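(* Let $\omega$ be a weight on $\mathbb D$ such that $\mathcal D(\omega)\subset H^2$. Then $\mathcal D^h(\omega)$ (identified, through Poisson extension, with a space of harmonic functions on $\mathbb D$) is a reproducing kernel Hilbert space, and every $f\in\mathcal D^h(\omega)$ admits the representation $$P[f](z)=\big\langle f,\;2\,\mathrm{Re}\,k^\omega(\cdot,z)-1\big\rangle_{\mathcal D^h(\omega)},\qquad z\in\mathbb D.$$
   Context: $\mathbb D$ is the open unit disk, $\mathbb T$ the unit circle, $dA$ the normalized area measure on $\mathbb D$, $m$ the normalized Lebesgue measure on $\mathbb T$, $L^2(\mathbb T)=L^2(\mathbb T,m)$. A weight is a measurable function $\omega:\mathbb D\to[0,\infty)$ with $\int_{\mathbb D}\omega\,dA<\infty$. For $f\in L^2(\mathbb T)$, $P[f]$ is its Poisson extension to $\mathbb D$. The gradient is normalized by $\nabla u=(\partial u,\bar\partial u)$, so $|\nabla u|^2=|\partial u|^2+|\bar\partial u|^2$ (hence $|\nabla u|=|u'|$ for holomorphic $u$). Put $\mathcal E_\omega(f,g)=\int_{\mathbb D}\nabla P[f]\cdot\overline{\nabla P[g]}\,\omega\,dA$ and $\mathcal D^h(\omega)=\{f\in L^2(\mathbb T):\mathcal E_\omega(f,f)<\infty\}$, with inner product $\langle f,g\rangle_{\mathcal D^h(\omega)}=\langle f,g\rangle_{L^2(\mathbb T)}+\mathcal E_\omega(f,g)$. $\mathcal D(\omega)$ is the space of holomorphic $f$ on $\mathbb D$ with $\mathcal D_\omega(f)=\int_{\mathbb D}|f'|^2\omega\,dA<\infty$.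 When $\mathcal D(\omega)\subset H^2$ (the Hardy space), $\mathcal D(\omega)$ with norm $\|f\|_\omega^2=\|f\|_{H^2}^2+\mathcal D_\omega(f)$ is a reproducing kernel Hilbert space on $\mathbb D$ with kernel $k^\omega$, i.e. $f(z)=\langle f,k^\omega(\cdot,z)\rangle_\omega$ for $f\in\mathcal D(\omega)$. Elements of $H^2$ are identified with their boundary functions in $L^2(\mathbb T)$. *)

theory Defs
  imports "HOL-Analysis.Analysis"
begin

section \<open>Reproducing kernel Hilbert spaces\<close>

text \<open>A Hilbert space of complex-valued functions on a set \<open>X\<close> is given by a carrier \<open>H\<close> and an
  inner product \<open>ip\<close>, linear in its first argument. Functions on \<open>X\<close> are extended by \<open>0\<close> outside
  \<open>X\<close>, so that equality of functions is equality on \<open>X\<close>.\<close>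

definition function_space_on :: "'a set \<Rightarrow> ('a \<Rightarrow> complex) set \<Rightarrow> bool" where
  "function_space_on X H \<longleftrightarrow>
     (\<forall>u\<in>H. \<forall>x. x \<notin> X \<longrightarrow> u x = 0) \<and>
     (\<lambda>x. 0) \<in> H \<and>
     (\<forall>u\<in>H. \<forall>v\<in>H. (\<lambda>x. u x + v x) \<in> H) \<and>
     (\<forall>c. \<forall>u\<in>H. (\<lambda>x. c * u x) \<in> H)"

definition inner_product_on ::
  "('a \<Rightarrow> complex) set \<Rightarrow> (('a \<Rightarrow> complex) \<Rightarrow> ('a \<Rightarrow> complex) \<Rightarrow> complex) \<Rightarrow> bool" where
  "inner_product_on H ip \<longleftrightarrow>
     (\<forall>u\<in>H. \<forall>v\<in>H. \<forall>w\<in>H. ip (\<lambda>x. u x + v x) w = ip u w + ip v w) \<and>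
     (\<forall>c. \<forall>u\<in>H. \<forall>w\<in>H. ip (\<lambda>x. c * u x) w = c * ip u w) \<and>
     (\<forall>u\<in>H. \<forall>v\<in>H. ip v u = cnj (ip u v)) \<and>
     (\<forall>u\<in>H. 0 \<le> Re (ip u u)) \<and>
     (\<forall>u\<in>H. ip u u = 0 \<longrightarrow> u = (\<lambda>x. 0))"

definition ip_norm ::
  "(('a \<Rightarrow> complex) \<Rightarrow> ('a \<Rightarrow> complex) \<Rightarrow> complex) \<Rightarrow> ('a \<Rightarrow> complex) \<Rightarrow> real" where
  "ip_norm ip u = sqrt (Re (ip u u))"

definition complete_on ::
  "('a \<Rightarrow> complex) set \<Rightarrow> (('a \<Rightarrow> complex) \<Rightarrow> ('a \<Rightarrow> complex) \<Rightarrow> complex) \<Rightarrow> bool" where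
  "complete_on H ip \<longleftrightarrow>
     (\<forall>s :: nat \<Rightarrow> 'a \<Rightarrow> complex.
        (\<forall>n. s n \<in> H) \<and>
        (\<forall>e>0. \<exists>N. \<forall>m\<ge>N. \<forall>n\<ge>N. ip_norm ip (\<lambda>x. s m x - s n x) < e) \<longrightarrow>
        (\<exists>u\<in>H. (\<lambda>n. ip_norm ip (\<lambda>x. s n x - u x)) \<longlonglongrightarrow> 0))"

definition rkhs_on ::
  "'a set \<Rightarrow> ('a \<Rightarrow> complex) set \<Rightarrow> (('a \<Rightarrow> complex) \<Rightarrow> ('a \<Rightarrow> complex) \<Rightarrow> complex) \<Rightarrow> bool" where
  "rkhs_on X H ip \<longleftrightarrow>
     function_space_on X H \<and> inner_product_on H ip \<and> complete_on H ip \<and>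
     (\<forall>x\<in>X. \<exists>C. \<forall>u\<in>H. cmod (u x) \<le> C * ip_norm ip u)"

definition reproducing_kernel ::
  "'a set \<Rightarrow> ('a \<Rightarrow> complex) set \<Rightarrow> (('a \<Rightarrow> complex) \<Rightarrow> ('a \<Rightarrow> complex) \<Rightarrow> complex) \<Rightarrow>
     ('a \<Rightarrow> 'a \<Rightarrow> complex) \<Rightarrow> bool" where
  "reproducing_kernel X H ip k \<longleftrightarrow>
     (\<forall>z\<in>X. (\<lambda>w. k w z) \<in> H \<and> (\<forall>f\<in>H. f z = ip f (\<lambda>w. k w z)))"


section \<open>The disk, the circle and weights\<close>

abbreviation unit_disk :: "complex set" where
  "unit_disk \<equiv> ball 0 1"

definition area :: "complex measure" where
  "area = uniform_measure (lebesgue_on unit_disk) unit_disk"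

text \<open>The normalized Lebesgue measure on the unit circle, as a measure with space \<open>sphere 0 1\<close>.\<close>

definition circle :: "complex measure" where
  "circle = completion
     (distr (uniform_measure lborel {0..2 * pi}) (restrict_space borel (sphere 0 1)) cis)"

definition weight :: "(complex \<Rightarrow> real) \<Rightarrow> bool" where
  "weight \<omega> \<longleftrightarrow>
     \<omega> \<in> borel_measurable area \<and> (\<forall>z\<in>unit_disk. 0 \<le> \<omega> z) \<and>
     (\<integral>\<^sup>+ z. ennreal (\<omega> z) \<partial>area) < \<infinity>"

text \<open>The elements of \<open>L2_circle\<close> are representatives: two functions that agree almost everywhere
  on the circle stand for the same element of $L^2$.\<close>

definition L2_circle :: "(complex \<Rightarrow> complex) set" where
  "L2_circle = {f \<in> borel_measurable circle. (\<integral>\<^sup>+ \<zeta>. ennreal ((cmod (f \<zeta>))\<^sup>2) \<partial>circle) < \<infinity>}"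

definition L2_ip :: "(complex \<Rightarrow> complex) \<Rightarrow> (complex \<Rightarrow> complex) \<Rightarrow> complex" where
  "L2_ip f g = (\<integral>\<zeta>. f \<zeta> * cnj (g \<zeta>) \<partial>circle)"

definition poisson :: "(complex \<Rightarrow> complex) \<Rightarrow> complex \<Rightarrow> complex" where
  "poisson f z =
     (if z \<in> unit_disk
      then \<integral>\<zeta>. complex_of_real ((1 - (cmod z)\<^sup>2) / (cmod (\<zeta> - z))\<^sup>2) * f \<zeta> \<partial>circle
      else 0)"


section \<open>Derivatives and harmonicity\<close>

definition partial_x :: "(complex \<Rightarrow> complex) \<Rightarrow> complex \<Rightarrow> complex" where
  "partial_x u z = frechet_derivative u (at z) 1"

definition partial_y :: "(complex \<Rightarrow> complex) \<Rightarrow> complex \<Rightarrow> complex" where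
  "partial_y u z = frechet_derivative u (at z) \<i>"

text \<open>The Wirtinger derivatives $\partial u$ and $\bar\partial u$.\<close>

definition dz :: "(complex \<Rightarrow> complex) \<Rightarrow> complex \<Rightarrow> complex" where
  "dz u z = (partial_x u z - \<i> * partial_y u z) / 2"

definition dzbar :: "(complex \<Rightarrow> complex) \<Rightarrow> complex \<Rightarrow> complex" where
  "dzbar u z = (partial_x u z + \<i> * partial_y u z) / 2"

text \<open>Harmonic on an open set: twice continuously differentiable with vanishing Laplacian.\<close>

definition harmonic_on :: "(complex \<Rightarrow> complex) \<Rightarrow> complex set \<Rightarrow> bool" where
  "harmonic_on u S \<longleftrightarrow>
     (\<forall>z\<in>S. u differentiable (at z) \<and>
        partial_x u differentiable (at z) \<and> partial_y u differentiable (at z)) \<and>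
     continuous_on S (partial_x (partial_x u)) \<and> continuous_on S (partial_y (partial_x u)) \<and>
     continuous_on S (partial_x (partial_y u)) \<and> continuous_on S (partial_y (partial_y u)) \<and>
     (\<forall>z\<in>S. partial_x (partial_x u) z + partial_y (partial_y u) z = 0)"


section \<open>The harmonic weighted Dirichlet space\<close>

definition energy ::
  "(complex \<Rightarrow> real) \<Rightarrow> (complex \<Rightarrow> complex) \<Rightarrow> (complex \<Rightarrow> complex) \<Rightarrow> complex" where
  "energy \<omega> f g =
     (\<integral>z. (dz (poisson f) z * cnj (dz (poisson g) z) +
           dzbar (poisson f) z * cnj (dzbar (poisson g) z)) * complex_of_real (\<omega> z) \<partial>area)"

definition Dh :: "(complex \<Rightarrow> real) \<Rightarrow> (complex \<Rightarrow> complex) set" where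
  "Dh \<omega> = {f \<in> L2_circle.
     (\<integral>\<^sup>+ z. ennreal (((cmod (dz (poisson f) z))\<^sup>2 + (cmod (dzbar (poisson f) z))\<^sup>2) * \<omega> z) \<partial>area)
       < \<infinity>}"

definition Dh_ip ::
  "(complex \<Rightarrow> real) \<Rightarrow> (complex \<Rightarrow> complex) \<Rightarrow> (complex \<Rightarrow> complex) \<Rightarrow> complex" where
  "Dh_ip \<omega> f g = L2_ip f g + energy \<omega> f g"

text \<open>The same space as a space of functions on the disk, with the inner product transported along
  the Poisson extension.\<close>

definition Dh_disk :: "(complex \<Rightarrow> real) \<Rightarrow> (complex \<Rightarrow> complex) set" where
  "Dh_disk \<omega> = poisson ` Dh \<omega>"

definition Dh_disk_ip ::
  "(complex \<Rightarrow> real) \<Rightarrow> (complex \<Rightarrow> complex) \<Rightarrow> (complex \<Rightarrow> complex) \<Rightarrow> complex" where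
  "Dh_disk_ip \<omega> u v = Dh_ip \<omega> (inv_into (Dh \<omega>) poisson u) (inv_into (Dh \<omega>) poisson v)"


section \<open>The Hardy space and the holomorphic weighted Dirichlet space\<close>

text \<open>In this section only the values of a function on the disk matter.\<close>

definition Hardy2 :: "(complex \<Rightarrow> complex) set" where
  "Hardy2 = {f. f holomorphic_on unit_disk \<and>
     (\<exists>C. \<forall>r\<in>{0..<1}. (\<integral>\<zeta>. (cmod (f (complex_of_real r * \<zeta>)))\<^sup>2 \<partial>circle) \<le> C)}"

text \<open>The boundary function of \<open>f\<close>: the limit in $L^2$ of the dilates $\zeta \mapsto f(r\zeta)$ as
  $r \to 1^-$. It is determined up to equality almost everywhere.\<close>

definition boundary :: "(complex \<Rightarrow> complex) \<Rightarrow> complex \<Rightarrow> complex" where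
  "boundary f = (SOME \<phi>. \<phi> \<in> L2_circle \<and>
     ((\<lambda>r. \<integral>\<^sup>+ \<zeta>. ennreal ((cmod (f (complex_of_real r * \<zeta>) - \<phi> \<zeta>))\<^sup>2) \<partial>circle) \<longlongrightarrow> 0) (at_left 1))"

definition Dhol :: "(complex \<Rightarrow> real) \<Rightarrow> (complex \<Rightarrow> complex) set" where
  "Dhol \<omega> = {f. f holomorphic_on unit_disk \<and>
     (\<integral>\<^sup>+ z. ennreal ((cmod (deriv f z))\<^sup>2 * \<omega> z) \<partial>area) < \<infinity>}"

definition Dhol_ip ::
  "(complex \<Rightarrow> real) \<Rightarrow> (complex \<Rightarrow> complex) \<Rightarrow> (complex \<Rightarrow> complex) \<Rightarrow> complex" where
  "Dhol_ip \<omega> f g =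
     L2_ip (boundary f) (boundary g) +
     (\<integral>z. deriv f z * cnj (deriv g z) * complex_of_real (\<omega> z) \<partial>area)"

text \<open>The reproducing kernel of \<open>Dhol \<omega>\<close>; its values on the disk are uniquely determined whenever
  \<open>Dhol \<omega> \<subseteq> Hardy2\<close>.\<close>

definition Dhol_kernel :: "(complex \<Rightarrow> real) \<Rightarrow> complex \<Rightarrow> complex \<Rightarrow> complex" where
  "Dhol_kernel \<omega> = (SOME k. reproducing_kernel unit_disk (Dhol \<omega>) (Dhol_ip \<omega>) k)"

end

theory Submission
  imports Defs "HOL-Complex_Analysis.Complex_Analysis" "HOL-Probability.Probability_Measure"
begin

text \<open>Expanding the Poisson kernel as a sum of two geometric series writes the Poisson integral of an
  $L^2$ function \<open>f\<close> as \<open>h + cnj g\<close>, where \<open>h = szego f\<close> and \<open>g = antiszego f\<close> are holomorphic and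
  \<open>g 0 = 0\<close> (\<open>poisson_eq_szego\<close>). The Wirtinger derivatives of the Poisson integral are \<open>h'\<close> and
  \<open>cnj g'\<close>, so \<open>f\<close> has finite energy exactly when \<open>h\<close> and \<open>g\<close> belong to \<open>Dhol \<omega>\<close>
  (\<open>Dh_iff_Dhol\<close>). The inclusion of \<open>Dhol \<omega>\<close> in $H^2$ then provides boundary functions of \<open>h\<close> and
  \<open>g\<close>, and \<open>f\<close> is the sum of the first and the conjugate of the second.

  The representation formula is obtained by multiplying out. In the energy the mixed terms
  vanish, and on the circle the mixed terms are integrals of products of two $H^2$ boundary functions,
  equal to products of values at \<open>0\<close> (\<open>boundary_mult_integral\<close>). This gives
  \<open>\<langle>h + cnj g, k + cnj l\<rangle> = \<langle>h, k\<rangle> + cnj \<langle>g, l\<rangle> + h 0 * l 0 + cnj (g 0 * k 0)\<close> with the inner products of \<open>Dhol \<omega>\<close> on the right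
  (\<open>Dh_ip_decomposition\<close>). If \<open>k\<close> is the kernel of \<open>Dhol \<omega>\<close> at \<open>z\<close>, then \<open>k 0 = 1\<close>, because the constant
  \<open>1\<close> is reproduced, and \<open>2 * Re k - 1 = k + cnj (k - 1)\<close>; so the inner product with \<open>f\<close> is
  \<open>h z + cnj (g z)\<close> (\<open>Dh_representation\<close>).

  Three facts support this. The harmonic space is complete (\<open>Dh_disk_complete\<close>): convergence in
  $L^2$ on the circle forces pointwise convergence of gradients in the disk by the Cauchy estimates, and
  Fatou's lemma does the rest. The kernel of \<open>Dhol \<omega>\<close> exists (\<open>Dhol_kernel_exists\<close>): evaluation at a point
  is bounded already in the $L^2$ norm, the Riesz representation theorem in the harmonic space
  represents it, and the holomorphic part of the representing function is the kernel. Finally, a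
  function is determined almost everywhere by its Poisson integral (\<open>poisson_eq_iff\<close>), because an
  integrable function on the circle is determined by its Fourier coefficients.\<close>

section \<open>Square-integrable functions\<close>

text \<open>All three Cauchy--Schwarz type estimates below have this form: a quadratic that is nowhere
  negative has a non-positive discriminant.\<close>

lemma discriminant_bound:
  fixes a b c :: real
  assumes "\<And>t. 0 \<le> a - 2 * t * b + t\<^sup>2 * c" and "0 \<le> c"
  shows "b\<^sup>2 \<le> a * c"
proof (cases "c = 0")
  case True
  have "b = 0"
  proof (rule ccontr)
    assume "b \<noteq> 0"
    then show False
      using assms(1)[of "(a + 1) / (2 * b)"] True by simp
  qed
  then show ?thesis using True by simp
next
  case False
  then have c: "0 < c" using assms(2) by simp
  have "0 \<le> a - b\<^sup>2 / c"
    using assms(1)[of "b / c"] c by (simp add: field_simps power2_eq_square)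
  then show ?thesis using c by (simp add: field_simps)
qed

definition L2 :: "'a measure \<Rightarrow> ('a \<Rightarrow> complex) set" where
  "L2 M = {f \<in> borel_measurable M. integrable M (\<lambda>x. (cmod (f x))\<^sup>2)}"

definition l2norm :: "'a measure \<Rightarrow> ('a \<Rightarrow> complex) \<Rightarrow> real" where
  "l2norm M f = sqrt (\<integral>x. (cmod (f x))\<^sup>2 \<partial>M)"

lemma L2D [measurable_dest]: "f \<in> L2 M \<Longrightarrow> f \<in> borel_measurable M"
  by (simp add: L2_def)

lemma L2_cmod2: "f \<in> L2 M \<Longrightarrow> integrable M (\<lambda>x. (cmod (f x))\<^sup>2)"
  by (simp add: L2_def)

lemma L2_iff_nn:
  "f \<in> L2 M \<longleftrightarrow>
     f \<in> borel_measurable M \<and> (\<integral>\<^sup>+x. ennreal ((cmod (f x))\<^sup>2) \<partial>M) < \<infinity>"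
  unfolding L2_def mem_Collect_eq
  by (intro conj_cong refl) (simp add: integrable_iff_bounded)

lemma l2norm_nonneg [simp]: "0 \<le> l2norm M f"
  by (simp add: l2norm_def)

lemma l2norm_power2: "(l2norm M f)\<^sup>2 = (\<integral>x. (cmod (f x))\<^sup>2 \<partial>M)"
  by (simp add: l2norm_def)

lemma nn_integral_l2norm:
  "f \<in> L2 M \<Longrightarrow> (\<integral>\<^sup>+x. ennreal ((cmod (f x))\<^sup>2) \<partial>M) = ennreal ((l2norm M f)\<^sup>2)"
  unfolding l2norm_power2 by (intro nn_integral_eq_integral L2_cmod2) auto

lemma L2_mult:
  assumes "f \<in> L2 M" "g \<in> L2 M"
  shows "integrable M (\<lambda>x. f x * g x)"
proof (rule Bochner_Integration.integrable_bound)
  show "integrable M (\<lambda>x. (cmod (f x))\<^sup>2 + (cmod (g x))\<^sup>2)"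
    using assms by (intro Bochner_Integration.integrable_add L2_cmod2)
  show "(\<lambda>x. f x * g x) \<in> borel_measurable M" using assms by measurable
  show "AE x in M. cmod (f x * g x) \<le> norm ((cmod (f x))\<^sup>2 + (cmod (g x))\<^sup>2)"
  proof (intro AE_I2)
    fix x
    have "2 * (cmod (f x) * cmod (g x)) \<le> (cmod (f x))\<^sup>2 + (cmod (g x))\<^sup>2"
      using sum_squares_bound[of "cmod (f x)" "cmod (g x)"] by simp
    moreover have "0 \<le> cmod (f x) * cmod (g x)" by simp
    ultimately show "cmod (f x * g x) \<le> norm ((cmod (f x))\<^sup>2 + (cmod (g x))\<^sup>2)"
      by (simp only: norm_mult real_norm_def)
  qed
qed

lemma L2_cmult:
  assumes "f \<in> L2 M" shows "(\<lambda>x. c * f x) \<in> L2 M"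
proof -
  have "(\<lambda>x. c * f x) \<in> borel_measurable M" using assms by measurable
  moreover have "integrable M (\<lambda>x. (cmod c)\<^sup>2 * (cmod (f x))\<^sup>2)"
    using assms by (intro integrable_mult_right L2_cmod2)
  ultimately show ?thesis by (simp add: L2_def norm_mult power_mult_distrib)
qed

lemma borel_measurable_cnj [measurable (raw)]:
  "f \<in> borel_measurable M \<Longrightarrow> (\<lambda>x. cnj (f x)) \<in> borel_measurable M"
  by (rule borel_measurable_continuous_on[where f = cnj]) (intro continuous_intros)

lemma L2_cnj:
  assumes "f \<in> L2 M" shows "(\<lambda>x. cnj (f x)) \<in> L2 M"
  unfolding L2_def mem_Collect_eq complex_mod_cnj
  by (intro conjI borel_measurable_cnj L2D L2_cmod2 assms)

lemma integrable_ip: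
  assumes "f \<in> L2 M" "g \<in> L2 M"
  shows "integrable M (\<lambda>x. f x * cnj (g x))"
  using L2_mult[OF assms(1) L2_cnj[OF assms(2)]] .

lemma L2_add:
  assumes f: "f \<in> L2 M" and g: "g \<in> L2 M"
  shows "(\<lambda>x. f x + g x) \<in> L2 M"
proof -
  have "(\<lambda>x. f x + g x) \<in> borel_measurable M" using assms by measurable
  moreover have "integrable M (\<lambda>x. Re (f x * cnj (f x) + f x * cnj (g x) + g x * cnj (f x) + g x * cnj (g x)))"
    using f g by (intro integrable_Re Bochner_Integration.integrable_add integrable_ip)
  moreover have "Re (f x * cnj (f x) + f x * cnj (g x) + g x * cnj (f x) + g x * cnj (g x)) = (cmod (f x + g x))\<^sup>2" for x
    unfolding cmod_power2 by (simp add: power2_eq_square algebra_simps)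
  ultimately show ?thesis by (simp add: L2_def)
qed

lemma L2_diff:
  assumes f: "f \<in> L2 M" and g: "g \<in> L2 M"
  shows "(\<lambda>x. f x - g x) \<in> L2 M"
  using L2_add[OF f L2_cmult[OF g, of "-1"]] by simp

lemma l2_cauchy_schwarz_cmod:
  assumes f: "f \<in> L2 M" and g: "g \<in> L2 M"
  shows "(\<integral>x. cmod (f x * g x) \<partial>M) \<le> l2norm M f * l2norm M g"
proof -
  have fg: "integrable M (\<lambda>x. cmod (f x * g x))"
    by (intro integrable_norm L2_mult f g)
  have "(\<integral>x. cmod (f x * g x) \<partial>M)\<^sup>2 \<le> (l2norm M f)\<^sup>2 * (l2norm M g)\<^sup>2"
  proof (rule discriminant_bound)
    fix t :: real
    have "0 \<le> (\<integral>x. (cmod (f x) - t * cmod (g x))\<^sup>2 \<partial>M)"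
      by (intro integral_nonneg_AE) auto
    also have "\<dots> = (\<integral>x. (cmod (f x))\<^sup>2 - 2 * t * cmod (f x * g x) + t\<^sup>2 * (cmod (g x))\<^sup>2 \<partial>M)"
      by (intro Bochner_Integration.integral_cong)
         (auto simp: power2_eq_square norm_mult algebra_simps)
    also have "\<dots> = (l2norm M f)\<^sup>2 - 2 * t * (\<integral>x. cmod (f x * g x) \<partial>M) + t\<^sup>2 * (l2norm M g)\<^sup>2"
      using fg L2_cmod2[OF f] L2_cmod2[OF g]
      by (simp add: l2norm_power2)
    finally show "0 \<le> (l2norm M f)\<^sup>2 - 2 * t * (\<integral>x. cmod (f x * g x) \<partial>M) + t\<^sup>2 * (l2norm M g)\<^sup>2" .
  qed simp
  then have "(\<integral>x. cmod (f x * g x) \<partial>M)\<^sup>2 \<le> (l2norm M f * l2norm M g)\<^sup>2"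
    by (simp add: power_mult_distrib)
  then show ?thesis by (rule power2_le_imp_le) simp
qed

lemma l2_cauchy_schwarz:
  assumes f: "f \<in> L2 M" and g: "g \<in> L2 M"
  shows "cmod (\<integral>x. f x * g x \<partial>M) \<le> l2norm M f * l2norm M g"
  using integral_norm_bound[of M "\<lambda>x. f x * g x"] l2_cauchy_schwarz_cmod[OF assms] by linarith

lemma l2norm_triangle:
  assumes f: "f \<in> L2 M" and g: "g \<in> L2 M"
  shows "l2norm M (\<lambda>x. f x + g x) \<le> l2norm M f + l2norm M g"
proof (rule power2_le_imp_le)
  have fg: "integrable M (\<lambda>x. cmod (f x * g x))"
    by (intro integrable_norm L2_mult f g)
  have "(l2norm M (\<lambda>x. f x + g x))\<^sup>2 \<le> (\<integral>x. (cmod (f x))\<^sup>2 + 2 * cmod (f x * g x) + (cmod (g x))\<^sup>2 \<partial>M)"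
    unfolding l2norm_power2
  proof (intro integral_mono)
    show "integrable M (\<lambda>x. (cmod (f x + g x))\<^sup>2)"
      by (intro L2_cmod2 L2_add f g)
    fix x
    have "(cmod (f x + g x))\<^sup>2 \<le> (cmod (f x) + cmod (g x))\<^sup>2"
      by (intro power_mono norm_triangle_ineq) auto
    then show "(cmod (f x + g x))\<^sup>2 \<le> (cmod (f x))\<^sup>2 + 2 * cmod (f x * g x) + (cmod (g x))\<^sup>2"
      by (simp add: power2_sum norm_mult)
  qed (use fg L2_cmod2[OF f] L2_cmod2[OF g] in auto)
  also have "\<dots> = (l2norm M f)\<^sup>2 + 2 * (\<integral>x. cmod (f x * g x) \<partial>M) + (l2norm M g)\<^sup>2"
    using fg L2_cmod2[OF f] L2_cmod2[OF g] by (simp add: l2norm_power2)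
  also have "\<dots> \<le> (l2norm M f + l2norm M g)\<^sup>2"
    using l2_cauchy_schwarz_cmod[OF f g] by (simp add: power2_sum)
  finally show "(l2norm M (\<lambda>x. f x + g x))\<^sup>2 \<le> (l2norm M f + l2norm M g)\<^sup>2" .
qed simp

definition l2_Cauchy :: "'a measure \<Rightarrow> (nat \<Rightarrow> 'a \<Rightarrow> complex) \<Rightarrow> bool" where
  "l2_Cauchy M u \<longleftrightarrow>
     (\<forall>e>0. \<exists>N. \<forall>m\<ge>N. \<forall>n\<ge>N. l2norm M (\<lambda>x. u m x - u n x) < e)"

lemma l2_CauchyD:
  assumes "l2_Cauchy M u" "e > 0"
  obtains N where "\<And>m n. m \<ge> N \<Longrightarrow> n \<ge> N \<Longrightarrow> l2norm M (\<lambda>x. u m x - u n x) < e"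
  using assms unfolding l2_Cauchy_def by blast

text \<open>Fatou's lemma. The pointwise limit may be known beforehand, as it is for the gradients of Poisson
  integrals; the lemma then identifies it as the limit in norm.\<close>

lemma l2_Cauchy_pointwise_limit:
  assumes u: "\<And>n. u n \<in> L2 M" and v [measurable]: "v \<in> borel_measurable M"
    and lim: "AE x in M. (\<lambda>n. u n x) \<longlonglongrightarrow> v x" and C: "l2_Cauchy M u"
  shows "v \<in> L2 M" "(\<lambda>n. l2norm M (\<lambda>x. u n x - v x)) \<longlonglongrightarrow> 0"
proof -
  have [measurable]: "u n \<in> borel_measurable M" for n using u by measurable
  have key: "\<exists>N. \<forall>n\<ge>N. (\<lambda>x. u n x - v x) \<in> L2 M \<and> l2norm M (\<lambda>x. u n x - v x) \<le> e"
    if "e > 0" for e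
  proof -
    obtain N where N: "\<And>m n. m \<ge> N \<Longrightarrow> n \<ge> N \<Longrightarrow> l2norm M (\<lambda>x. u m x - u n x) < e"
      using l2_CauchyD[OF C \<open>e > 0\<close>] by blast
    have "(\<lambda>x. u n x - v x) \<in> L2 M \<and> l2norm M (\<lambda>x. u n x - v x) \<le> e" if n: "n \<ge> N" for n
    proof -
      have "(\<integral>\<^sup>+x. ennreal ((cmod (u n x - v x))\<^sup>2) \<partial>M) =
            (\<integral>\<^sup>+x. liminf (\<lambda>m. ennreal ((cmod (u n x - u m x))\<^sup>2)) \<partial>M)"
        using lim
      proof (intro nn_integral_cong_AE, eventually_elim)
        fix x assume "(\<lambda>m. u m x) \<longlonglongrightarrow> v x"
        then have "(\<lambda>m. ennreal ((cmod (u n x - u m x))\<^sup>2)) \<longlonglongrightarrow> ennreal ((cmod (u n x - v x))\<^sup>2)"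
          by (intro tendsto_intros tendsto_ennrealI)
        then show "ennreal ((cmod (u n x - v x))\<^sup>2) = liminf (\<lambda>m. ennreal ((cmod (u n x - u m x))\<^sup>2))"
          by (intro lim_imp_Liminf[symmetric]) auto
      qed
      also have "\<dots> \<le> liminf (\<lambda>m. \<integral>\<^sup>+x. ennreal ((cmod (u n x - u m x))\<^sup>2) \<partial>M)"
        by (intro nn_integral_liminf) measurable
      also have "\<dots> \<le> ennreal (e\<^sup>2)"
      proof (rule Liminf_le)
        show "\<forall>\<^sub>F m in sequentially. (\<integral>\<^sup>+x. ennreal ((cmod (u n x - u m x))\<^sup>2) \<partial>M) \<le> ennreal (e\<^sup>2)"
          using eventually_ge_at_top[of N]
        proof eventually_elim
          fix m assume "m \<ge> N"
          then have "l2norm M (\<lambda>x. u n x - u m x) < e" using N n by blast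
          then have "(l2norm M (\<lambda>x. u n x - u m x))\<^sup>2 \<le> e\<^sup>2"
            by (intro power_mono) auto
          then show "(\<integral>\<^sup>+x. ennreal ((cmod (u n x - u m x))\<^sup>2) \<partial>M) \<le> ennreal (e\<^sup>2)"
            by (subst nn_integral_l2norm[OF L2_diff[OF u u]]) (rule ennreal_leI)
        qed
      qed simp
      finally have le: "(\<integral>\<^sup>+x. ennreal ((cmod (u n x - v x))\<^sup>2) \<partial>M) \<le> ennreal (e\<^sup>2)" .
      then have sq: "(\<lambda>x. u n x - v x) \<in> L2 M"
        by (auto simp: L2_iff_nn intro: le_less_trans)
      then have "(l2norm M (\<lambda>x. u n x - v x))\<^sup>2 \<le> e\<^sup>2"
        using le nn_integral_l2norm[OF sq] by (simp add: ennreal_le_iff)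
      then show ?thesis using sq \<open>e > 0\<close> by (auto intro: power2_le_imp_le)
    qed
    then show ?thesis by blast
  qed
  obtain N where "(\<lambda>x. u N x - v x) \<in> L2 M" using key[of 1] by auto
  from L2_diff[OF u[of N] this] show "v \<in> L2 M" by simp
  show "(\<lambda>n. l2norm M (\<lambda>x. u n x - v x)) \<longlonglongrightarrow> 0"
  proof (rule LIMSEQ_I)
    fix r :: real assume "0 < r"
    then obtain N where "\<forall>n\<ge>N. l2norm M (\<lambda>x. u n x - v x) \<le> r / 2"
      using key[of "r / 2"] by auto
    then show "\<exists>N. \<forall>n\<ge>N. norm (l2norm M (\<lambda>x. u n x - v x) - 0) < r"
      using \<open>0 < r\<close> by (intro exI[of _ N]) fastforce
  qed
qed

lemma (in prob_space) L2_bounded: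
  assumes "f \<in> borel_measurable M" "\<And>x. x \<in> space M \<Longrightarrow> cmod (f x) \<le> B"
  shows "f \<in> L2 M"
proof -
  have "integrable M (\<lambda>x. (cmod (f x))\<^sup>2)"
  proof (rule integrable_const_bound[where B = "B\<^sup>2"])
    show "AE x in M. norm ((cmod (f x))\<^sup>2) \<le> B\<^sup>2"
      using assms(2) by (intro AE_I2) (auto intro: power_mono)
  qed (use assms in measurable)
  then show ?thesis using assms by (simp add: L2_def)
qed

lemma (in prob_space) L2_const: "(\<lambda>_. c) \<in> L2 M"
  by (rule L2_bounded[where B = "cmod c"]) auto

lemma (in prob_space) L2_imp_integrable:
  assumes "f \<in> L2 M" shows "integrable M f"
  using L2_mult[OF assms L2_const[of 1]] by simp

lemma (in prob_space) l1_le_l2norm: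
  assumes "f \<in> L2 M" shows "(\<integral>x. cmod (f x) \<partial>M) \<le> l2norm M f"
proof -
  have "l2norm M (\<lambda>_. 1) = 1" by (simp add: l2norm_def prob_space)
  then show ?thesis
    using l2_cauchy_schwarz_cmod[OF assms L2_const[of 1]] by simp
qed

text \<open>The Riesz--Fischer theorem. A subsequence with geometrically decreasing increments converges almost
  everywhere, because on a probability space the $L^1$ norms of the increments are dominated by
  their $L^2$ norms.\<close>

lemma (in prob_space) l2_Cauchy_convergent:
  assumes u: "\<And>n. u n \<in> L2 M" and C: "l2_Cauchy M u"
  obtains v where "v \<in> L2 M" "(\<lambda>n. l2norm M (\<lambda>x. u n x - v x)) \<longlonglongrightarrow> 0"
proof -
  have [measurable]: "u n \<in> borel_measurable M" for n using u by measurable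
  define P where "P k N \<longleftrightarrow> (\<forall>m\<ge>N. \<forall>n\<ge>N. l2norm M (\<lambda>x. u m x - u n x) < (1/2)^k)" for k N
  have ex: "\<exists>N. P k N" for k
    unfolding P_def by (rule l2_CauchyD[OF C, of "(1/2)^k"]) (simp, blast)
  define N where "N k = (SOME N. P k N)" for k
  have PN: "P k (N k)" for k unfolding N_def using ex by (rule someI_ex)
  \<comment> \<open>partial sums make the subsequence strictly increasing and keep it above \<open>N\<close>\<close>
  define s where "s k = (\<Sum>i\<le>k. N i + 1)" for k
  have s_ge: "N k \<le> s k" for k
    by (induction k) (auto simp: s_def)
  have s_mono: "strict_mono s" by (rule strict_monoI_Suc) (simp add: s_def)
  define d where "d k x = u (s (Suc k)) x - u (s k) x" for k x
  have d_sq: "d k \<in> L2 M" for k unfolding d_def by (intro L2_diff u)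
  have [measurable]: "d k \<in> borel_measurable M" for k using d_sq by measurable
  have d_le: "(\<integral>x. cmod (d k x) \<partial>M) \<le> (1/2)^k" for k
  proof -
    have "s (Suc k) \<ge> s k" using s_mono by (simp add: strict_mono_leD)
    then have "l2norm M (d k) < (1/2)^k"
      using PN[of k] s_ge[of k] unfolding P_def d_def by (meson order_trans)
    then show ?thesis using l1_le_l2norm[OF d_sq] by (meson less_imp_le order_trans)
  qed
  have "(\<integral>\<^sup>+x. (\<Sum>k. ennreal (cmod (d k x))) \<partial>M) = (\<Sum>k. \<integral>\<^sup>+x. ennreal (cmod (d k x)) \<partial>M)"
    by (intro nn_integral_suminf) measurable
  also have "\<dots> = (\<Sum>k. ennreal (\<integral>x. cmod (d k x) \<partial>M))"
    using d_sq by (intro suminf_cong nn_integral_eq_integral integrable_norm L2_imp_integrable) auto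
  also have "\<dots> \<le> (\<Sum>k. ennreal ((1/2)^k))"
    by (intro suminf_le ennreal_leI d_le) auto
  also have "\<dots> = ennreal (\<Sum>k. (1/2)^k)"
    by (intro suminf_ennreal2 summable_geometric) auto
  also have "\<dots> < \<infinity>" by simp
  finally have "AE x in M. (\<Sum>k. ennreal (cmod (d k x))) \<noteq> \<infinity>"
    by (intro nn_integral_PInf_AE) auto
  then have ae: "AE x in M. (\<lambda>k. u (s k) x) \<longlonglongrightarrow> lim (\<lambda>k. u (s k) x)"
  proof eventually_elim
    fix x assume "(\<Sum>k. ennreal (cmod (d k x))) \<noteq> \<infinity>"
    then have "summable (\<lambda>k. cmod (d k x))" by (intro summable_suminf_not_top) auto
    then have "summable (\<lambda>k. d k x)" by (rule summable_norm_cancel)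
    then have "convergent (\<lambda>k. u (s k) x)"
    proof -
      have "u (s k) x = u (s 0) x + (\<Sum>i<k. d i x)" for k
        by (induction k) (auto simp: d_def)
      then have eq: "(\<lambda>k. u (s k) x) = (\<lambda>k. u (s 0) x + (\<Sum>i<k. d i x))" by (rule ext)
      have "convergent (\<lambda>k. u (s 0) x + (\<Sum>i<k. d i x))"
        using \<open>summable (\<lambda>k. d k x)\<close>
        by (simp add: convergent_add_const_iff summable_iff_convergent)
      then show ?thesis by (subst eq)
    qed
    then show "(\<lambda>k. u (s k) x) \<longlonglongrightarrow> lim (\<lambda>k. u (s k) x)" by (simp add: convergent_LIMSEQ_iff)
  qed
  define v where "v x = lim (\<lambda>k. u (s k) x)" for x
  have v [measurable]: "v \<in> borel_measurable M" unfolding v_def by measurable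
  have Cs: "l2_Cauchy M (\<lambda>k. u (s k))"
    unfolding l2_Cauchy_def
  proof (intro allI impI)
    fix e :: real assume "e > 0"
    then obtain K where "\<And>m n. m \<ge> K \<Longrightarrow> n \<ge> K \<Longrightarrow> l2norm M (\<lambda>x. u m x - u n x) < e"
      using l2_CauchyD[OF C] by blast
    then show "\<exists>K. \<forall>m\<ge>K. \<forall>n\<ge>K. l2norm M (\<lambda>x. u (s m) x - u (s n) x) < e"
      using seq_suble[OF s_mono] by (meson order_trans)
  qed
  have vsq: "v \<in> L2 M" and vlim: "(\<lambda>k. l2norm M (\<lambda>x. u (s k) x - v x)) \<longlonglongrightarrow> 0"
    using l2_Cauchy_pointwise_limit[OF u v _ Cs] ae unfolding v_def by auto
  have "(\<lambda>n. l2norm M (\<lambda>x. u n x - v x)) \<longlonglongrightarrow> 0"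
  proof (rule LIMSEQ_I)
    fix r :: real assume "0 < r"
    then obtain K where K: "\<And>m n. m \<ge> K \<Longrightarrow> n \<ge> K \<Longrightarrow> l2norm M (\<lambda>x. u m x - u n x) < r / 2"
      using l2_CauchyD[OF C, of "r / 2"] by auto
    obtain L where L: "\<And>k. k \<ge> L \<Longrightarrow> l2norm M (\<lambda>x. u (s k) x - v x) < r / 2"
      using LIMSEQ_D[OF vlim, of "r / 2"] \<open>0 < r\<close> by auto
    have "l2norm M (\<lambda>x. u n x - v x) < r" if "n \<ge> K" for n
    proof -
      define k where "k = max K L"
      have "s k \<ge> K" using seq_suble[OF s_mono, of k] unfolding k_def by linarith
      have "l2norm M (\<lambda>x. (u n x - u (s k) x) + (u (s k) x - v x)) < r"
        using l2norm_triangle[OF L2_diff[OF u u] L2_diff[OF u vsq], of n "s k" "s k"]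
          K[OF that \<open>s k \<ge> K\<close>] L[of k] unfolding k_def by simp
      then show ?thesis by simp
    qed
    then show "\<exists>N. \<forall>n\<ge>N. norm (l2norm M (\<lambda>x. u n x - v x) - 0) < r" by auto
  qed
  with vsq show ?thesis by (rule that)
qed

section \<open>Integration on the circle\<close>

text \<open>The measure \<open>circle\<close> before completion. Borel sets suffice for the monotone class argument
  below; the completion is treated separately.\<close>

definition borel_circle :: "complex measure" where
  "borel_circle = distr (uniform_measure lborel {0..2 * pi}) (restrict_space borel (sphere 0 1)) cis"

lemma circle_eq: "circle = completion borel_circle"
  by (simp add: circle_def borel_circle_def)

lemma cis_measurable [measurable]:
  "cis \<in> uniform_measure lborel {0..2 * pi} \<rightarrow>\<^sub>M restrict_space borel (sphere 0 1)"
proof (rule measurable_restrict_space2)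
  have "continuous_on UNIV cis" by (intro continuous_intros)
  then have "cis \<in> borel_measurable borel" by (rule borel_measurable_continuous_onI)
  then show "cis \<in> borel_measurable (uniform_measure lborel {0..2 * pi})" by simp
qed auto

lemma prob_space_borel_circle: "prob_space borel_circle"
  unfolding borel_circle_def
  by (intro prob_space.prob_space_distr prob_space_uniform_measure cis_measurable) auto

interpretation circle: prob_space circle
  unfolding circle_eq by (rule prob_space.prob_space_completion[OF prob_space_borel_circle])

lemma space_circle [simp]: "space circle = sphere 0 1"
  by (simp add: circle_eq borel_circle_def space_restrict_space)

lemma sets_borel_circle: "sets borel_circle = sets (restrict_space borel (sphere 0 1))"
  by (simp add: borel_circle_def)

lemma sets_circle_borel: "B \<in> sets borel \<Longrightarrow> B \<inter> sphere 0 1 \<in> sets circle"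
  unfolding circle_eq
  by (rule sets_completionI_sets) (auto simp: sets_borel_circle sets_restrict_space)

lemma borel_measurable_circle:
  fixes f :: "complex \<Rightarrow> 'a::topological_space"
  assumes "continuous_on (sphere 0 1) f" shows "f \<in> borel_measurable borel_circle" "f \<in> borel_measurable circle"
proof -
  have "f \<in> borel_measurable (restrict_space borel (sphere 0 1))"
    by (rule borel_measurable_continuous_on_restrict[OF assms])
  then show "f \<in> borel_measurable borel_circle"
    by (subst measurable_cong_sets[OF sets_borel_circle refl])
  then show "f \<in> borel_measurable circle"
    unfolding circle_eq by (rule measurable_completion)
qed

lemma continuous_circle_bound:
  fixes f :: "complex \<Rightarrow> complex"
  assumes "continuous_on (sphere 0 1) f"
  obtains B where "\<And>\<zeta>. \<zeta> \<in> sphere 0 1 \<Longrightarrow> cmod (f \<zeta>) \<le> B"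
proof -
  have "bounded (f ` sphere 0 1)"
    by (intro compact_imp_bounded compact_continuous_image assms) auto
  then obtain B where "\<forall>\<zeta>\<in>sphere 0 1. cmod (f \<zeta>) \<le> B" by (auto simp: bounded_iff)
  then show ?thesis by (intro that[of B]) blast
qed

lemma L2_continuous:
  assumes "continuous_on (sphere 0 1) f" shows "f \<in> L2 circle"
proof -
  obtain B where "\<And>\<zeta>. \<zeta> \<in> sphere 0 1 \<Longrightarrow> cmod (f \<zeta>) \<le> B"
    using continuous_circle_bound[OF assms] by blast
  then show ?thesis
    by (intro circle.L2_bounded borel_measurable_circle assms) auto
qed

lemma integrable_circle_mult_continuous:
  fixes f g :: "complex \<Rightarrow> complex"
  assumes f: "integrable circle f" and g: "continuous_on (sphere 0 1) g"
  shows "integrable circle (\<lambda>\<zeta>. f \<zeta> * g \<zeta>)"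
proof -
  obtain B where B: "\<And>\<zeta>. \<zeta> \<in> sphere 0 1 \<Longrightarrow> cmod (g \<zeta>) \<le> B"
    using continuous_circle_bound[OF g] by blast
  have [measurable]: "g \<in> borel_measurable circle" "f \<in> borel_measurable circle"
    using borel_measurable_circle[OF g] f by auto
  show ?thesis
  proof (rule Bochner_Integration.integrable_bound)
    show "integrable circle (\<lambda>\<zeta>. B * cmod (f \<zeta>))" using f by simp
    show "AE \<zeta> in circle. cmod (f \<zeta> * g \<zeta>) \<le> norm (B * cmod (f \<zeta>))"
    proof (intro AE_I2)
      fix \<zeta> assume "\<zeta> \<in> space circle"
      then have "cmod (f \<zeta>) * cmod (g \<zeta>) \<le> cmod (f \<zeta>) * B" by (intro mult_left_mono B) auto
      also have "\<dots> \<le> norm (B * cmod (f \<zeta>))" by (simp add: mult.commute)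
      finally show "cmod (f \<zeta> * g \<zeta>) \<le> norm (B * cmod (f \<zeta>))" by (simp add: norm_mult)
    qed
  qed measurable
qed

lemma integral_circle:
  fixes f :: "complex \<Rightarrow> complex"
  assumes f: "continuous_on (sphere 0 1) f"
  shows "(\<integral>\<zeta>. f \<zeta> \<partial>circle) = (\<integral>t. indicator {0..2*pi} t *\<^sub>R f (cis t) \<partial>lborel) / (2 * pi)"
proof -
  have m: "(\<lambda>t. f (cis t)) \<in> borel_measurable lborel"
  proof -
    have "continuous_on UNIV (f \<circ> cis)"
      by (intro continuous_on_compose continuous_intros continuous_on_subset[OF f]) auto
    then show ?thesis using borel_measurable_continuous_onI by (fastforce simp: o_def)
  qed
  have "(\<integral>\<zeta>. f \<zeta> \<partial>circle) = (\<integral>\<zeta>. f \<zeta> \<partial>borel_circle)"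
    unfolding circle_eq by (intro integral_completion borel_measurable_circle f)
  also have "\<dots> = (\<integral>t. f (cis t) \<partial>uniform_measure lborel {0..2*pi})"
    unfolding borel_circle_def
    by (intro integral_distr cis_measurable borel_measurable_continuous_on_restrict f)
  also have "uniform_measure lborel {0..2*pi} =
      density lborel (\<lambda>t. ennreal (indicator {0..2*pi} t / (2*pi)))"
    unfolding uniform_measure_def
    by (intro density_cong) (auto split: split_indicator simp: divide_ennreal[symmetric] ennreal_1[symmetric] simp del: ennreal_1)
  also have "(\<integral>t. f (cis t) \<partial>density lborel (\<lambda>t. ennreal (indicator {0..2*pi} t / (2*pi)))) =
      (\<integral>t. (indicator {0..2*pi} t / (2*pi)) *\<^sub>R f (cis t) \<partial>lborel)"
    using m by (intro integral_density) (auto)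
  also have "\<dots> = (\<integral>t. (1 / (2*pi)) *\<^sub>R (indicator {0..2*pi} t *\<^sub>R f (cis t)) \<partial>lborel)"
    by (intro Bochner_Integration.integral_cong) auto
  also have "\<dots> = (\<integral>t. indicator {0..2*pi} t *\<^sub>R f (cis t) \<partial>lborel) / (2 * pi)"
    by (subst integral_scaleR_right) (simp add: scaleR_conv_of_real)
  finally show ?thesis .
qed

lemma circle_integral_power:
  assumes "n \<noteq> 0" shows "(\<integral>\<zeta>. \<zeta> ^ n \<partial>circle) = 0"
proof -
  have "(\<integral>t. indicator {0..2*pi} t *\<^sub>R (cis t) ^ n \<partial>lborel) =
    cis (real n * (2*pi)) / (\<i> * of_nat n) - cis (real n * 0) / (\<i> * of_nat n)"
  proof (rule integral_FTC_atLeastAtMost)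
    fix t :: real
    have "((\<lambda>z. exp (\<i> * of_nat n * z) / (\<i> * of_nat n)) has_field_derivative
      exp (\<i> * of_nat n * of_real t)) (at (of_real t))"
      using assms by (auto intro!: derivative_eq_intros)
    then have "((\<lambda>t. exp (\<i> * of_nat n * of_real t) / (\<i> * of_nat n)) has_vector_derivative
      exp (\<i> * of_nat n * of_real t)) (at t within {0..2*pi})"
      by (rule has_vector_derivative_real_field)
    then show "((\<lambda>t. cis (real n * t) / (\<i> * of_nat n)) has_vector_derivative cis t ^ n) (at t within {0..2*pi})"
      by (simp only: Complex.DeMoivre) (simp add: cis_conv_exp mult.assoc)
  qed (auto intro!: continuous_intros)
  also have "\<dots> = 0"
    using cis_multiple_2pi[of "real n"] by (simp add: mult.commute mult.left_commute)
  finally show ?thesis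
    by (subst integral_circle) (auto intro!: continuous_intros)
qed

text \<open>On the circle \<open>cnj \<zeta>\<close> is the inverse of \<open>\<zeta>\<close>, so the integrand is a single power of \<open>\<zeta>\<close> or of
  \<open>cnj \<zeta>\<close>.\<close>

lemma circle_orthonormal:
  "(\<integral>\<zeta>. \<zeta> ^ m * cnj \<zeta> ^ n \<partial>circle) = (if m = n then 1 else 0)"
proof -
  have unit: "\<zeta> * cnj \<zeta> = 1" if "\<zeta> \<in> sphere 0 1" for \<zeta> :: complex
    using that by (simp add: complex_norm_square[symmetric])
  have less: "(\<integral>\<zeta>. \<zeta> ^ m * cnj \<zeta> ^ n \<partial>circle) = 0" if "n < m" for m n
  proof -
    have "(\<integral>\<zeta>. \<zeta> ^ m * cnj \<zeta> ^ n \<partial>circle) = (\<integral>\<zeta>. \<zeta> ^ (m - n) \<partial>circle)"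
    proof (intro Bochner_Integration.integral_cong refl)
      fix \<zeta> assume "\<zeta> \<in> space circle"
      then have "\<zeta> ^ n * cnj \<zeta> ^ n = 1" using unit[of \<zeta>] by (simp flip: power_mult_distrib)
      moreover have "\<zeta> ^ m = \<zeta> ^ (m - n) * \<zeta> ^ n" using that by (simp flip: power_add)
      ultimately show "\<zeta> ^ m * cnj \<zeta> ^ n = \<zeta> ^ (m - n)" by (simp add: mult.assoc)
    qed
    then show ?thesis using that by (simp add: circle_integral_power)
  qed
  consider "m = n" | "n < m" | "m < n" by linarith
  then show ?thesis
  proof cases
    case 1
    have "(\<integral>\<zeta>. \<zeta> ^ m * cnj \<zeta> ^ n \<partial>circle) = (\<integral>\<zeta>. 1 \<partial>circle)"
      using 1 unit by (intro Bochner_Integration.integral_cong) (auto simp flip: power_mult_distrib)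
    then show ?thesis using 1 circle.prob_space by simp
  next
    case 2 then show ?thesis by (simp add: less)
  next
    case 3
    have "(\<integral>\<zeta>. \<zeta> ^ m * cnj \<zeta> ^ n \<partial>circle) = cnj (\<integral>\<zeta>. \<zeta> ^ n * cnj \<zeta> ^ m \<partial>circle)"
      by (subst Complex.complex_cnj_cnj[symmetric]) (simp only: Bochner_Integration.integral_cnj[symmetric] complex_cnj_mult complex_cnj_power complex_cnj_cnj mult.commute)
    then show ?thesis using 3 by (simp add: less)
  qed
qed

section \<open>Uniqueness of Fourier coefficients\<close>

text \<open>The integrable functions that annihilate all trigonometric polynomials. Carrying both powers in the
  definition makes this set a module over the polynomials in \<open>\<zeta>\<close> and \<open>cnj \<zeta>\<close>; that is what allows an
  induction over polynomial functions, whose product case would fail for the orthogonality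
  relation alone.\<close>

definition trig_annihilator :: "(complex \<Rightarrow> complex) set" where
  "trig_annihilator = {f. integrable circle f \<and> (\<forall>m n. (\<integral>\<zeta>. f \<zeta> * \<zeta> ^ m * cnj \<zeta> ^ n \<partial>circle) = 0)}"

lemma trig_annihilator_integrable:
  assumes "f \<in> trig_annihilator"
  shows "integrable circle (\<lambda>\<zeta>. f \<zeta> * \<zeta> ^ m * cnj \<zeta> ^ n)"
  unfolding mult.assoc
  by (intro integrable_circle_mult_continuous continuous_intros)
     (use assms in \<open>simp add: trig_annihilator_def\<close>)

lemma trig_annihilator_add:
  assumes f: "f \<in> trig_annihilator" and g: "g \<in> trig_annihilator"
  shows "(\<lambda>\<zeta>. f \<zeta> + g \<zeta>) \<in> trig_annihilator"
proof -
  have "(\<integral>\<zeta>. (f \<zeta> + g \<zeta>) * \<zeta> ^ m * cnj \<zeta> ^ n \<partial>circle) = 0" for m n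
    using f g trig_annihilator_integrable[OF f] trig_annihilator_integrable[OF g]
    by (simp add: ring_distribs trig_annihilator_def)
  then show ?thesis using assms by (simp add: trig_annihilator_def)
qed

lemma trig_annihilator_cmult:
  assumes f: "f \<in> trig_annihilator"
  shows "(\<lambda>\<zeta>. c * f \<zeta>) \<in> trig_annihilator"
  using f by (simp add: trig_annihilator_def mult.assoc)

lemma trig_annihilator_shift:
  assumes f: "f \<in> trig_annihilator"
  shows "(\<lambda>\<zeta>. \<zeta> * f \<zeta>) \<in> trig_annihilator" "(\<lambda>\<zeta>. cnj \<zeta> * f \<zeta>) \<in> trig_annihilator"
proof -
  have "(\<integral>\<zeta>. \<zeta> * f \<zeta> * \<zeta> ^ m * cnj \<zeta> ^ n \<partial>circle) = 0"
    "(\<integral>\<zeta>. cnj \<zeta> * f \<zeta> * \<zeta> ^ m * cnj \<zeta> ^ n \<partial>circle) = 0" for m n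
  proof -
    have "(\<integral>\<zeta>. f \<zeta> * \<zeta> ^ Suc m * cnj \<zeta> ^ n \<partial>circle) = 0" "(\<integral>\<zeta>. f \<zeta> * \<zeta> ^ m * cnj \<zeta> ^ Suc n \<partial>circle) = 0"
      using f unfolding trig_annihilator_def by blast+
    then show "(\<integral>\<zeta>. \<zeta> * f \<zeta> * \<zeta> ^ m * cnj \<zeta> ^ n \<partial>circle) = 0"
      "(\<integral>\<zeta>. cnj \<zeta> * f \<zeta> * \<zeta> ^ m * cnj \<zeta> ^ n \<partial>circle) = 0"
      by (simp_all add: ac_simps)
  qed
  moreover have "integrable circle (\<lambda>\<zeta>. f \<zeta> * \<zeta>)" "integrable circle (\<lambda>\<zeta>. f \<zeta> * cnj \<zeta>)"
    using trig_annihilator_integrable[OF f, of 1 0] trig_annihilator_integrable[OF f, of 0 1] by simp_all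
  ultimately show "(\<lambda>\<zeta>. \<zeta> * f \<zeta>) \<in> trig_annihilator" "(\<lambda>\<zeta>. cnj \<zeta> * f \<zeta>) \<in> trig_annihilator"
    by (simp_all add: trig_annihilator_def mult.commute)
qed

lemma trig_annihilator_polynomial:
  assumes "real_polynomial_function p" "f \<in> trig_annihilator"
  shows "(\<lambda>\<zeta>. of_real (p \<zeta>) * f \<zeta>) \<in> trig_annihilator"
  using assms
proof (induction arbitrary: f)
  case (linear h)
  interpret bounded_linear h by fact
  \<comment> \<open>a real-linear functional on the plane is a complex combination of \<open>\<zeta>\<close> and \<open>cnj \<zeta>\<close>\<close>
  define \<alpha> where "\<alpha> = (of_real (h 1) - \<i> * of_real (h \<i>)) / 2"
  define \<beta> where "\<beta> = (of_real (h 1) + \<i> * of_real (h \<i>)) / 2"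
  have "of_real (h \<zeta>) = \<alpha> * \<zeta> + \<beta> * cnj \<zeta>" for \<zeta>
  proof -
    have "h (Re \<zeta> *\<^sub>R 1 + Im \<zeta> *\<^sub>R \<i>) = Re \<zeta> * h 1 + Im \<zeta> * h \<i>" by (simp add: add scaleR)
    moreover have "Re \<zeta> *\<^sub>R 1 + Im \<zeta> *\<^sub>R \<i> = \<zeta>" by (simp add: complex_eq_iff)
    ultimately have "h \<zeta> = Re \<zeta> * h 1 + Im \<zeta> * h \<i>" by simp
    then show ?thesis by (simp add: \<alpha>_def \<beta>_def complex_eq_iff field_simps)
  qed
  then have "(\<lambda>\<zeta>. of_real (h \<zeta>) * f \<zeta>) = (\<lambda>\<zeta>. \<alpha> * (\<zeta> * f \<zeta>) + \<beta> * (cnj \<zeta> * f \<zeta>))"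
    by (simp add: fun_eq_iff algebra_simps)
  then show ?case
    using trig_annihilator_add[OF trig_annihilator_cmult[OF trig_annihilator_shift(1)]
        trig_annihilator_cmult[OF trig_annihilator_shift(2)], OF \<open>f \<in> trig_annihilator\<close> \<open>f \<in> trig_annihilator\<close>] by simp
next
  case (const c) then show ?case by (simp add: trig_annihilator_cmult)
next
  case (add p q) then show ?case
    using trig_annihilator_add[of "\<lambda>\<zeta>. of_real (p \<zeta>) * f \<zeta>" "\<lambda>\<zeta>. of_real (q \<zeta>) * f \<zeta>"]
    by (simp add: ring_distribs)
next
  case (mult p q)
  from mult.IH(1)[OF mult.IH(2)[OF mult.prems]] show ?case by (simp add: mult.assoc)
qed

text \<open>Uniform approximation by polynomials (Stone--Weierstrass). The error is at most \<open>e\<close> times the $L^1$ norm of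
  \<open>f\<close>, and \<open>e\<close> is chosen so that this is less than the modulus of the integral.\<close>

lemma trig_annihilator_continuous:
  fixes u :: "complex \<Rightarrow> real"
  assumes f: "f \<in> trig_annihilator" and u: "continuous_on (sphere 0 1) u"
  shows "(\<integral>\<zeta>. of_real (u \<zeta>) * f \<zeta> \<partial>circle) = 0"
proof (rule ccontr)
  assume nz: "(\<integral>\<zeta>. of_real (u \<zeta>) * f \<zeta> \<partial>circle) \<noteq> 0"
  define K where "K = (\<integral>\<zeta>. cmod (f \<zeta>) \<partial>circle)"
  have K: "0 \<le> K" unfolding K_def by (intro integral_nonneg_AE) auto
  have fi: "integrable circle f" using f by (simp add: trig_annihilator_def)
  define e where "e = cmod (\<integral>\<zeta>. of_real (u \<zeta>) * f \<zeta> \<partial>circle) / (K + 1)"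
  have e: "e > 0" using nz K by (simp add: e_def)
  obtain p where p: "real_polynomial_function p" "\<And>x. x \<in> sphere 0 1 \<Longrightarrow> \<bar>u x - p x\<bar> < e"
    using Stone_Weierstrass_real_polynomial_function[OF compact_sphere u e] by blast
  have cp: "continuous_on (sphere 0 1) p"
    using p(1) by (simp add: continuous_on_polymonial_function real_polynomial_function_eq)
  have iu: "integrable circle (\<lambda>\<zeta>. of_real (u \<zeta>) * f \<zeta>)" "integrable circle (\<lambda>\<zeta>. of_real (p \<zeta>) * f \<zeta>)"
    using integrable_circle_mult_continuous[OF fi, of "\<lambda>\<zeta>. of_real (u \<zeta>)"]
      integrable_circle_mult_continuous[OF fi, of "\<lambda>\<zeta>. of_real (p \<zeta>)"] u cp
    by (auto simp: mult.commute intro: continuous_intros)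
  have "(\<integral>\<zeta>. of_real (p \<zeta>) * f \<zeta> * \<zeta> ^ 0 * cnj \<zeta> ^ 0 \<partial>circle) = 0"
    using trig_annihilator_polynomial[OF p(1) f] unfolding trig_annihilator_def by blast
  then have "(\<integral>\<zeta>. of_real (u \<zeta>) * f \<zeta> \<partial>circle) = (\<integral>\<zeta>. of_real (u \<zeta>) * f \<zeta> - of_real (p \<zeta>) * f \<zeta> \<partial>circle)"
    using iu by simp
  then have "cmod (\<integral>\<zeta>. of_real (u \<zeta>) * f \<zeta> \<partial>circle) \<le> (\<integral>\<zeta>. cmod (of_real (u \<zeta>) * f \<zeta> - of_real (p \<zeta>) * f \<zeta>) \<partial>circle)"
    using integral_norm_bound by simp
  also have "\<dots> \<le> (\<integral>\<zeta>. e * cmod (f \<zeta>) \<partial>circle)"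
  proof (intro integral_mono)
    fix \<zeta> assume "\<zeta> \<in> space circle"
    then have "\<bar>u \<zeta> - p \<zeta>\<bar> * cmod (f \<zeta>) \<le> e * cmod (f \<zeta>)"
      using p(2)[of \<zeta>] by (intro mult_right_mono) auto
    then show "cmod (of_real (u \<zeta>) * f \<zeta> - of_real (p \<zeta>) * f \<zeta>) \<le> e * cmod (f \<zeta>)"
      by (simp flip: left_diff_distrib of_real_diff add: norm_mult)
  qed (use iu fi in auto)
  also have "\<dots> = e * K" by (simp add: K_def)
  also have "\<dots> < e * (K + 1)" using e by simp
  also have "\<dots> = cmod (\<integral>\<zeta>. of_real (u \<zeta>) * f \<zeta> \<partial>circle)" using K by (simp add: e_def)
  finally show False by simp
qed

text \<open>The indicator of a closed set is the decreasing limit of the continuous functions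
  \<open>max 0 (1 - n * infdist \<zeta> K)\<close>.\<close>

lemma trig_annihilator_closed:
  assumes f: "f \<in> trig_annihilator" and K: "closed K"
  shows "set_lebesgue_integral circle (K \<inter> sphere 0 1) f = 0"
proof (cases "K = {}")
  case False
  have fi: "integrable circle f" using f by (simp add: trig_annihilator_def)
  define u where "u n \<zeta> = max 0 (1 - real n * infdist \<zeta> K)" for n \<zeta>
  have cu: "continuous_on A (u n)" for n A unfolding u_def by (intro continuous_intros)
  have "(\<lambda>n. \<integral>\<zeta>. of_real (u n \<zeta>) * f \<zeta> \<partial>circle) \<longlonglongrightarrow> (\<integral>\<zeta>. indicator (K \<inter> sphere 0 1) \<zeta> *\<^sub>R f \<zeta> \<partial>circle)"
  proof (rule integral_dominated_convergence[where w = "\<lambda>\<zeta>. cmod (f \<zeta>)"])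
    show "(\<lambda>\<zeta>. indicator (K \<inter> sphere 0 1) \<zeta> *\<^sub>R f \<zeta>) \<in> borel_measurable circle"
      using fi sets_circle_borel[of K] K by (intro borel_measurable_scaleR borel_measurable_indicator) auto
    show "(\<lambda>\<zeta>. of_real (u n \<zeta>) * f \<zeta>) \<in> borel_measurable circle" for n
      using fi borel_measurable_circle(2)[OF cu] by (intro borel_measurable_times borel_measurable_of_real) auto
    show "AE \<zeta> in circle. (\<lambda>n. of_real (u n \<zeta>) * f \<zeta>) \<longlonglongrightarrow> indicator (K \<inter> sphere 0 1) \<zeta> *\<^sub>R f \<zeta>"
    proof (intro AE_I2)
      fix \<zeta> assume z: "\<zeta> \<in> space circle"
      have "(\<lambda>n. u n \<zeta>) \<longlonglongrightarrow> indicator K \<zeta>"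
      proof (cases "\<zeta> \<in> K")
        case True then show ?thesis by (simp add: u_def)
      next
        case no: False
        then have d: "infdist \<zeta> K > 0"
          using K False in_closed_iff_infdist_zero[OF K False] infdist_nonneg[of \<zeta> K] by force
        obtain N :: nat where N: "1 / infdist \<zeta> K < real N" using reals_Archimedean2 by blast
        have "\<forall>\<^sub>F n in sequentially. u n \<zeta> = 0"
          using eventually_ge_at_top[of N]
        proof eventually_elim
          fix n assume "N \<le> n"
          then have "1 / infdist \<zeta> K < real n" using N by linarith
          then show "u n \<zeta> = 0" using d by (simp add: u_def field_simps)
        qed
        then show ?thesis using no by (simp add: tendsto_eventually)
      qed
      then have "(\<lambda>n. of_real (u n \<zeta>) * f \<zeta>) \<longlonglongrightarrow> of_real (indicator K \<zeta>) * f \<zeta>"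
        by (intro tendsto_intros)
      then show "(\<lambda>n. of_real (u n \<zeta>) * f \<zeta>) \<longlonglongrightarrow> indicator (K \<inter> sphere 0 1) \<zeta> *\<^sub>R f \<zeta>"
        using z by (simp add: scaleR_conv_of_real indicator_def)
    qed
    show "AE \<zeta> in circle. norm (of_real (u n \<zeta>) * f \<zeta>) \<le> cmod (f \<zeta>)" for n
    proof (intro AE_I2)
      fix \<zeta>
      have "\<bar>u n \<zeta>\<bar> \<le> 1" using infdist_nonneg[of \<zeta> K] by (simp add: u_def)
      then show "norm (of_real (u n \<zeta>) * f \<zeta>) \<le> cmod (f \<zeta>)"
        by (simp add: norm_mult mult_left_le_one_le)
    qed
  qed (use fi in auto)
  then have "(\<lambda>n. 0) \<longlonglongrightarrow> (\<integral>\<zeta>. indicator (K \<inter> sphere 0 1) \<zeta> *\<^sub>R f \<zeta> \<partial>circle)"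
    by (simp add: trig_annihilator_continuous[OF f cu])
  then show ?thesis
    by (simp add: set_lebesgue_integral_def LIMSEQ_const_iff)
qed (simp add: set_lebesgue_integral_def)

text \<open>The closed sets are an intersection-stable generator of the Borel sets, so Dynkin's theorem applies.\<close>

lemma trig_annihilator_borel:
  assumes f: "f \<in> trig_annihilator" and B: "B \<in> sets borel"
  shows "set_lebesgue_integral circle (B \<inter> sphere 0 1) f = 0"
proof -
  have fi: "integrable circle f" using f by (simp add: trig_annihilator_def)
  have si: "set_integrable circle (B \<inter> sphere 0 1) f" if "B \<in> sets borel" for B
    unfolding set_integrable_def by (intro integrable_mult_indicator sets_circle_borel that fi)
  have "Int_stable (Collect closed :: complex set set)" "Collect closed \<subseteq> Pow (UNIV :: complex set)"
    by (auto simp: Int_stable_def)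
  moreover have "B \<in> sigma_sets UNIV (Collect closed)"
    using B by (simp add: borel_eq_closed)
  ultimately show ?thesis
  proof (induction rule: sigma_sets_induct_disjoint)
    case (basic K) then show ?case using trig_annihilator_closed[OF f] by simp
  next
    case empty show ?case by (simp add: set_lebesgue_integral_def)
  next
    case (compl A)
    then have A: "A \<in> sets borel" by (simp add: borel_eq_closed)
    have "set_lebesgue_integral circle ((A \<inter> sphere 0 1) \<union> ((UNIV - A) \<inter> sphere 0 1)) f =
       set_lebesgue_integral circle (A \<inter> sphere 0 1) f + set_lebesgue_integral circle ((UNIV - A) \<inter> sphere 0 1) f"
      by (rule set_integral_Un) (use A in \<open>auto intro!: si\<close>)
    moreover have "(A \<inter> sphere 0 1) \<union> ((UNIV - A) \<inter> sphere 0 1) = UNIV \<inter> sphere 0 1" by auto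
    ultimately show ?case using compl.IH trig_annihilator_closed[OF f closed_UNIV] by simp
  next
    case (union A)
    then have A: "A i \<in> sets borel" for i by (auto simp: borel_eq_closed)
    have "set_lebesgue_integral circle (\<Union>i. A i \<inter> sphere 0 1) f =
       (\<Sum>i. set_lebesgue_integral circle (A i \<inter> sphere 0 1) f)"
    proof (rule lebesgue_integral_countable_add)
      show "i \<noteq> j \<Longrightarrow> (A i \<inter> sphere 0 1) \<inter> (A j \<inter> sphere 0 1) = {}" for i j
        using union.hyps(1) by (auto simp: disjoint_family_on_def)
      show "set_integrable circle (\<Union>i. A i \<inter> sphere 0 1) f"
        using si[of "\<Union>i. A i"] A by simp
    qed (intro sets_circle_borel A)
    then show ?case using union by simp
  qed
qed

text \<open>A set that is measurable for the completion differs from a Borel set by a null set, so all its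
  integrals vanish as well.\<close>

lemma trig_annihilator_zero:
  assumes f: "f \<in> trig_annihilator" shows "AE \<zeta> in circle. f \<zeta> = 0"
proof (rule circle.density_zero)
  show fi: "integrable circle f" using f by (simp add: trig_annihilator_def)
  fix A assume A: "A \<in> sets circle"
  then obtain S N N' where SN: "A = S \<union> N" "N \<subseteq> N'" "N' \<in> null_sets borel_circle" "S \<in> sets borel_circle"
    unfolding circle_eq sets_completion by (rule completionE)
  have Sc: "S \<in> sets circle" using SN(4) unfolding circle_eq by (rule sets_completionI_sets)
  from SN(4) obtain B where B: "B \<in> sets borel" "S = B \<inter> sphere 0 1"
    by (auto simp: sets_borel_circle sets_restrict_space)
  have m: "set_borel_measurable circle A f" "set_borel_measurable circle S f"
    unfolding set_borel_measurable_def using fi A Sc by auto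
  have "N' \<in> null_sets circle" unfolding circle_eq by (rule null_sets_completionI[OF SN(3)])
  then have "AE \<zeta> in circle. \<zeta> \<notin> N'" by (rule AE_not_in)
  then have "AE \<zeta> in circle. \<zeta> \<in> S \<longleftrightarrow> \<zeta> \<in> A"
    by eventually_elim (use SN in auto)
  from set_integral_cong_set[OF m(2,1) this] show "set_lebesgue_integral circle A f = 0"
    using trig_annihilator_borel[OF f B(1)] B(2) by simp
qed

lemma fourier_coefficients_zero_imp_AE_zero:
  assumes fi: "integrable circle f"
    and pos: "\<And>n. (\<integral>\<zeta>. f \<zeta> * cnj \<zeta> ^ n \<partial>circle) = 0" and neg: "\<And>n. (\<integral>\<zeta>. f \<zeta> * \<zeta> ^ n \<partial>circle) = 0"
  shows "AE \<zeta> in circle. f \<zeta> = 0"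
proof (rule trig_annihilator_zero)
  have "(\<integral>\<zeta>. f \<zeta> * \<zeta> ^ m * cnj \<zeta> ^ n \<partial>circle) = 0" for m n
  proof -
    have unit: "\<zeta> ^ k * cnj \<zeta> ^ k = 1" if "\<zeta> \<in> space circle" for \<zeta> k
      using that by (simp add: complex_norm_square[symmetric] flip: power_mult_distrib)
    have "(\<integral>\<zeta>. f \<zeta> * \<zeta> ^ m * cnj \<zeta> ^ n \<partial>circle) =
      (if n \<le> m then \<integral>\<zeta>. f \<zeta> * \<zeta> ^ (m - n) \<partial>circle else \<integral>\<zeta>. f \<zeta> * cnj \<zeta> ^ (n - m) \<partial>circle)"
    proof (cases "n \<le> m")
      case True
      then have "\<zeta> ^ m = \<zeta> ^ (m - n) * \<zeta> ^ n" for \<zeta> :: complex by (simp flip: power_add)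
      then show ?thesis using True unit
        by (auto simp: mult.assoc intro!: Bochner_Integration.integral_cong)
    next
      case False
      then have "cnj \<zeta> ^ n = cnj \<zeta> ^ m * cnj \<zeta> ^ (n - m)" for \<zeta> :: complex by (simp flip: power_add)
      moreover have "\<zeta> ^ m * (cnj \<zeta> ^ m * c) = c" if "\<zeta> \<in> space circle" for \<zeta> c
        using unit[OF that, of m] by (simp flip: mult.assoc)
      ultimately show ?thesis using False
        by (auto simp: mult.assoc intro!: Bochner_Integration.integral_cong)
    qed
    then show ?thesis by (simp add: pos neg)
  qed
  then show "f \<in> trig_annihilator" using fi by (simp add: trig_annihilator_def)
qed

section \<open>Harmonic functions with holomorphic and antiholomorphic parts\<close>

text \<open>A harmonic function on the disk is handled through a representation \<open>h + cnj g\<close> with \<open>h\<close> and \<open>g\<close>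
  holomorphic: the partial derivatives are again of this form, so the same lemma gives the second
  derivatives.\<close>

lemma has_derivative_holomorphic_plus_cnj:
  assumes h: "h holomorphic_on unit_disk" and g: "g holomorphic_on unit_disk"
    and u: "\<forall>z\<in>unit_disk. u z = h z + cnj (g z)" and z: "z \<in> unit_disk"
  shows "(u has_derivative (\<lambda>v. deriv h z * v + cnj (deriv g z * v))) (at z)"
proof (rule has_derivative_transform_within_open)
  have "(h has_field_derivative deriv h z) (at z)" "(g has_field_derivative deriv g z) (at z)"
    by (rule holomorphic_derivI[OF h open_ball z], rule holomorphic_derivI[OF g open_ball z])
  then show "((\<lambda>z. h z + cnj (g z)) has_derivative (\<lambda>v. deriv h z * v + cnj (deriv g z * v))) (at z)"
    unfolding has_field_derivative_def by (intro has_derivative_add bounded_linear.has_derivative[OF bounded_linear_cnj])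
  show "\<And>x. x \<in> unit_disk \<Longrightarrow> h x + cnj (g x) = u x" using u by simp
qed (use z in auto)

lemma partials_holomorphic_plus_cnj:
  assumes h: "h holomorphic_on unit_disk" and g: "g holomorphic_on unit_disk"
    and u: "\<forall>z\<in>unit_disk. u z = h z + cnj (g z)" and z: "z \<in> unit_disk"
  shows "partial_x u z = deriv h z + cnj (deriv g z)"
    and "partial_y u z = \<i> * deriv h z + cnj (\<i> * deriv g z)"
proof -
  have "frechet_derivative u (at z) = (\<lambda>v. deriv h z * v + cnj (deriv g z * v))"
    by (rule frechet_derivative_at[OF has_derivative_holomorphic_plus_cnj[OF assms], symmetric])
  then show "partial_x u z = deriv h z + cnj (deriv g z)"
    "partial_y u z = \<i> * deriv h z + cnj (\<i> * deriv g z)"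
    by (simp_all add: partial_x_def partial_y_def mult.commute)
qed

text \<open>The two Wirtinger derivatives separate \<open>h\<close> from \<open>g\<close>. This is why the energy of \<open>h + cnj g\<close> has no
  mixed terms.\<close>

lemma wirtinger_holomorphic_plus_cnj:
  assumes h: "h holomorphic_on unit_disk" and g: "g holomorphic_on unit_disk"
    and u: "\<forall>z\<in>unit_disk. u z = h z + cnj (g z)" and z: "z \<in> unit_disk"
  shows "dz u z = deriv h z" and "dzbar u z = cnj (deriv g z)"
  unfolding dz_def dzbar_def partials_holomorphic_plus_cnj[OF assms]
  by (simp_all add: algebra_simps)

lemma harmonic_holomorphic_plus_cnj:
  assumes h: "h holomorphic_on unit_disk" and g: "g holomorphic_on unit_disk"
    and u: "\<forall>z\<in>unit_disk. u z = h z + cnj (g z)"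
  shows "harmonic_on u unit_disk"
proof -
  note P = partials_holomorphic_plus_cnj and D = has_derivative_holomorphic_plus_cnj
  have h': "deriv h holomorphic_on unit_disk" and g': "deriv g holomorphic_on unit_disk"
    by (rule holomorphic_deriv[OF h open_ball], rule holomorphic_deriv[OF g open_ball])
  have ih': "(\<lambda>z. \<i> * deriv h z) holomorphic_on unit_disk" and ig': "(\<lambda>z. \<i> * deriv g z) holomorphic_on unit_disk"
    by (intro holomorphic_on_mult holomorphic_on_const h' g')+
  have d: "deriv (\<lambda>z. \<i> * deriv f z) z = \<i> * deriv (deriv f) z"
    if "deriv f holomorphic_on unit_disk" "z \<in> unit_disk" for f z
    using that holomorphic_on_imp_differentiable_at[OF that(1) open_ball that(2)] by (simp add: deriv_cmult)
  have ux: "\<forall>z\<in>unit_disk. partial_x u z = deriv h z + cnj (deriv g z)"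
    and uy: "\<forall>z\<in>unit_disk. partial_y u z = \<i> * deriv h z + cnj (\<i> * deriv g z)"
    using P[OF h g u] by blast+
  note Px = P[OF h' g' ux] and Py = P[OF ih' ig' uy]
  have c: "continuous_on unit_disk (deriv (deriv h))" "continuous_on unit_disk (deriv (deriv g))"
    by (rule holomorphic_on_imp_continuous_on[OF holomorphic_deriv[OF h' open_ball]],
        rule holomorphic_on_imp_continuous_on[OF holomorphic_deriv[OF g' open_ball]])
  have cc: "continuous_on unit_disk v"
    if "\<And>z. z \<in> unit_disk \<Longrightarrow> v z = a * deriv (deriv h) z + cnj (b * deriv (deriv g) z)" for v a b
  proof -
    have "continuous_on unit_disk (\<lambda>z. a * deriv (deriv h) z + cnj (b * deriv (deriv g) z))"
      by (intro continuous_intros c)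
    then show ?thesis by (subst continuous_on_cong[OF refl that])
  qed
  show ?thesis
    unfolding harmonic_on_def
  proof (intro conjI ballI)
    fix z assume z: "z \<in> unit_disk"
    show "u differentiable (at z)" using D[OF h g u z] by (auto simp: differentiable_def)
    show "partial_x u differentiable (at z)"
      using D[OF h' g' ux z] by (auto simp: differentiable_def)
    show "partial_y u differentiable (at z)"
      using D[OF ih' ig' uy z] by (auto simp: differentiable_def)
    show "partial_x (partial_x u) z + partial_y (partial_y u) z = 0"
      using z by (simp add: Px Py d[OF h'] d[OF g'])
  next
    show "continuous_on unit_disk (partial_x (partial_x u))"
      by (rule cc[of _ 1 1]) (simp add: Px)
    show "continuous_on unit_disk (partial_y (partial_x u))"
      by (rule cc[of _ \<i> \<i>]) (simp add: Px)
    show "continuous_on unit_disk (partial_x (partial_y u))"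
      by (rule cc[of _ \<i> \<i>]) (simp add: Py d[OF h'] d[OF g'])
    show "continuous_on unit_disk (partial_y (partial_y u))"
      by (rule cc[of _ "-1" "-1"]) (simp add: Py d[OF h'] d[OF g'])
  qed
qed

section \<open>Cauchy and Poisson integrals\<close>

lemma integrable_cnj_iff [simp]: "integrable M (\<lambda>x. cnj (f x)) \<longleftrightarrow> integrable M f"
proof
  assume "integrable M (\<lambda>x. cnj (f x))"
  from integrable_bounded_linear[OF bounded_linear_cnj this] show "integrable M f"
    by (simp only: complex_cnj_cnj)
qed (rule integrable_bounded_linear[OF bounded_linear_cnj])

text \<open>Termwise integration. It is used with \<open>e = cnj\<close> for Cauchy integrals and with \<open>e\<close> the identity for
  dilates of holomorphic functions.\<close>

lemma circle_integral_power_series: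
  fixes e :: "complex \<Rightarrow> complex"
  assumes \<phi>: "integrable circle \<phi>" and e: "continuous_on (sphere 0 1) e" "\<And>\<zeta>. cmod \<zeta> = 1 \<Longrightarrow> cmod (e \<zeta>) = 1"
    and b: "summable (\<lambda>n. cmod (b n))"
  shows "(\<lambda>n. b n * (\<integral>\<zeta>. \<phi> \<zeta> * e \<zeta> ^ n \<partial>circle)) sums (\<integral>\<zeta>. \<phi> \<zeta> * (\<Sum>n. b n * e \<zeta> ^ n) \<partial>circle)"
proof -
  have int: "integrable circle (\<lambda>\<zeta>. \<phi> \<zeta> * (b n * e \<zeta> ^ n))" for n
    by (intro integrable_circle_mult_continuous \<phi> continuous_intros e)
  have nrm: "norm (\<phi> \<zeta> * (b n * e \<zeta> ^ n)) = cmod (\<phi> \<zeta>) * cmod (b n)" if "\<zeta> \<in> space circle" for \<zeta> n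
    using that e(2)[of \<zeta>] by (simp add: norm_mult norm_power)
  have "(\<lambda>n. \<integral>\<zeta>. \<phi> \<zeta> * (b n * e \<zeta> ^ n) \<partial>circle) sums (\<integral>\<zeta>. (\<Sum>n. \<phi> \<zeta> * (b n * e \<zeta> ^ n)) \<partial>circle)"
  proof (rule sums_integral[OF int])
    show "AE \<zeta> in circle. summable (\<lambda>n. norm (\<phi> \<zeta> * (b n * e \<zeta> ^ n)))"
    proof (rule AE_I2)
      fix \<zeta> assume "\<zeta> \<in> space circle"
      then have "(\<lambda>n. norm (\<phi> \<zeta> * (b n * e \<zeta> ^ n))) = (\<lambda>n. cmod (\<phi> \<zeta>) * cmod (b n))"
        by (intro ext nrm)
      then show "summable (\<lambda>n. norm (\<phi> \<zeta> * (b n * e \<zeta> ^ n)))"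
        using summable_mult[OF b] by (simp only:)
    qed
    have "(\<integral>\<zeta>. norm (\<phi> \<zeta> * (b n * e \<zeta> ^ n)) \<partial>circle) = (\<integral>\<zeta>. cmod (\<phi> \<zeta>) \<partial>circle) * cmod (b n)" for n
    proof -
      have "(\<integral>\<zeta>. norm (\<phi> \<zeta> * (b n * e \<zeta> ^ n)) \<partial>circle) = (\<integral>\<zeta>. cmod (\<phi> \<zeta>) * cmod (b n) \<partial>circle)"
        by (rule Bochner_Integration.integral_cong[OF refl nrm])
      then show ?thesis by simp
    qed
    then show "summable (\<lambda>n. \<integral>\<zeta>. norm (\<phi> \<zeta> * (b n * e \<zeta> ^ n)) \<partial>circle)"
      using summable_mult[OF b] by (simp only:)
  qed
  moreover have "(\<integral>\<zeta>. (\<Sum>n. \<phi> \<zeta> * (b n * e \<zeta> ^ n)) \<partial>circle) = (\<integral>\<zeta>. \<phi> \<zeta> * (\<Sum>n. b n * e \<zeta> ^ n) \<partial>circle)"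
  proof (intro Bochner_Integration.integral_cong refl)
    fix \<zeta> assume "\<zeta> \<in> space circle"
    then have "summable (\<lambda>n. b n * e \<zeta> ^ n)"
      using b e(2)[of \<zeta>] by - (rule summable_norm_cancel, simp add: norm_mult norm_power)
    then show "(\<Sum>n. \<phi> \<zeta> * (b n * e \<zeta> ^ n)) = \<phi> \<zeta> * (\<Sum>n. b n * e \<zeta> ^ n)"
      by (rule suminf_mult)
  qed
  moreover have "(\<integral>\<zeta>. \<phi> \<zeta> * (b n * e \<zeta> ^ n) \<partial>circle) = b n * (\<integral>\<zeta>. \<phi> \<zeta> * e \<zeta> ^ n \<partial>circle)" for n
  proof -
    have "(\<lambda>\<zeta>. \<phi> \<zeta> * (b n * e \<zeta> ^ n)) = (\<lambda>\<zeta>. b n * (\<phi> \<zeta> * e \<zeta> ^ n))"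
      by (simp add: fun_eq_iff mult.left_commute)
    then show ?thesis by (simp only: integral_mult_right_zero)
  qed
  ultimately show ?thesis by (simp only:)
qed

text \<open>The Cauchy integral of \<open>f\<close>, that is, the holomorphic function whose Taylor coefficients are the
  Fourier coefficients of \<open>f\<close> with non-negative index.\<close>

definition szego :: "(complex \<Rightarrow> complex) \<Rightarrow> complex \<Rightarrow> complex" where
  "szego f z = (\<integral>\<zeta>. f \<zeta> / (1 - z * cnj \<zeta>) \<partial>circle)"

text \<open>The holomorphic function whose conjugate collects the Fourier coefficients of \<open>f\<close> with negative
  index. Subtracting the value at \<open>0\<close> keeps the coefficient of index \<open>0\<close> from being counted twice.\<close>

definition antiszego :: "(complex \<Rightarrow> complex) \<Rightarrow> complex \<Rightarrow> complex" where
  "antiszego f z = szego (\<lambda>\<zeta>. cnj (f \<zeta>)) z - szego (\<lambda>\<zeta>. cnj (f \<zeta>)) 0"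

lemma szego_kernel_nonzero:
  assumes "z \<in> unit_disk" "cmod \<zeta> = 1" shows "1 - cmod z \<le> cmod (1 - z * cnj \<zeta>)" "1 - z * cnj \<zeta> \<noteq> 0"
proof -
  have "norm (1::complex) - norm (z * cnj \<zeta>) \<le> cmod (1 - z * cnj \<zeta>)" by (rule norm_triangle_ineq2)
  then show le: "1 - cmod z \<le> cmod (1 - z * cnj \<zeta>)" using assms by (simp add: norm_mult)
  have "0 < 1 - cmod z" using assms(1) by simp
  with le have "0 < cmod (1 - z * cnj \<zeta>)" by linarith
  then show "1 - z * cnj \<zeta> \<noteq> 0" by (metis norm_zero less_irrefl)
qed

lemma integrable_szego_kernel:
  assumes f: "integrable circle f" and z: "z \<in> unit_disk"
  shows "integrable circle (\<lambda>\<zeta>. f \<zeta> / (1 - z * cnj \<zeta>))"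
proof -
  have "continuous_on (sphere 0 1) (\<lambda>\<zeta>. inverse (1 - z * cnj \<zeta>))"
  proof (intro continuous_on_inverse ballI)
    show "continuous_on (sphere 0 1) (\<lambda>\<zeta>. 1 - z * cnj \<zeta>)" by (intro continuous_intros)
    show "1 - z * cnj \<zeta> \<noteq> 0" if "\<zeta> \<in> sphere 0 1" for \<zeta>
      using that by (intro szego_kernel_nonzero(2)[OF z]) simp
  qed
  from integrable_circle_mult_continuous[OF f this] show ?thesis
    by (simp only: divide_inverse)
qed

lemma szego_sums:
  assumes f: "integrable circle f" and z: "z \<in> unit_disk"
  shows "(\<lambda>n. (\<integral>\<zeta>. f \<zeta> * cnj \<zeta> ^ n \<partial>circle) * z ^ n) sums szego f z"
proof -
  have "(\<lambda>n. z ^ n * (\<integral>\<zeta>. f \<zeta> * cnj \<zeta> ^ n \<partial>circle)) sums (\<integral>\<zeta>. f \<zeta> * (\<Sum>n. z ^ n * cnj \<zeta> ^ n) \<partial>circle)"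
    using z by (intro circle_integral_power_series f)
      (auto intro!: continuous_intros simp: norm_power summable_geometric)
  moreover have "(\<integral>\<zeta>. f \<zeta> * (\<Sum>n. z ^ n * cnj \<zeta> ^ n) \<partial>circle) = szego f z"
    unfolding szego_def
  proof (intro Bochner_Integration.integral_cong refl)
    fix \<zeta> assume "\<zeta> \<in> space circle"
    then have "cmod (z * cnj \<zeta>) < 1" using z by (simp add: norm_mult)
    from suminf_geometric[OF this] show "f \<zeta> * (\<Sum>n. z ^ n * cnj \<zeta> ^ n) = f \<zeta> / (1 - z * cnj \<zeta>)"
      by (simp add: power_mult_distrib)
  qed
  ultimately show ?thesis by (simp only: mult.commute[of "z ^ _"])
qed

lemma szego_holomorphic:
  assumes "integrable circle f" shows "szego f holomorphic_on unit_disk"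
proof (rule power_series_holomorphic)
  fix w assume w: "w \<in> unit_disk"
  show "(\<lambda>n. (\<integral>\<zeta>. f \<zeta> * cnj \<zeta> ^ n \<partial>circle) * (w - 0) ^ n) sums szego f w"
    using szego_sums[OF assms w] by (simp only: diff_zero)
qed

lemma antiszego_holomorphic:
  assumes "integrable circle f" shows "antiszego f holomorphic_on unit_disk"
  unfolding antiszego_def using assms
  by (intro holomorphic_on_diff holomorphic_on_const szego_holomorphic) simp

lemma antiszego_0 [simp]: "antiszego f 0 = 0" by (simp add: antiszego_def)

abbreviation poisson_kernel :: "complex \<Rightarrow> complex \<Rightarrow> complex" where
  "poisson_kernel z \<zeta> \<equiv> complex_of_real ((1 - (cmod z)\<^sup>2) / (cmod (\<zeta> - z))\<^sup>2)"

lemma poisson_kernel_split: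
  assumes z: "z \<in> unit_disk" and \<zeta>: "cmod \<zeta> = 1"
  shows "poisson_kernel z \<zeta> =
    1 / (1 - z * cnj \<zeta>) + cnj (1 / (1 - z * cnj \<zeta>)) - 1"
proof -
  have u: "\<zeta> * cnj \<zeta> = 1" using \<zeta> by (simp add: complex_norm_square[symmetric])
  have nz: "1 - z * cnj \<zeta> \<noteq> 0" by (rule szego_kernel_nonzero[OF z \<zeta>])
  then have nz': "1 - cnj z * \<zeta> \<noteq> 0"
    by (metis complex_cnj_cnj complex_cnj_diff complex_cnj_mult complex_cnj_one complex_cnj_zero_iff)
  have alg: "(w - a) * (d - c) = (1 - a * d) * (1 - c * w)"
      "1 - a * c = (1 - c * w) + (1 - a * d) - (1 - a * d) * (1 - c * w)"
    if "w * d = 1" for w d a c :: complex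
    using that by algebra+
  have "complex_of_real ((cmod (\<zeta> - z))\<^sup>2) = (\<zeta> - z) * (cnj \<zeta> - cnj z)"
    using complex_norm_square[of "\<zeta> - z"] by (simp only: of_real_power complex_cnj_diff)
  also have "\<dots> = (1 - z * cnj \<zeta>) * (1 - cnj z * \<zeta>)"
    by (rule alg(1)[OF u])
  finally have "poisson_kernel z \<zeta> =
     (1 - z * cnj z) / ((1 - z * cnj \<zeta>) * (1 - cnj z * \<zeta>))"
    by (simp only: of_real_divide of_real_diff of_real_1 complex_norm_square)
  also have "\<dots> = 1 / (1 - z * cnj \<zeta>) + 1 / (1 - cnj z * \<zeta>) - 1"
  proof -
    have "(b + a - a * b) / (a * b) = 1 / a + 1 / b - 1" if "a \<noteq> 0" "b \<noteq> 0" for a b :: complex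
      using that by (simp add: field_simps)
    from this[OF nz nz'] show ?thesis by (simp only: alg(2)[OF u, symmetric])
  qed
  finally show ?thesis by simp
qed

lemma poisson_eq_szego:
  assumes f: "integrable circle f" and z: "z \<in> unit_disk"
  shows "poisson f z = szego f z + cnj (antiszego f z)"
proof -
  have i: "integrable circle (\<lambda>\<zeta>. cnj (cnj (f \<zeta>) / (1 - z * cnj \<zeta>)))"
    unfolding integrable_cnj_iff using f by (intro integrable_szego_kernel z) simp
  have "poisson f z = (\<integral>\<zeta>. f \<zeta> / (1 - z * cnj \<zeta>) + cnj (cnj (f \<zeta>) / (1 - z * cnj \<zeta>)) - f \<zeta> \<partial>circle)"
    using z unfolding poisson_def
  proof (simp only: if_True, intro Bochner_Integration.integral_cong refl)
    fix \<zeta> assume "\<zeta> \<in> space circle"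
    then have "cmod \<zeta> = 1" by simp
    then show "poisson_kernel z \<zeta> * f \<zeta> =
        f \<zeta> / (1 - z * cnj \<zeta>) + cnj (cnj (f \<zeta>) / (1 - z * cnj \<zeta>)) - f \<zeta>"
      by (subst poisson_kernel_split[OF z]) (simp_all add: algebra_simps)
  qed
  also have "\<dots> = szego f z + (\<integral>\<zeta>. cnj (cnj (f \<zeta>) / (1 - z * cnj \<zeta>)) \<partial>circle) - (\<integral>\<zeta>. f \<zeta> \<partial>circle)"
    unfolding szego_def using integrable_szego_kernel[OF f z] i f
    by (subst Bochner_Integration.integral_diff; (subst Bochner_Integration.integral_add)?; simp)
  also have "(\<integral>\<zeta>. f \<zeta> \<partial>circle) = (\<integral>\<zeta>. cnj (cnj (f \<zeta>)) \<partial>circle)" by simp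
  finally show ?thesis
    unfolding antiszego_def szego_def by (simp only: Bochner_Integration.integral_cnj) simp
qed

lemma szego_diff:
  assumes "integrable circle f" "integrable circle g" "z \<in> unit_disk"
  shows "szego (\<lambda>\<zeta>. f \<zeta> - g \<zeta>) z = szego f z - szego g z"
  unfolding szego_def diff_divide_distrib
  by (intro Bochner_Integration.integral_diff integrable_szego_kernel assms)

lemma szego_bound:
  assumes f: "f \<in> L2 circle" and z: "z \<in> unit_disk"
  shows "cmod (szego f z) \<le> l2norm circle f / (1 - cmod z)"
proof -
  have fi: "integrable circle f" by (rule circle.L2_imp_integrable[OF f])
  have "cmod (szego f z) \<le> (\<integral>\<zeta>. cmod (f \<zeta> / (1 - z * cnj \<zeta>)) \<partial>circle)"
    unfolding szego_def by (rule integral_norm_bound)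
  also have "\<dots> \<le> (\<integral>\<zeta>. cmod (f \<zeta>) / (1 - cmod z) \<partial>circle)"
  proof (intro integral_mono integrable_norm integrable_szego_kernel fi z)
    show "integrable circle (\<lambda>\<zeta>. cmod (f \<zeta>) / (1 - cmod z))" using fi by auto
    fix \<zeta> assume "\<zeta> \<in> space circle"
    then show "cmod (f \<zeta> / (1 - z * cnj \<zeta>)) \<le> cmod (f \<zeta>) / (1 - cmod z)"
      unfolding norm_divide using z
      by (intro divide_left_mono szego_kernel_nonzero mult_pos_pos) (auto dest: szego_kernel_nonzero[OF z])
  qed
  also have "\<dots> = (\<integral>\<zeta>. cmod (f \<zeta>) \<partial>circle) / (1 - cmod z)" by simp
  also have "\<dots> \<le> l2norm circle f / (1 - cmod z)"
    using z by (intro divide_right_mono circle.l1_le_l2norm f) auto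
  finally show ?thesis .
qed

text \<open>The Cauchy estimate on the disk of radius \<open>(1 - cmod z) / 2\<close> about \<open>z\<close>, where the Cauchy integral is
  under control. Convergence in $L^2$ of the boundary data therefore forces pointwise convergence of
  the gradients.\<close>

lemma deriv_szego_bound:
  assumes f: "f \<in> L2 circle" and z: "z \<in> unit_disk"
  shows "cmod (deriv (szego f) z) \<le> l2norm circle f / ((1 - cmod z) / 2)\<^sup>2"
proof -
  define r where "r = (1 - cmod z) / 2"
  have r: "r > 0" using z by (simp add: r_def)
  have sub: "x \<in> unit_disk \<and> r \<le> 1 - cmod x" if "x \<in> cball z r" for x
  proof -
    have "cmod x \<le> cmod z + r"
      using that norm_triangle_ineq[of z "x - z"] by (simp add: dist_norm norm_minus_commute)
    then show ?thesis using r by (simp add: r_def field_simps)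
  qed
  have hol: "szego f holomorphic_on unit_disk"
    by (intro szego_holomorphic circle.L2_imp_integrable f)
  have "cmod ((deriv ^^ 1) (szego f) z) \<le> fact 1 * (l2norm circle f / r) / r ^ 1"
  proof (rule Cauchy_inequality[OF _ _ r])
    show "szego f holomorphic_on ball z r" "continuous_on (cball z r) (szego f)"
      using sub by (auto intro!: holomorphic_on_subset[OF hol] holomorphic_on_imp_continuous_on)
    fix x assume "norm (z - x) = r"
    then have x: "x \<in> unit_disk" "r \<le> 1 - cmod x" using sub[of x] by (auto simp: dist_norm)
    have "cmod (szego f x) \<le> l2norm circle f / (1 - cmod x)" by (rule szego_bound[OF f x(1)])
    also have "\<dots> \<le> l2norm circle f / r"
      using x r by (intro divide_left_mono mult_pos_pos) auto
    finally show "norm (szego f x) \<le> l2norm circle f / r" .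
  qed
  then show ?thesis by (simp add: r_def power2_eq_square mult.commute)
qed

text \<open>The Wirtinger derivatives of the zero function are \<open>h'\<close> and \<open>cnj g'\<close>, so \<open>h\<close> and \<open>g\<close> are constant.\<close>

lemma holomorphic_pair_unique:
  assumes "h holomorphic_on unit_disk" "g holomorphic_on unit_disk" "g 0 = 0"
    and zero: "\<forall>z\<in>unit_disk. h z + cnj (g z) = 0" and z: "z \<in> unit_disk"
  shows "h z = 0" "g z = 0"
proof -
  note W = wirtinger_holomorphic_plus_cnj[OF assms(1,2), of "\<lambda>z. 0"]
  have const: "f w = f 0" if "f holomorphic_on unit_disk" "\<And>w. w \<in> unit_disk \<Longrightarrow> deriv f w = 0" "w \<in> unit_disk"
    for f and w :: complex
  proof -
    have "\<exists>c. \<forall>x\<in>unit_disk. f x = c"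
    proof (rule has_field_derivative_zero_constant)
      fix x :: complex assume "x \<in> unit_disk"
      then show "(f has_field_derivative 0) (at x within unit_disk)"
        using holomorphic_derivI[OF that(1) open_ball, of x] that(2)[of x] by simp
    qed simp
    then obtain c where "\<forall>x\<in>unit_disk. f x = c" by blast
    then show ?thesis using that(3) by simp
  qed
  have d0: "dz (\<lambda>z. 0) w = 0" "dzbar (\<lambda>z. 0) w = 0" for w
    by (simp_all add: dz_def dzbar_def partial_x_def partial_y_def)
  have zero': "\<forall>w\<in>unit_disk. 0 = h w + cnj (g w)" using zero by simp
  have "g z = g 0" by (rule const[OF assms(2) _ z]) (use W(2)[OF zero'] d0(2) in simp)
  then show "g z = 0" using assms(3) by simp
  then show "h z = 0" using zero[rule_format, OF z] by simp
qed

lemma szego_zero_imp_coefficients_zero: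
  assumes f: "integrable circle f" and zero: "\<forall>z\<in>unit_disk. szego f z = 0"
  shows "(\<integral>\<zeta>. f \<zeta> * cnj \<zeta> ^ n \<partial>circle) = 0"
proof -
  define c where "c n = (\<integral>\<zeta>. f \<zeta> * cnj \<zeta> ^ n \<partial>circle)" for n
  have s: "(\<lambda>n. c n * (z - 0) ^ n) sums 0" if "norm (z - 0) < 1" for z
    using szego_sums[OF f, of z] that zero by (simp add: c_def)
  have c0: "c 0 = 0"
  proof -
    have "(\<lambda>n. c n * 0 ^ n) sums 0" using s[of 0] by (simp only: diff_zero norm_zero zero_less_one)
    with powser_sums_zero[of c] show ?thesis by (rule sums_unique2)
  qed
  show ?thesis
  proof (rule ccontr)
    assume "(\<integral>\<zeta>. f \<zeta> * cnj \<zeta> ^ n \<partial>circle) \<noteq> 0"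
    then have "c n \<noteq> 0" "n > 0" using c0 by (auto simp: c_def intro: gr0I)
    then obtain s where "0 < s" "\<And>z::complex. z \<in> cball 0 s - {0} \<Longrightarrow> (0::complex) \<noteq> 0"
      using powser_0_nonzero[of 1 0 c "\<lambda>_. 0" n] s by auto
    from this(2)[of "of_real s"] this(1) show False by simp
  qed
qed

lemma poisson_cong_AE:
  assumes "f \<in> borel_measurable circle" "g \<in> borel_measurable circle" "AE \<zeta> in circle. f \<zeta> = g \<zeta>"
  shows "poisson f = poisson g"
proof
  fix z show "poisson f z = poisson g z"
  proof (cases "z \<in> unit_disk")
    case True
    have "continuous_on (sphere 0 1) (\<lambda>\<zeta>. poisson_kernel z \<zeta>)"
      using True by (intro continuous_intros) auto
    then have m: "(\<lambda>\<zeta>. poisson_kernel z \<zeta>) \<in> borel_measurable circle"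
      by (rule borel_measurable_circle)
    show ?thesis
      unfolding poisson_def
      by (intro if_cong integral_cong_AE refl borel_measurable_times[OF m] assms(1,2))
         (use assms(3) in \<open>eventually_elim, simp\<close>)
  qed (simp add: poisson_def)
qed

text \<open>If the Poisson integral of \<open>f - g\<close> vanishes, then so do its holomorphic and its antiholomorphic
  part, hence all Fourier coefficients of \<open>f - g\<close>.\<close>

lemma poisson_eq_iff:
  assumes f: "integrable circle f" and g: "integrable circle g"
  shows "poisson f = poisson g \<longleftrightarrow> (AE \<zeta> in circle. f \<zeta> = g \<zeta>)"
proof
  assume "AE \<zeta> in circle. f \<zeta> = g \<zeta>"
  then show "poisson f = poisson g" by (intro poisson_cong_AE) (use f g in auto)
next
  assume eq: "poisson f = poisson g"
  define d where "d \<zeta> = f \<zeta> - g \<zeta>" for \<zeta>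
  have d: "integrable circle d" unfolding d_def using f g by simp
  have cd: "integrable circle (\<lambda>\<zeta>. cnj (d \<zeta>))" using d by simp
  have zero: "szego d z + cnj (antiszego d z) = 0" if "z \<in> unit_disk" for z
  proof -
    have "szego (\<lambda>\<zeta>. cnj (d \<zeta>)) w = szego (\<lambda>\<zeta>. cnj (f \<zeta>)) w - szego (\<lambda>\<zeta>. cnj (g \<zeta>)) w" if "w \<in> unit_disk" for w
      unfolding d_def complex_cnj_diff using f g that by (intro szego_diff) auto
    then have "antiszego d z = antiszego f z - antiszego g z"
      using that by (simp add: antiszego_def)
    moreover have "szego d z = szego f z - szego g z"
      unfolding d_def by (rule szego_diff[OF f g that])
    moreover have "szego f z + cnj (antiszego f z) = szego g z + cnj (antiszego g z)"
      using poisson_eq_szego[OF f that] poisson_eq_szego[OF g that] eq by simp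
    moreover have "a - b + (c - d) = 0" if "a + c = b + d" for a b c d :: complex
      using that by algebra
    ultimately show ?thesis by simp
  qed
  then have zero': "\<forall>z\<in>unit_disk. szego d z + cnj (antiszego d z) = 0" by blast
  note H = holomorphic_pair_unique[OF szego_holomorphic[OF d] antiszego_holomorphic[OF d] antiszego_0 zero']
  have pos: "(\<integral>\<zeta>. d \<zeta> * cnj \<zeta> ^ n \<partial>circle) = 0" for n
    by (rule szego_zero_imp_coefficients_zero[OF d]) (use H(1) in blast)
  have "szego (\<lambda>\<zeta>. cnj (d \<zeta>)) 0 = cnj (szego d 0)"
    unfolding szego_def by simp
  then have "szego (\<lambda>\<zeta>. cnj (d \<zeta>)) z = 0" if "z \<in> unit_disk" for z
    using H(2)[OF that] H(1)[of 0] by (simp add: antiszego_def)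
  then have "\<forall>z\<in>unit_disk. szego (\<lambda>\<zeta>. cnj (d \<zeta>)) z = 0" by blast
  then have "(\<integral>\<zeta>. cnj (d \<zeta>) * cnj \<zeta> ^ n \<partial>circle) = 0" for n
    by (rule szego_zero_imp_coefficients_zero[OF cd])
  moreover have "(\<integral>\<zeta>. cnj (d \<zeta>) * cnj \<zeta> ^ n \<partial>circle) = cnj (\<integral>\<zeta>. d \<zeta> * \<zeta> ^ n \<partial>circle)" for n
    by (simp flip: Bochner_Integration.integral_cnj)
  ultimately have neg: "(\<integral>\<zeta>. d \<zeta> * \<zeta> ^ n \<partial>circle) = 0" for n by simp
  have "AE \<zeta> in circle. d \<zeta> = 0" by (rule fourier_coefficients_zero_imp_AE_zero[OF d pos neg])
  then show "AE \<zeta> in circle. f \<zeta> = g \<zeta>" by (simp add: d_def)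
qed

lemma integrable_poisson_kernel:
  assumes "integrable circle f" and z: "z \<in> unit_disk"
  shows "integrable circle (\<lambda>\<zeta>. poisson_kernel z \<zeta> * f \<zeta>)"
proof -
  have "continuous_on (sphere 0 1) (\<lambda>\<zeta>. poisson_kernel z \<zeta>)"
    using z by (intro continuous_intros) auto
  from integrable_circle_mult_continuous[OF assms(1) this] show ?thesis by (simp only: mult.commute)
qed

lemma poisson_outside: "z \<notin> unit_disk \<Longrightarrow> poisson f z = 0"
  by (simp only: poisson_def if_False)

lemma poisson_add:
  assumes "integrable circle f" "integrable circle g"
  shows "poisson (\<lambda>\<zeta>. f \<zeta> + g \<zeta>) = (\<lambda>z. poisson f z + poisson g z)"
proof
  fix z show "poisson (\<lambda>\<zeta>. f \<zeta> + g \<zeta>) z = poisson f z + poisson g z"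
    unfolding poisson_def distrib_left
    using Bochner_Integration.integral_add[OF integrable_poisson_kernel[OF assms(1)] integrable_poisson_kernel[OF assms(2)]]
    by simp
qed

lemma poisson_cmult: "poisson (\<lambda>\<zeta>. c * f \<zeta>) = (\<lambda>z. c * poisson f z)"
proof
  fix z
  have "(\<lambda>\<zeta>. poisson_kernel z \<zeta> * (c * f \<zeta>)) =
    (\<lambda>\<zeta>. c * (poisson_kernel z \<zeta> * f \<zeta>))"
    by (simp only: mult.left_commute)
  then show "poisson (\<lambda>\<zeta>. c * f \<zeta>) z = c * poisson f z"
    unfolding poisson_def by (simp only: integral_mult_right_zero) simp
qed

lemma poisson_diff:
  assumes "integrable circle f" "integrable circle g"
  shows "poisson (\<lambda>\<zeta>. f \<zeta> - g \<zeta>) = (\<lambda>z. poisson f z - poisson g z)"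
  using poisson_add[OF assms(1), of "\<lambda>\<zeta>. (-1) * g \<zeta>"] assms(2) poisson_cmult[of "-1" g] by simp

lemma poisson_cnj: "poisson (\<lambda>\<zeta>. cnj (f \<zeta>)) z = cnj (poisson f z)"
proof -
  have "(\<lambda>\<zeta>. poisson_kernel z \<zeta> * cnj (f \<zeta>)) =
    (\<lambda>\<zeta>. cnj (poisson_kernel z \<zeta> * f \<zeta>))"
    by (simp only: complex_cnj_mult complex_cnj_complex_of_real)
  then show ?thesis
    unfolding poisson_def by (simp only: Bochner_Integration.integral_cnj) simp
qed

lemma l2norm_cnj [simp]: "l2norm M (\<lambda>x. cnj (f x)) = l2norm M f"
  by (simp add: l2norm_def)

lemma poisson_bound:
  assumes f: "f \<in> L2 circle" and z: "z \<in> unit_disk"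
  shows "cmod (poisson f z) \<le> 3 / (1 - cmod z) * l2norm circle f"
proof -
  note cf = L2_cnj[OF f]
  have "cmod (poisson f z) \<le> cmod (szego f z) + (cmod (szego (\<lambda>\<zeta>. cnj (f \<zeta>)) z) + cmod (szego (\<lambda>\<zeta>. cnj (f \<zeta>)) 0))"
    unfolding poisson_eq_szego[OF circle.L2_imp_integrable[OF f] z] antiszego_def
    by (intro order_trans[OF norm_triangle_ineq] add_left_mono) (simp only: complex_mod_cnj norm_triangle_ineq4)
  also have "\<dots> \<le> l2norm circle f / (1 - cmod z) + (l2norm circle f / (1 - cmod z) + l2norm circle f / (1 - cmod 0))"
    using szego_bound[OF f z] szego_bound[OF cf z] szego_bound[OF cf, of 0]
    by (intro add_mono) auto
  also have "\<dots> \<le> l2norm circle f / (1 - cmod z) + (l2norm circle f / (1 - cmod z) + l2norm circle f / (1 - cmod z))"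
    using z by (intro add_left_mono divide_left_mono) auto
  finally show ?thesis by simp
qed

text \<open>Expand \<open>f * g - \<phi> * \<gamma>\<close> in powers of the two differences and apply Cauchy--Schwarz to each term.\<close>

lemma l2_tendsto_mult:
  assumes f: "\<forall>\<^sub>F r in F. f r \<in> L2 M" and g: "\<forall>\<^sub>F r in F. g r \<in> L2 M"
    and \<phi>: "\<phi> \<in> L2 M" and \<gamma>: "\<gamma> \<in> L2 M"
    and fl: "((\<lambda>r. l2norm M (\<lambda>x. f r x - \<phi> x)) \<longlongrightarrow> 0) F" and gl: "((\<lambda>r. l2norm M (\<lambda>x. g r x - \<gamma> x)) \<longlongrightarrow> 0) F"
  shows "((\<lambda>r. \<integral>x. f r x * g r x \<partial>M) \<longlongrightarrow> (\<integral>x. \<phi> x * \<gamma> x \<partial>M)) F"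
proof (rule LIM_zero_cancel, rule Lim_null_comparison)
  let ?a = "\<lambda>r. l2norm M (\<lambda>x. f r x - \<phi> x)" and ?b = "\<lambda>r. l2norm M (\<lambda>x. g r x - \<gamma> x)"
  show "\<forall>\<^sub>F r in F. norm ((\<integral>x. f r x * g r x \<partial>M) - (\<integral>x. \<phi> x * \<gamma> x \<partial>M)) \<le>
     ?a r * ?b r + ?a r * l2norm M \<gamma> + l2norm M \<phi> * ?b r"
    using f g
  proof eventually_elim
    fix r assume fr: "f r \<in> L2 M" and gr: "g r \<in> L2 M"
    have d: "(\<lambda>x. f r x - \<phi> x) \<in> L2 M" "(\<lambda>x. g r x - \<gamma> x) \<in> L2 M"
      by (intro L2_diff fr gr \<phi> \<gamma>)+
    note i = L2_mult[OF d] L2_mult[OF d(1) \<gamma>] L2_mult[OF \<phi> d(2)]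
    have "(\<integral>x. f r x * g r x \<partial>M) - (\<integral>x. \<phi> x * \<gamma> x \<partial>M) = (\<integral>x. f r x * g r x - \<phi> x * \<gamma> x \<partial>M)"
      by (intro Bochner_Integration.integral_diff[symmetric] L2_mult fr gr \<phi> \<gamma>)
    also have "\<dots> = (\<integral>x. (f r x - \<phi> x) * (g r x - \<gamma> x) + (f r x - \<phi> x) * \<gamma> x + \<phi> x * (g r x - \<gamma> x) \<partial>M)"
      by (intro Bochner_Integration.integral_cong refl) (simp add: algebra_simps)
    also have "\<dots> = (\<integral>x. (f r x - \<phi> x) * (g r x - \<gamma> x) \<partial>M) + (\<integral>x. (f r x - \<phi> x) * \<gamma> x \<partial>M) + (\<integral>x. \<phi> x * (g r x - \<gamma> x) \<partial>M)"
      using i by (simp only: Bochner_Integration.integral_add Bochner_Integration.integrable_add)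
    finally show "norm ((\<integral>x. f r x * g r x \<partial>M) - (\<integral>x. \<phi> x * \<gamma> x \<partial>M)) \<le>
      ?a r * ?b r + ?a r * l2norm M \<gamma> + l2norm M \<phi> * ?b r"
      using l2_cauchy_schwarz[OF d] l2_cauchy_schwarz[OF d(1) \<gamma>] l2_cauchy_schwarz[OF \<phi> d(2)]
      by (metis (no_types, lifting) norm_triangle_mono)
  qed
  have "((\<lambda>r. ?a r * ?b r + ?a r * l2norm M \<gamma> + l2norm M \<phi> * ?b r) \<longlongrightarrow> 0 * 0 + 0 * l2norm M \<gamma> + l2norm M \<phi> * 0) F"
    by (intro tendsto_add tendsto_mult tendsto_const fl gl)
  then show "((\<lambda>r. ?a r * ?b r + ?a r * l2norm M \<gamma> + l2norm M \<phi> * ?b r) \<longlongrightarrow> 0) F" by simp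
qed

section \<open>Boundary functions in the Hardy space\<close>

definition taylor :: "(complex \<Rightarrow> complex) \<Rightarrow> nat \<Rightarrow> complex" where
  "taylor f n = (deriv ^^ n) f 0 / fact n"

definition dilate :: "(complex \<Rightarrow> complex) \<Rightarrow> real \<Rightarrow> complex \<Rightarrow> complex" where
  "dilate f r \<zeta> = f (of_real r * \<zeta>)"

lemma taylor_0 [simp]: "taylor f 0 = f 0" by (simp add: taylor_def)

lemma taylor_sums:
  assumes "f holomorphic_on unit_disk" "z \<in> unit_disk"
  shows "(\<lambda>n. taylor f n * z ^ n) sums f z"
  using holomorphic_power_series[OF assms] by (simp only: taylor_def diff_zero)

lemma taylor_summable:
  assumes f: "f holomorphic_on unit_disk" and r: "0 \<le> r" "r < 1"
  shows "summable (\<lambda>n. cmod (taylor f n * of_real r ^ n))"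
proof (rule powser_insidea)
  have "complex_of_real ((1 + r) / 2) \<in> unit_disk"
    using r unfolding mem_ball dist_0_norm norm_of_real by simp
  then show "summable (\<lambda>n. taylor f n * complex_of_real ((1 + r) / 2) ^ n)"
    using taylor_sums[OF f] sums_summable by blast
  show "norm (complex_of_real r) < norm (complex_of_real ((1 + r) / 2))"
    using r by (simp only: norm_of_real) simp
qed

lemma dilate_in_disk:
  assumes "0 \<le> r" "r < 1" "cmod \<zeta> \<le> 1" shows "of_real r * \<zeta> \<in> unit_disk"
proof -
  have "cmod (of_real r * \<zeta>) \<le> r * 1" using assms by (simp only: norm_mult norm_of_real abs_of_nonneg mult_left_mono)
  then show ?thesis using assms by simp
qed

lemma dilate_continuous:
  assumes f: "f holomorphic_on unit_disk" and r: "0 \<le> r" "r < 1"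
  shows "continuous_on (sphere 0 1) (dilate f r)"
  unfolding dilate_def
proof (rule continuous_on_compose2[OF holomorphic_on_imp_continuous_on[OF f]])
  show "continuous_on (sphere 0 1) (\<lambda>\<zeta>. complex_of_real r * \<zeta>)" by (intro continuous_intros)
  show "(\<lambda>\<zeta>. complex_of_real r * \<zeta>) ` sphere 0 1 \<subseteq> unit_disk" using dilate_in_disk[OF r] by auto
qed

lemma dilate_L2:
  assumes "f holomorphic_on unit_disk" "0 \<le> r" "r < 1"
  shows "dilate f r \<in> L2 circle"
  by (rule L2_continuous[OF dilate_continuous[OF assms]])

text \<open>All integrals of dilates below are evaluated by this formula: against \<open>cnj \<zeta> ^ m\<close>, \<open>\<zeta> ^ m\<close> or
  another dilate at most one Fourier coefficient of \<open>\<phi>\<close>, or a Parseval series, survives.\<close>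

lemma dilate_pairing:
  assumes f: "f holomorphic_on unit_disk" and r: "0 \<le> r" "r < 1" and \<phi>: "integrable circle \<phi>"
  shows "(\<lambda>n. taylor f n * of_real r ^ n * (\<integral>\<zeta>. \<phi> \<zeta> * \<zeta> ^ n \<partial>circle)) sums (\<integral>\<zeta>. \<phi> \<zeta> * dilate f r \<zeta> \<partial>circle)"
proof -
  have "(\<lambda>n. taylor f n * of_real r ^ n * (\<integral>\<zeta>. \<phi> \<zeta> * \<zeta> ^ n \<partial>circle)) sums
     (\<integral>\<zeta>. \<phi> \<zeta> * (\<Sum>n. taylor f n * of_real r ^ n * \<zeta> ^ n) \<partial>circle)"
    by (rule circle_integral_power_series[OF \<phi> continuous_on_id _ taylor_summable[OF f r]])
  moreover have "(\<integral>\<zeta>. \<phi> \<zeta> * (\<Sum>n. taylor f n * of_real r ^ n * \<zeta> ^ n) \<partial>circle) = (\<integral>\<zeta>. \<phi> \<zeta> * dilate f r \<zeta> \<partial>circle)"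
  proof (rule Bochner_Integration.integral_cong[OF refl])
    fix \<zeta> assume "\<zeta> \<in> space circle"
    then have "complex_of_real r * \<zeta> \<in> unit_disk" by (intro dilate_in_disk[OF r]) simp
    from sums_unique[OF taylor_sums[OF f this]]
    show "\<phi> \<zeta> * (\<Sum>n. taylor f n * of_real r ^ n * \<zeta> ^ n) = \<phi> \<zeta> * dilate f r \<zeta>"
      by (simp only: dilate_def power_mult_distrib mult.assoc)
  qed
  ultimately show ?thesis by (simp only:)
qed

lemma circle_power_integrable: "integrable circle (\<lambda>\<zeta>. \<zeta> ^ m)" "integrable circle (\<lambda>\<zeta>. cnj \<zeta> ^ m)"
  by (rule circle.L2_imp_integrable[OF L2_continuous]; intro continuous_intros)+

lemma sums_single_unique:
  fixes s :: complex
  assumes "f sums s" and "f = (\<lambda>n. if n = m then g n else 0)" shows "s = g m"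
  by (rule sums_unique2[OF assms(1)]) (simp only: assms(2) sums_single)

lemma dilate_coefficient:
  assumes f: "f holomorphic_on unit_disk" and r: "0 \<le> r" "r < 1"
  shows "(\<integral>\<zeta>. dilate f r \<zeta> * cnj \<zeta> ^ m \<partial>circle) = taylor f m * of_real r ^ m"
proof -
  have "(\<integral>\<zeta>. cnj \<zeta> ^ m * \<zeta> ^ n \<partial>circle) = (if n = m then 1 else 0)" for n
    using circle_orthonormal[of n m] by (simp only: mult.commute)
  then have eq: "(\<lambda>n. taylor f n * of_real r ^ n * (\<integral>\<zeta>. cnj \<zeta> ^ m * \<zeta> ^ n \<partial>circle)) =
     (\<lambda>n. if n = m then taylor f n * of_real r ^ n else 0)"
    by (simp add: fun_eq_iff)
  have "(\<integral>\<zeta>. cnj \<zeta> ^ m * dilate f r \<zeta> \<partial>circle) = taylor f m * of_real r ^ m"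
    by (rule sums_single_unique[OF dilate_pairing[OF f r circle_power_integrable(2)] eq])
  then show ?thesis by (simp only: mult.commute)
qed

lemma dilate_power_integral:
  assumes f: "f holomorphic_on unit_disk" and r: "0 \<le> r" "r < 1"
  shows "(\<integral>\<zeta>. dilate f r \<zeta> * \<zeta> ^ m \<partial>circle) = (if m = 0 then f 0 else 0)"
proof (cases "m = 0")
  case True
  then show ?thesis using dilate_coefficient[OF assms, of 0] by simp
next
  case False
  have "(\<integral>\<zeta>. \<zeta> ^ m * \<zeta> ^ n \<partial>circle) = 0" for n
    using circle_integral_power[of "m + n"] False by (simp add: power_add)
  with dilate_pairing[OF f r circle_power_integrable(1)[of m]]
  have "(\<lambda>n. 0) sums (\<integral>\<zeta>. \<zeta> ^ m * dilate f r \<zeta> \<partial>circle)" by simp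
  then have "(\<integral>\<zeta>. \<zeta> ^ m * dilate f r \<zeta> \<partial>circle) = 0"
    by (rule sums_unique2[OF _ sums_zero])
  then show ?thesis using False by (simp add: mult.commute)
qed

text \<open>The Fourier coefficients of both factors vanish at negative indices, so only the constant terms meet.\<close>

lemma dilate_mult_integral:
  assumes f: "f holomorphic_on unit_disk" and g: "g holomorphic_on unit_disk" and r: "0 \<le> r" "r < 1"
  shows "(\<integral>\<zeta>. dilate f r \<zeta> * dilate g r \<zeta> \<partial>circle) = f 0 * g 0"
proof -
  have gi: "integrable circle (dilate g r)"
    by (rule circle.L2_imp_integrable[OF dilate_L2[OF g r]])
  have eq: "(\<lambda>n. taylor f n * of_real r ^ n * (\<integral>\<zeta>. dilate g r \<zeta> * \<zeta> ^ n \<partial>circle)) =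
     (\<lambda>n. if n = 0 then taylor f n * of_real r ^ n * g 0 else 0)"
    by (simp add: fun_eq_iff dilate_power_integral[OF g r])
  have "(\<integral>\<zeta>. dilate g r \<zeta> * dilate f r \<zeta> \<partial>circle) = taylor f 0 * of_real r ^ 0 * g 0"
    by (rule sums_single_unique[OF dilate_pairing[OF f r gi] eq])
  then show ?thesis by (simp add: mult.commute)
qed

lemma dilate_ip_sums:
  assumes f: "f holomorphic_on unit_disk" and r: "0 \<le> r" "r < 1" and s: "0 \<le> s" "s < 1"
  shows "(\<lambda>n. (cmod (taylor f n))\<^sup>2 * (r * s) ^ n) sums Re (\<integral>\<zeta>. dilate f r \<zeta> * cnj (dilate f s \<zeta>) \<partial>circle)"
proof -
  have si: "integrable circle (\<lambda>\<zeta>. cnj (dilate f s \<zeta>))"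
    using circle.L2_imp_integrable[OF dilate_L2[OF f s]] by simp
  have "(\<integral>\<zeta>. cnj (dilate f s \<zeta>) * \<zeta> ^ n \<partial>circle) = cnj (taylor f n * of_real s ^ n)" for n
  proof -
    have "(\<integral>\<zeta>. cnj (dilate f s \<zeta>) * \<zeta> ^ n \<partial>circle) = (\<integral>\<zeta>. cnj (dilate f s \<zeta> * cnj \<zeta> ^ n) \<partial>circle)" by simp
    also have "\<dots> = cnj (\<integral>\<zeta>. dilate f s \<zeta> * cnj \<zeta> ^ n \<partial>circle)" by (rule Bochner_Integration.integral_cnj)
    finally show ?thesis by (simp only: dilate_coefficient[OF f s])
  qed
  moreover have "Re (taylor f n * of_real r ^ n * cnj (taylor f n * of_real s ^ n)) = (cmod (taylor f n))\<^sup>2 * (r * s) ^ n" for n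
  proof -
    have "taylor f n * of_real r ^ n * cnj (taylor f n * of_real s ^ n) =
       (taylor f n * cnj (taylor f n)) * (of_real r * of_real s) ^ n"
      by (simp add: power_mult_distrib)
    also have "\<dots> = of_real ((cmod (taylor f n))\<^sup>2 * (r * s) ^ n)"
      by (simp only: of_real_mult complex_norm_square) simp
    finally show ?thesis by (simp only: Re_complex_of_real)
  qed
  ultimately show ?thesis
    using sums_Re[OF dilate_pairing[OF f r si]] by (simp only: mult.commute[of _ "cnj (dilate f s _)"])
qed

lemma szego_cnj_dilate_coefficient:
  assumes f: "f holomorphic_on unit_disk" and r: "0 \<le> r" "r < 1"
  shows "(\<integral>\<zeta>. cnj (dilate f r \<zeta>) * cnj \<zeta> ^ n \<partial>circle) = (if n = 0 then cnj (f 0) else 0)"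
proof -
  have "(\<integral>\<zeta>. cnj (dilate f r \<zeta>) * cnj \<zeta> ^ n \<partial>circle) = (\<integral>\<zeta>. cnj (dilate f r \<zeta> * \<zeta> ^ n) \<partial>circle)" by simp
  also have "\<dots> = cnj (\<integral>\<zeta>. dilate f r \<zeta> * \<zeta> ^ n \<partial>circle)" by (rule Bochner_Integration.integral_cnj)
  finally show ?thesis by (simp add: dilate_power_integral[OF assms])
qed

text \<open>A dilate is holomorphic across the circle, so its Cauchy integral reproduces it and its
  antiholomorphic part vanishes.\<close>

lemma poisson_dilate:
  assumes f: "f holomorphic_on unit_disk" and r: "0 \<le> r" "r < 1" and z: "z \<in> unit_disk"
  shows "poisson (dilate f r) z = f (of_real r * z)"
proof -
  have i: "integrable circle (dilate f r)" "integrable circle (\<lambda>\<zeta>. cnj (dilate f r \<zeta>))"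
    using circle.L2_imp_integrable[OF dilate_L2[OF f r]] by simp_all
  have "of_real r * z \<in> unit_disk" using z by (intro dilate_in_disk[OF r]) simp
  from taylor_sums[OF f this] szego_sums[OF i(1) z]
  have 1: "szego (dilate f r) z = f (of_real r * z)"
    unfolding dilate_coefficient[OF f r] power_mult_distrib mult.assoc by (rule sums_unique2[symmetric])
  have 2: "szego (\<lambda>\<zeta>. cnj (dilate f r \<zeta>)) w = cnj (f 0)" if w: "w \<in> unit_disk" for w
  proof -
    have eq: "(\<lambda>n. (\<integral>\<zeta>. cnj (dilate f r \<zeta>) * cnj \<zeta> ^ n \<partial>circle) * w ^ n) = (\<lambda>n. if n = 0 then cnj (f 0) * w ^ n else 0)"
      by (simp add: fun_eq_iff szego_cnj_dilate_coefficient[OF f r])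
    have "szego (\<lambda>\<zeta>. cnj (dilate f r \<zeta>)) w = cnj (f 0) * w ^ 0"
      by (rule sums_single_unique[OF szego_sums[OF i(2) w] eq])
    then show ?thesis by simp
  qed
  show ?thesis
    using 2[OF z] 2[of 0] by (simp add: poisson_eq_szego[OF i(1) z] 1 antiszego_def)
qed

text \<open>Let $M(t) = \<Sum>_n |a_n|^2 t^n$ with $a_n$ the Taylor coefficients of \<open>f\<close>. By Parseval the inner product of the dilates by
  \<open>r\<close> and \<open>s\<close> is \<open>M (r * s)\<close>, so the squared distance between them is
  \<open>M (r\<^sup>2) + M (s\<^sup>2) - 2 * M (r * s)\<close>. As \<open>M\<close> is increasing and bounded on \<open>[0, 1)\<close>, all three values are close to
  its supremum when \<open>r\<close> and \<open>s\<close> are close to \<open>1\<close>.\<close>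

lemma Hardy2_dilates_Cauchy:
  assumes f: "f \<in> Hardy2" and e: "e > 0"
  shows "\<exists>r0\<in>{0..<1}. \<forall>r\<in>{r0..<1}. \<forall>s\<in>{r0..<1}. l2norm circle (\<lambda>\<zeta>. dilate f r \<zeta> - dilate f s \<zeta>) < e"
proof -
  have hol: "f holomorphic_on unit_disk" using f by (simp add: Hardy2_def)
  obtain C where C: "\<And>r. r \<in> {0..<1} \<Longrightarrow> (\<integral>\<zeta>. (cmod (f (complex_of_real r * \<zeta>)))\<^sup>2 \<partial>circle) \<le> C"
    using f unfolding Hardy2_def by blast
  define M where "M t = (\<Sum>n. (cmod (taylor f n))\<^sup>2 * t ^ n)" for t
  have M_sums: "(\<lambda>n. (cmod (taylor f n))\<^sup>2 * (r * s) ^ n) sums M (r * s)"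
    and M_ip: "Re (\<integral>\<zeta>. dilate f r \<zeta> * cnj (dilate f s \<zeta>) \<partial>circle) = M (r * s)"
    if "r \<in> {0..<1}" "s \<in> {0..<1}" for r s
    using dilate_ip_sums[OF hol, of r s] that by (auto simp: M_def sums_iff)
  have sq: "dilate f r \<in> L2 circle" if "r \<in> {0..<1}" for r
    using that by (intro dilate_L2[OF hol]) auto
  have M_sqrt: "(\<lambda>n. (cmod (taylor f n))\<^sup>2 * t ^ n) sums M t" if "t \<in> {0..<1}" for t
    using M_sums[of "sqrt t" "sqrt t"] that by simp
  have M_mono: "M s \<le> M t" if "0 \<le> s" "s \<le> t" "t < 1" for s t
  proof (rule sums_le[OF _ M_sqrt M_sqrt])
    show "(cmod (taylor f n))\<^sup>2 * s ^ n \<le> (cmod (taylor f n))\<^sup>2 * t ^ n" for n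
      using that by (intro mult_left_mono power_mono) auto
  qed (use that in auto)
  have nrm: "(l2norm circle (dilate f r))\<^sup>2 = M (r * r)" if "r \<in> {0..<1}" for r
  proof -
    have "M (r * r) = (\<integral>\<zeta>. Re (dilate f r \<zeta> * cnj (dilate f r \<zeta>)) \<partial>circle)"
      unfolding M_ip[OF that that, symmetric] by (rule integral_Re[OF integrable_ip[OF sq[OF that] sq[OF that]], symmetric])
    then show ?thesis by (simp add: l2norm_power2 complex_norm_square[symmetric] Re_complex_of_real flip: of_real_power)
  qed
  have M_le: "M t \<le> C" if "t \<in> {0..<1}" for t
  proof -
    have s: "sqrt t \<in> {0..<1}" using that by simp
    have "M t = (l2norm circle (dilate f (sqrt t)))\<^sup>2" using nrm[OF s] that by simp
    then show ?thesis using C[OF s] by (simp add: l2norm_power2 dilate_def)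
  qed
  define L where "L = (SUP t\<in>{0..<1}. M t)"
  have bdd: "bdd_above (M ` {0..<1})" unfolding bdd_above_def using M_le by blast
  have M_L: "M t \<le> L" if "t \<in> {0..<1}" for t
    unfolding L_def by (rule cSUP_upper[OF that bdd])
  have "\<exists>t\<in>{0..<1}. L - e\<^sup>2 / 2 < M t"
  proof -
    have "L - e\<^sup>2 / 2 < (SUP t\<in>{0..<1}. M t)" using e by (simp add: L_def)
    then show ?thesis by (subst (asm) less_cSUP_iff[OF _ bdd]) auto
  qed
  then obtain t0 where t0: "t0 \<in> {0..<1}" "L - e\<^sup>2 / 2 < M t0" by blast
  have "l2norm circle (\<lambda>\<zeta>. dilate f r \<zeta> - dilate f s \<zeta>) < e"
    if "r \<in> {sqrt t0..<1}" "s \<in> {sqrt t0..<1}" for r s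
  proof -
    have "0 \<le> sqrt t0" using t0 by simp
    with that have rs: "r \<in> {0..<1}" "s \<in> {0..<1}" unfolding atLeastLessThan_iff by linarith+
    have prod: "r * r \<in> {0..<1}" "s * s \<in> {0..<1}" "r * s < 1" "0 \<le> r * s"
      using rs mult_strict_mono[of r 1 r 1] mult_strict_mono[of s 1 s 1] mult_strict_mono[of r 1 s 1] by auto
    have "sqrt t0 * sqrt t0 \<le> r * s" using that rs \<open>0 \<le> sqrt t0\<close>
      unfolding atLeastLessThan_iff by (intro mult_mono) linarith+
    then have "t0 \<le> r * s" using t0 by simp
    then have M_rs: "L - e\<^sup>2 / 2 < M (r * s)" using M_mono[of t0 "r * s"] t0 prod by auto
    have i: "integrable circle (\<lambda>\<zeta>. (cmod (dilate f r \<zeta>))\<^sup>2)" "integrable circle (\<lambda>\<zeta>. (cmod (dilate f s \<zeta>))\<^sup>2)"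
      "integrable circle (\<lambda>\<zeta>. Re (dilate f r \<zeta> * cnj (dilate f s \<zeta>)))"
      by (intro L2_cmod2 integrable_Re integrable_ip sq rs)+
    have "(l2norm circle (\<lambda>\<zeta>. dilate f r \<zeta> - dilate f s \<zeta>))\<^sup>2 =
        (\<integral>\<zeta>. (cmod (dilate f r \<zeta>))\<^sup>2 + (cmod (dilate f s \<zeta>))\<^sup>2 - 2 * Re (dilate f r \<zeta> * cnj (dilate f s \<zeta>)) \<partial>circle)"
      unfolding l2norm_power2
      by (intro Bochner_Integration.integral_cong refl) (simp only: cmod_power2, simp add: power2_eq_square algebra_simps)
    also have "\<dots> = (l2norm circle (dilate f r))\<^sup>2 + (l2norm circle (dilate f s))\<^sup>2
        - 2 * (\<integral>\<zeta>. Re (dilate f r \<zeta> * cnj (dilate f s \<zeta>)) \<partial>circle)"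
    proof -
      have "(\<integral>\<zeta>. A \<zeta> + B \<zeta> - 2 * R \<zeta> \<partial>circle) = (\<integral>\<zeta>. A \<zeta> \<partial>circle) + (\<integral>\<zeta>. B \<zeta> \<partial>circle) - 2 * (\<integral>\<zeta>. R \<zeta> \<partial>circle)"
        if "integrable circle A" "integrable circle B" "integrable circle R" for A B R :: "complex \<Rightarrow> real"
        using that by simp
      from this[OF i] show ?thesis by (simp only: l2norm_power2)
    qed
    also have "\<dots> = M (r * r) + M (s * s) - 2 * M (r * s)"
      by (simp only: integral_Re[OF integrable_ip[OF sq[OF rs(1)] sq[OF rs(2)]]] M_ip[OF rs] nrm[OF rs(1)] nrm[OF rs(2)])
    also have "\<dots> < e\<^sup>2" using M_L[OF prod(1)] M_L[OF prod(2)] M_rs by linarith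
    finally show ?thesis using e by (auto intro: power2_less_imp_less)
  qed
  then show ?thesis using t0 by (intro bexI[of _ "sqrt t0"]) auto
qed

lemma Hardy2_boundary_exists:
  assumes f: "f \<in> Hardy2"
  shows "\<exists>\<phi>\<in>L2 circle. ((\<lambda>r. l2norm circle (\<lambda>\<zeta>. dilate f r \<zeta> - \<phi> \<zeta>)) \<longlongrightarrow> 0) (at_left 1)"
proof -
  have hol: "f holomorphic_on unit_disk" using f by (simp add: Hardy2_def)
  have sq: "dilate f r \<in> L2 circle" if "r \<in> {0..<1}" for r
    using that by (intro dilate_L2[OF hol]) auto
  define \<rho> where "\<rho> n = 1 - 1 / real (Suc n)" for n
  have \<rho>: "\<rho> n \<in> {0..<1}" for n by (simp add: \<rho>_def)
  have "\<rho> \<longlonglongrightarrow> 1 - 0" unfolding \<rho>_def by (intro tendsto_diff tendsto_const lim_1_over_real_power[of 0, simplified] LIMSEQ_Suc[OF lim_inverse_n'])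
  then have \<rho>_lim: "\<rho> \<longlonglongrightarrow> 1" by simp
  have \<rho>_ev: "\<forall>\<^sub>F n in sequentially. \<rho> n \<in> {r0..<1}" if "r0 \<in> {0..<1}" for r0
    using order_tendstoD(1)[OF \<rho>_lim, of r0] that
    by (auto elim!: eventually_mono) (use \<rho> in auto)
  have C: "l2_Cauchy circle (\<lambda>n. dilate f (\<rho> n))"
    unfolding l2_Cauchy_def
  proof (intro allI impI)
    fix e :: real assume "e > 0"
    then obtain r0 where r0: "r0 \<in> {0..<1}" "\<And>r s. r \<in> {r0..<1} \<Longrightarrow> s \<in> {r0..<1} \<Longrightarrow> l2norm circle (\<lambda>\<zeta>. dilate f r \<zeta> - dilate f s \<zeta>) < e"
      using Hardy2_dilates_Cauchy[OF f] by blast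
    then show "\<exists>N. \<forall>m\<ge>N. \<forall>n\<ge>N. l2norm circle (\<lambda>x. dilate f (\<rho> m) x - dilate f (\<rho> n) x) < e"
      using \<rho>_ev[OF r0(1)] unfolding eventually_sequentially by meson
  qed
  obtain \<phi> where \<phi>: "\<phi> \<in> L2 circle" "(\<lambda>n. l2norm circle (\<lambda>\<zeta>. dilate f (\<rho> n) \<zeta> - \<phi> \<zeta>)) \<longlonglongrightarrow> 0"
    using circle.l2_Cauchy_convergent[OF sq[OF \<rho>] C] by blast
  have "((\<lambda>r. l2norm circle (\<lambda>\<zeta>. dilate f r \<zeta> - \<phi> \<zeta>)) \<longlongrightarrow> 0) (at_left 1)"
  proof (rule tendstoI)
    fix e :: real assume "e > 0"
    then obtain r0 where r0: "r0 \<in> {0..<1}" "\<And>r s. r \<in> {r0..<1} \<Longrightarrow> s \<in> {r0..<1} \<Longrightarrow> l2norm circle (\<lambda>\<zeta>. dilate f r \<zeta> - dilate f s \<zeta>) < e / 2"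
      using Hardy2_dilates_Cauchy[OF f, of "e / 2"] by fastforce
    have "\<forall>\<^sub>F n in sequentially. l2norm circle (\<lambda>\<zeta>. dilate f (\<rho> n) \<zeta> - \<phi> \<zeta>) < e / 2"
      using order_tendstoD(2)[OF \<phi>(2), of "e / 2"] \<open>e > 0\<close> by simp
    then have "\<exists>n. l2norm circle (\<lambda>\<zeta>. dilate f (\<rho> n) \<zeta> - \<phi> \<zeta>) < e / 2 \<and> \<rho> n \<in> {r0..<1}"
      using \<rho>_ev[OF r0(1)] eventually_happens'[OF sequentially_bot] eventually_conj by blast
    then obtain n where n: "l2norm circle (\<lambda>\<zeta>. dilate f (\<rho> n) \<zeta> - \<phi> \<zeta>) < e / 2" "\<rho> n \<in> {r0..<1}" by blast
    have "\<forall>\<^sub>F r in at_left 1. r \<in> {r0<..<1}"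
      using r0(1) by (intro eventually_at_left_real) simp
    then show "\<forall>\<^sub>F r in at_left 1. dist (l2norm circle (\<lambda>\<zeta>. dilate f r \<zeta> - \<phi> \<zeta>)) 0 < e"
    proof eventually_elim
      fix r assume "r \<in> {r0<..<1}"
      then have r: "r \<in> {r0..<1}" "r \<in> {0..<1}" using r0(1) by auto
      have "l2norm circle (\<lambda>\<zeta>. (dilate f r \<zeta> - dilate f (\<rho> n) \<zeta>) + (dilate f (\<rho> n) \<zeta> - \<phi> \<zeta>)) < e"
        using l2norm_triangle[OF L2_diff[OF sq[OF r(2)] sq[OF \<rho>[of n]]] L2_diff[OF sq[OF \<rho>[of n]] \<phi>(1)]]
          n(1) r0(2)[OF r(1) n(2)] by linarith
      then show "dist (l2norm circle (\<lambda>\<zeta>. dilate f r \<zeta> - \<phi> \<zeta>)) 0 < e" by simp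
    qed
  qed
  with \<phi>(1) show ?thesis by blast
qed

lemma L2_circle_eq: "L2_circle = L2 circle"
  unfolding L2_circle_def by (auto simp: L2_iff_nn)

text \<open>Rephrases the limit in the definition of \<open>boundary\<close> in terms of the $L^2$ norm.\<close>

lemma boundary_limit_iff:
  assumes hol: "f holomorphic_on unit_disk" and \<phi>: "\<phi> \<in> L2 circle"
  shows "((\<lambda>r. \<integral>\<^sup>+ \<zeta>. ennreal ((cmod (f (complex_of_real r * \<zeta>) - \<phi> \<zeta>))\<^sup>2) \<partial>circle) \<longlongrightarrow> 0) (at_left 1) \<longleftrightarrow>
    ((\<lambda>r. l2norm circle (\<lambda>\<zeta>. dilate f r \<zeta> - \<phi> \<zeta>)) \<longlongrightarrow> 0) (at_left 1)" (is "(?I \<longlongrightarrow> 0) _ \<longleftrightarrow> (?n \<longlongrightarrow> 0) _")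
proof -
  have "\<forall>\<^sub>F r in at_left (1::real). r \<in> {0<..<1}" by (intro eventually_at_left_real) simp
  then have ev: "\<forall>\<^sub>F r in at_left 1. ?I r = ennreal ((?n r)\<^sup>2)"
  proof eventually_elim
    fix r :: real assume "r \<in> {0<..<1}"
    then have "(\<lambda>\<zeta>. dilate f r \<zeta> - \<phi> \<zeta>) \<in> L2 circle"
      by (intro L2_diff \<phi> dilate_L2 hol) auto
    from nn_integral_l2norm[OF this] show "?I r = ennreal ((?n r)\<^sup>2)"
      by (simp only: dilate_def)
  qed
  have "(?I \<longlongrightarrow> 0) (at_left 1) \<longleftrightarrow> ((\<lambda>r. ennreal ((?n r)\<^sup>2)) \<longlongrightarrow> ennreal 0) (at_left 1)"
    using tendsto_cong[OF ev] by simp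
  also have "\<dots> \<longleftrightarrow> ((\<lambda>r. (?n r)\<^sup>2) \<longlongrightarrow> 0) (at_left 1)"
    by (rule tendsto_ennreal_iff) auto
  also have "\<dots> \<longleftrightarrow> (?n \<longlongrightarrow> 0) (at_left 1)"
  proof
    assume "((\<lambda>r. (?n r)\<^sup>2) \<longlongrightarrow> 0) (at_left 1)"
    from tendsto_real_sqrt[OF this] show "(?n \<longlongrightarrow> 0) (at_left 1)" by simp
  next
    assume "(?n \<longlongrightarrow> 0) (at_left 1)"
    from tendsto_power[OF this, of 2] show "((\<lambda>r. (?n r)\<^sup>2) \<longlongrightarrow> 0) (at_left 1)" by simp
  qed
  finally show ?thesis .
qed

lemma boundary_Hardy2:
  assumes f: "f \<in> Hardy2"
  shows "boundary f \<in> L2 circle"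
    "((\<lambda>r. l2norm circle (\<lambda>\<zeta>. dilate f r \<zeta> - boundary f \<zeta>)) \<longlongrightarrow> 0) (at_left 1)"
proof -
  have hol: "f holomorphic_on unit_disk" using f by (simp add: Hardy2_def)
  define Q where "Q \<phi> \<longleftrightarrow> \<phi> \<in> L2_circle \<and>
     ((\<lambda>r. \<integral>\<^sup>+ \<zeta>. ennreal ((cmod (f (complex_of_real r * \<zeta>) - \<phi> \<zeta>))\<^sup>2) \<partial>circle) \<longlongrightarrow> 0) (at_left 1)" for \<phi>
  have "\<exists>\<phi>. Q \<phi>"
    using Hardy2_boundary_exists[OF f] boundary_limit_iff[OF hol] unfolding Q_def L2_circle_eq by blast
  then have "Q (boundary f)"
    unfolding boundary_def Q_def[symmetric] by (rule someI_ex)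
  then show "boundary f \<in> L2 circle"
    "((\<lambda>r. l2norm circle (\<lambda>\<zeta>. dilate f r \<zeta> - boundary f \<zeta>)) \<longlongrightarrow> 0) (at_left 1)"
    using boundary_limit_iff[OF hol] unfolding Q_def L2_circle_eq by blast+
qed

lemma eventually_dilate:
  assumes "f holomorphic_on unit_disk"
  shows "\<forall>\<^sub>F r in at_left 1. dilate f r \<in> L2 circle"
proof -
  have "\<forall>\<^sub>F r in at_left (1::real). r \<in> {0<..<1}" by (intro eventually_at_left_real) simp
  then show ?thesis by eventually_elim (intro dilate_L2 assms, auto)
qed

text \<open>Pass to the limit \<open>r \<longlongrightarrow> 1\<close> in the Poisson formula for dilates.\<close>

lemma poisson_boundary:
  assumes f: "f \<in> Hardy2" and z: "z \<in> unit_disk"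
  shows "poisson (boundary f) z = f z"
proof -
  have hol: "f holomorphic_on unit_disk" using f by (simp add: Hardy2_def)
  note b = boundary_Hardy2[OF f]
  have ev: "\<forall>\<^sub>F r in at_left (1::real). r \<in> {0<..<1}" by (intro eventually_at_left_real) simp
  have "((\<lambda>r. f (of_real r * z)) \<longlongrightarrow> poisson (boundary f) z) (at_left 1)"
  proof (rule LIM_zero_cancel, rule Lim_null_comparison)
    show "\<forall>\<^sub>F r in at_left 1. norm (f (of_real r * z) - poisson (boundary f) z) \<le>
       3 / (1 - cmod z) * l2norm circle (\<lambda>\<zeta>. dilate f r \<zeta> - boundary f \<zeta>)"
      using ev
    proof eventually_elim
      fix r :: real assume "r \<in> {0<..<1}"
      then have r: "0 \<le> r" "r < 1" by auto
      note sq = dilate_L2[OF hol r]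
      have "poisson (\<lambda>\<zeta>. dilate f r \<zeta> - boundary f \<zeta>) z = f (of_real r * z) - poisson (boundary f) z"
        by (simp only: poisson_diff[OF circle.L2_imp_integrable[OF sq] circle.L2_imp_integrable[OF b(1)]]
            poisson_dilate[OF hol r z])
      then show "norm (f (of_real r * z) - poisson (boundary f) z) \<le>
         3 / (1 - cmod z) * l2norm circle (\<lambda>\<zeta>. dilate f r \<zeta> - boundary f \<zeta>)"
        using poisson_bound[OF L2_diff[OF sq b(1)] z] by simp
    qed
    show "((\<lambda>r. 3 / (1 - cmod z) * l2norm circle (\<lambda>\<zeta>. dilate f r \<zeta> - boundary f \<zeta>)) \<longlongrightarrow> 0) (at_left 1)"
      using tendsto_mult[OF tendsto_const b(2), of "3 / (1 - cmod z)"] by simp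
  qed
  moreover have "((\<lambda>r. f (of_real r * z)) \<longlongrightarrow> f z) (at_left 1)"
  proof (rule isCont_tendsto_compose[of z f])
    show "isCont f z"
      using holomorphic_on_imp_continuous_on[OF hol] z continuous_on_eq_continuous_at[OF open_ball] by blast
    have "((\<lambda>r. complex_of_real r * z) \<longlongrightarrow> complex_of_real 1 * z) (at_left 1)"
      by (intro tendsto_intros)
    then show "((\<lambda>r. complex_of_real r * z) \<longlongrightarrow> z) (at_left 1)" by simp
  qed
  ultimately show ?thesis by (rule tendsto_unique[rotated]) simp
qed

text \<open>The limit of the corresponding formula for dilates. It says that boundary functions of $H^2$ functions are
  orthogonal to conjugates of such functions, up to the constant terms.\<close>

lemma boundary_mult_integral:
  assumes f: "f \<in> Hardy2" and g: "g \<in> Hardy2"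
  shows "(\<integral>\<zeta>. boundary f \<zeta> * boundary g \<zeta> \<partial>circle) = f 0 * g 0"
proof -
  have hol: "f holomorphic_on unit_disk" "g holomorphic_on unit_disk" using f g by (simp_all add: Hardy2_def)
  have "((\<lambda>r. \<integral>\<zeta>. dilate f r \<zeta> * dilate g r \<zeta> \<partial>circle) \<longlongrightarrow> (\<integral>\<zeta>. boundary f \<zeta> * boundary g \<zeta> \<partial>circle)) (at_left 1)"
    by (intro l2_tendsto_mult eventually_dilate hol boundary_Hardy2 f g)
  moreover have "((\<lambda>r. \<integral>\<zeta>. dilate f r \<zeta> * dilate g r \<zeta> \<partial>circle) \<longlongrightarrow> f 0 * g 0) (at_left 1)"
  proof (rule tendsto_eventually)
    have "\<forall>\<^sub>F r in at_left (1::real). r \<in> {0<..<1}" by (intro eventually_at_left_real) simp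
    then show "\<forall>\<^sub>F r in at_left 1. (\<integral>\<zeta>. dilate f r \<zeta> * dilate g r \<zeta> \<partial>circle) = f 0 * g 0"
      by eventually_elim (rule dilate_mult_integral[OF hol], auto)
  qed
  ultimately show ?thesis by (rule tendsto_unique[rotated]) simp
qed

section \<open>The Riesz representation theorem\<close>

locale inner_product_function_space =
  fixes X :: "'a set" and H :: "('a \<Rightarrow> complex) set" and ip :: "('a \<Rightarrow> complex) \<Rightarrow> ('a \<Rightarrow> complex) \<Rightarrow> complex"
  assumes space: "function_space_on X H" and ip: "inner_product_on H ip"
begin

lemma add_closed: "u \<in> H \<Longrightarrow> v \<in> H \<Longrightarrow> (\<lambda>x. u x + v x) \<in> H"
  and scale_closed: "u \<in> H \<Longrightarrow> (\<lambda>x. c * u x) \<in> H"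
  and zero_closed: "(\<lambda>x. 0) \<in> H"
  using space unfolding function_space_on_def by blast+

lemma ip_add: "u \<in> H \<Longrightarrow> v \<in> H \<Longrightarrow> w \<in> H \<Longrightarrow> ip (\<lambda>x. u x + v x) w = ip u w + ip v w"
  and ip_scale: "u \<in> H \<Longrightarrow> w \<in> H \<Longrightarrow> ip (\<lambda>x. c * u x) w = c * ip u w"
  and ip_sym: "u \<in> H \<Longrightarrow> v \<in> H \<Longrightarrow> ip v u = cnj (ip u v)"
  and ip_nonneg: "u \<in> H \<Longrightarrow> 0 \<le> Re (ip u u)"
  using ip unfolding inner_product_on_def by blast+

lemma lincomb_closed:
  assumes "u \<in> H" "v \<in> H" shows "(\<lambda>x. u x + c * v x) \<in> H"
  by (intro add_closed[of u "\<lambda>x. c * v x"] scale_closed assms)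

lemma diff_closed:
  assumes "u \<in> H" "v \<in> H" shows "(\<lambda>x. u x - v x) \<in> H"
  using lincomb_closed[OF assms, of "-1"] by simp

lemma ip_lincomb:
  assumes "u \<in> H" "v \<in> H" "w \<in> H" shows "ip (\<lambda>x. u x + c * v x) w = ip u w + c * ip v w"
  using ip_add[OF assms(1) scale_closed[OF assms(2)] assms(3)] ip_scale[OF assms(2,3)] by simp

lemma ip_lincomb_right:
  assumes "u \<in> H" "v \<in> H" "w \<in> H" shows "ip w (\<lambda>x. u x + c * v x) = ip w u + cnj c * ip w v"
  using ip_lincomb[OF assms] ip_sym[OF lincomb_closed[OF assms(1,2)] assms(3)] ip_sym[OF assms(1,3)] ip_sym[OF assms(2,3)]
  by simp

abbreviation sqn :: "('a \<Rightarrow> complex) \<Rightarrow> real" where "sqn u \<equiv> Re (ip u u)"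

lemma sqn_lincomb:
  assumes "u \<in> H" "v \<in> H"
  shows "sqn (\<lambda>x. u x + complex_of_real t * v x) = sqn u + 2 * t * Re (ip u v) + t\<^sup>2 * sqn v"
proof -
  have "ip (\<lambda>x. u x + complex_of_real t * v x) (\<lambda>x. u x + complex_of_real t * v x) =
    (ip u u + of_real t * ip u v) + of_real t * (ip v u + of_real t * ip v v)"
    using assms by (simp add: ip_lincomb ip_lincomb_right lincomb_closed)
  moreover have "Re (ip v u) = Re (ip u v)" using ip_sym[OF assms] by simp
  ultimately show ?thesis by (simp add: power2_eq_square algebra_simps)
qed

lemma cauchy_schwarz:
  assumes "u \<in> H" "v \<in> H" shows "(Re (ip u v))\<^sup>2 \<le> sqn u * sqn v"
proof (rule discriminant_bound)
  fix t
  have "0 \<le> sqn (\<lambda>x. u x + complex_of_real (- t) * v x)"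
    by (intro ip_nonneg lincomb_closed assms)
  then show "0 \<le> sqn u - 2 * t * Re (ip u v) + t\<^sup>2 * sqn v"
    unfolding sqn_lincomb[OF assms] by simp
qed (rule ip_nonneg[OF assms(2)])

text \<open>A minimizing sequence of \<open>J u = ip u u - 2 * Re (L u)\<close> is Cauchy by the parallelogram law. Its
  limit \<open>w\<close> satisfies the Euler--Lagrange equation \<open>Re (ip w v) = Re (L v)\<close>, and replacing \<open>v\<close> by
  \<open>\<i> * v\<close> gives the imaginary part.\<close>

lemma riesz_representation:
  assumes complete: "complete_on H ip"
    and L_add: "\<And>u v. u \<in> H \<Longrightarrow> v \<in> H \<Longrightarrow> L (\<lambda>x. u x + v x) = L u + L v"
    and L_scale: "\<And>u c. u \<in> H \<Longrightarrow> L (\<lambda>x. c * u x) = c * L u"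
    and L_bound: "\<And>u. u \<in> H \<Longrightarrow> cmod (L u) \<le> C * ip_norm ip u"
  shows "\<exists>w\<in>H. \<forall>u\<in>H. L u = ip u w"
proof -
  define J where "J u = sqn u - 2 * Re (L u)" for u
  have L_lincomb: "L (\<lambda>x. u x + c * v x) = L u + c * L v" if "u \<in> H" "v \<in> H" for u v c
    using L_add[OF that(1) scale_closed[OF that(2)]] L_scale[OF that(2)] by simp
  have J_line: "J (\<lambda>x. u x + complex_of_real t * v x) = J u + 2 * t * (Re (ip u v) - Re (L v)) + t\<^sup>2 * sqn v"
    if "u \<in> H" "v \<in> H" for u v t
    unfolding J_def sqn_lincomb[OF that] L_lincomb[OF that] by (simp add: algebra_simps)
  have J_ge: "- C\<^sup>2 \<le> J u" if "u \<in> H" for u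
  proof -
    have "Re (L u) \<le> C * ip_norm ip u" using L_bound[OF that] complex_Re_le_cmod order_trans by blast
    moreover have "sqn u = (ip_norm ip u)\<^sup>2" using ip_nonneg[OF that] by (simp add: ip_norm_def)
    moreover have "0 \<le> (ip_norm ip u - C)\<^sup>2" by simp
    ultimately show ?thesis by (simp add: J_def power2_diff algebra_simps)
  qed
  define m where "m = (INF u\<in>H. J u)"
  have bdd: "bdd_below (J ` H)" unfolding bdd_below_def using J_ge by blast
  have m_le: "m \<le> J u" if "u \<in> H" for u unfolding m_def by (rule cINF_lower[OF bdd that])
  define \<epsilon> where "\<epsilon> n = 1 / real (Suc n)" for n
  have \<epsilon>: "\<epsilon> n > 0" for n by (simp add: \<epsilon>_def)
  have \<epsilon>_lim: "\<epsilon> \<longlonglongrightarrow> 0" unfolding \<epsilon>_def by (rule LIMSEQ_Suc[OF lim_1_over_n])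
  have "\<exists>u\<in>H. J u < m + \<epsilon> n" for n
  proof -
    have "(INF u\<in>H. J u) < m + \<epsilon> n" using \<epsilon>[of n] by (simp add: m_def)
    then show ?thesis using cINF_less_iff[OF _ bdd] zero_closed by blast
  qed
  then obtain s where s: "\<And>n. s n \<in> H" "\<And>n. J (s n) < m + \<epsilon> n" by metis
  \<comment> \<open>the parallelogram law, with \<open>J\<close> at the midpoint bounded below by \<open>m\<close>\<close>
  have par: "sqn (\<lambda>x. u x - v x) \<le> 2 * (J u - m) + 2 * (J v - m)" if uv: "u \<in> H" "v \<in> H" for u v
  proof -
    have "m \<le> J (\<lambda>x. u x + complex_of_real (1/2) * (v x - u x))"
      by (intro m_le lincomb_closed diff_closed uv)
    also have "\<dots> = J u + (Re (ip u (\<lambda>x. v x - u x)) - Re (L (\<lambda>x. v x - u x))) + sqn (\<lambda>x. v x - u x) / 4"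
      by (subst J_line[OF uv(1) diff_closed[OF uv(2,1)]]) (simp add: power2_eq_square)
    finally have 1: "m \<le> J u + (Re (ip u (\<lambda>x. v x - u x)) - Re (L (\<lambda>x. v x - u x))) + sqn (\<lambda>x. v x - u x) / 4" .
    have 2: "J v = J u + 2 * (Re (ip u (\<lambda>x. v x - u x)) - Re (L (\<lambda>x. v x - u x))) + sqn (\<lambda>x. v x - u x)"
      using J_line[OF uv(1) diff_closed[OF uv(2,1)], of 1] by simp
    have "sqn (\<lambda>x. u x - v x) = sqn (\<lambda>x. v x - u x)"
    proof -
      have z: "ip (\<lambda>x. 0) d = 0" if "d \<in> H" for d using ip_scale[OF that that, of 0] by simp
      have "sqn (\<lambda>x. 0 + complex_of_real (-1) * (v x - u x)) = sqn (\<lambda>x. v x - u x)"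
        unfolding sqn_lincomb[OF zero_closed diff_closed[OF uv(2,1)]]
        by (simp add: z[OF zero_closed] z[OF diff_closed[OF uv(2,1)]])
      then show ?thesis by simp
    qed
    moreover have "q' \<le> 2 * (x - m) + 2 * (y - m)" if "q' = q" "m \<le> x + a + q / 4" "y = x + 2 * a + q" for q q' x y a :: real
      using that by (simp add: field_simps)
    ultimately show ?thesis using 1 2 by blast
  qed
  have "\<exists>w\<in>H. (\<lambda>n. ip_norm ip (\<lambda>x. s n x - w x)) \<longlonglongrightarrow> 0"
  proof (rule complete[unfolded complete_on_def, rule_format], intro conjI allI impI)
    fix e :: real assume e: "e > 0"
    then have "\<forall>\<^sub>F n in sequentially. \<epsilon> n < e\<^sup>2 / 4"
      using order_tendstoD(2)[OF \<epsilon>_lim, of "e\<^sup>2 / 4"] by simp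
    then obtain N where N: "\<And>n. n \<ge> N \<Longrightarrow> \<epsilon> n < e\<^sup>2 / 4" unfolding eventually_sequentially by blast
    have "ip_norm ip (\<lambda>x. s k x - s l x) < e" if "k \<ge> N" "l \<ge> N" for k l
    proof -
      have "sqn (\<lambda>x. s k x - s l x) < e\<^sup>2"
        using par[OF s(1) s(1), of k l] s(2)[of k] s(2)[of l] N[OF that(1)] N[OF that(2)] by argo
      then have "sqrt (sqn (\<lambda>x. s k x - s l x)) < sqrt (e\<^sup>2)" by (rule real_sqrt_less_mono)
      then show ?thesis using e by (simp add: ip_norm_def)
    qed
    then show "\<exists>N. \<forall>k\<ge>N. \<forall>l\<ge>N. ip_norm ip (\<lambda>x. s k x - s l x) < e" by blast
  qed (rule s(1))
  then obtain w where w: "w \<in> H" "(\<lambda>n. ip_norm ip (\<lambda>x. s n x - w x)) \<longlonglongrightarrow> 0" by blast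
  have lim0: "(\<lambda>n. sqn (\<lambda>x. s n x - w x)) \<longlonglongrightarrow> 0"
  proof -
    have "(ip_norm ip (\<lambda>x. s n x - w x))\<^sup>2 = sqn (\<lambda>x. s n x - w x)" for n
      using ip_nonneg[OF diff_closed[OF s(1) w(1)]] by (simp add: ip_norm_def)
    then show ?thesis using tendsto_power[OF w(2), of 2] by simp
  qed
  have sq0: "a \<longlonglongrightarrow> 0" if "\<And>n. (a n)\<^sup>2 \<le> b n * c" "b \<longlonglongrightarrow> 0" for a b :: "nat \<Rightarrow> real" and c
  proof -
    have "(\<lambda>n. b n * c) \<longlonglongrightarrow> 0" using tendsto_mult_right[OF that(2), of c] by simp
    then have "(\<lambda>n. (a n)\<^sup>2) \<longlonglongrightarrow> 0"
      by (rule tendsto_sandwich[OF always_eventually always_eventually tendsto_const, rotated 2]) (use that(1) in auto)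
    then have "(\<lambda>n. sqrt ((a n)\<^sup>2)) \<longlonglongrightarrow> sqrt 0" by (rule tendsto_real_sqrt)
    then show ?thesis by (simp add: tendsto_rabs_zero_iff)
  qed
  have Re_eq: "Re (ip w v) = Re (L v)" if v: "v \<in> H" for v
  proof -
    \<comment> \<open>along the line through \<open>s n\<close> in direction \<open>v\<close>, \<open>J\<close> drops by at most \<open>\<epsilon> n\<close>\<close>
    have "(Re (ip (s n) v) - Re (L v))\<^sup>2 \<le> \<epsilon> n * sqn v" for n
    proof (rule discriminant_bound[OF _ ip_nonneg[OF v]])
      fix t
      have "m \<le> J (\<lambda>x. s n x + complex_of_real (- t) * v x)" by (intro m_le lincomb_closed s(1) v)
      then show "0 \<le> \<epsilon> n - 2 * t * (Re (ip (s n) v) - Re (L v)) + t\<^sup>2 * sqn v"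
        unfolding J_line[OF s(1) v] using s(2)[of n] by simp
    qed
    then have "(\<lambda>n. Re (ip (s n) v) - Re (L v)) \<longlonglongrightarrow> 0" by (rule sq0[OF _ \<epsilon>_lim])
    moreover have "(\<lambda>n. Re (ip (\<lambda>x. s n x - w x) v)) \<longlonglongrightarrow> 0"
      by (rule sq0[OF cauchy_schwarz[OF diff_closed[OF s(1) w(1)] v] lim0])
    ultimately have "(\<lambda>n. (Re (ip (s n) v) - Re (L v)) - Re (ip (\<lambda>x. s n x - w x) v)) \<longlonglongrightarrow> 0 - 0"
      by (rule tendsto_diff)
    moreover have "(Re (ip (s n) v) - Re (L v)) - Re (ip (\<lambda>x. s n x - w x) v) = Re (ip w v) - Re (L v)" for n
      using ip_lincomb[OF s(1) w(1) v, of n "-1"] by simp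
    ultimately show ?thesis by (simp add: LIMSEQ_const_iff)
  qed
  have "L v = ip v w" if v: "v \<in> H" for v
  proof (rule complex_eqI)
    have sym: "ip v w = cnj (ip w v)" by (rule ip_sym[OF w(1) v])
    show "Re (L v) = Re (ip v w)" using Re_eq[OF v] sym by simp
    have "Re (ip w (\<lambda>x. \<i> * v x)) = Re (\<i> * L v)"
      using Re_eq[OF scale_closed[OF v], of \<i>] L_scale[OF v, of \<i>] by simp
    moreover have "ip w (\<lambda>x. \<i> * v x) = cnj (\<i> * ip v w)"
      using ip_sym[OF scale_closed[OF v] w(1), of \<i>] ip_scale[OF v w(1), of \<i>] by simp
    ultimately show "Im (L v) = Im (ip v w)" by simp
  qed
  with w(1) show ?thesis by blast
qed

end

section \<open>The harmonic weighted Dirichlet space\<close>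

lemma space_area [simp]: "space area = unit_disk"
  by (simp add: area_def space_restrict_space)

lemma borel_measurable_area:
  fixes u :: "complex \<Rightarrow> complex"
  assumes "continuous_on unit_disk u" shows "u \<in> borel_measurable area"
proof -
  have "u \<in> borel_measurable (lebesgue_on unit_disk)"
    by (rule continuous_imp_measurable_on_sets_lebesgue[OF assms]) (simp add: lmeasurable_ball fmeasurableD)
  then show ?thesis by (simp add: area_def)
qed

text \<open>Multiplication by the square root of the weight turns weighted energy integrals into inner products in
  the unweighted $L^2$ space of the disk, to which the general lemmas apply.\<close>

definition weighted :: "(complex \<Rightarrow> real) \<Rightarrow> (complex \<Rightarrow> complex) \<Rightarrow> complex \<Rightarrow> complex" where
  "weighted \<omega> u z = complex_of_real (sqrt (\<omega> z)) * u z"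

lemma weight_measurable: "weight \<omega> \<Longrightarrow> \<omega> \<in> borel_measurable area"
  and weight_nonneg: "weight \<omega> \<Longrightarrow> z \<in> unit_disk \<Longrightarrow> 0 \<le> \<omega> z"
  by (simp_all add: weight_def)

lemma weighted_measurable:
  assumes "weight \<omega>" "continuous_on unit_disk u"
  shows "weighted \<omega> u \<in> borel_measurable area"
proof -
  have [measurable]: "\<omega> \<in> borel_measurable area" "u \<in> borel_measurable area"
    by (rule weight_measurable[OF assms(1)], rule borel_measurable_area[OF assms(2)])
  show ?thesis unfolding weighted_def[abs_def] by measurable
qed

lemma weighted_cmod2:
  assumes "weight \<omega>" "z \<in> unit_disk" shows "(cmod (weighted \<omega> u z))\<^sup>2 = (cmod (u z))\<^sup>2 * \<omega> z"
  using weight_nonneg[OF assms] by (simp add: weighted_def norm_mult power_mult_distrib)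

lemma weighted_mult:
  assumes "weight \<omega>" "z \<in> unit_disk"
  shows "weighted \<omega> u z * cnj (weighted \<omega> v z) = u z * cnj (v z) * complex_of_real (\<omega> z)"
proof -
  have "complex_of_real (sqrt (\<omega> z)) * complex_of_real (sqrt (\<omega> z)) = complex_of_real (\<omega> z)"
    using weight_nonneg[OF assms] by (simp flip: of_real_mult)
  moreover have "(s * a) * (s * b) = a * b * (s * s)" for s a b :: complex by (simp add: algebra_simps)
  ultimately show ?thesis
    by (simp only: weighted_def complex_cnj_mult complex_cnj_complex_of_real)
qed

lemma weighted_L2_iff:
  assumes w: "weight \<omega>" and u: "continuous_on unit_disk u"
  shows "weighted \<omega> u \<in> L2 area \<longleftrightarrow> (\<integral>\<^sup>+z. ennreal ((cmod (u z))\<^sup>2 * \<omega> z) \<partial>area) < \<infinity>"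
proof -
  have "(\<integral>\<^sup>+z. ennreal ((cmod (weighted \<omega> u z))\<^sup>2) \<partial>area) = (\<integral>\<^sup>+z. ennreal ((cmod (u z))\<^sup>2 * \<omega> z) \<partial>area)"
    by (rule nn_integral_cong) (simp only: space_area weighted_cmod2[OF w])
  then show ?thesis using weighted_measurable[OF assms] by (simp add: L2_iff_nn)
qed

lemma L2_cong:
  assumes "\<And>x. x \<in> space M \<Longrightarrow> u x = v x" shows "u \<in> L2 M \<longleftrightarrow> v \<in> L2 M"
proof -
  have "u \<in> borel_measurable M \<longleftrightarrow> v \<in> borel_measurable M" by (rule measurable_cong[OF assms])
  moreover have "integrable M (\<lambda>x. (cmod (u x))\<^sup>2) \<longleftrightarrow> integrable M (\<lambda>x. (cmod (v x))\<^sup>2)"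
    by (intro Bochner_Integration.integrable_cong refl) (simp only: assms)
  ultimately show ?thesis by (simp add: L2_def)
qed

lemma l2norm_cong:
  assumes "\<And>x. x \<in> space M \<Longrightarrow> u x = v x" shows "l2norm M u = l2norm M v"
  unfolding l2norm_def by (intro arg_cong[where f = sqrt] Bochner_Integration.integral_cong refl) (simp only: assms)

lemma wirtinger_poisson:
  assumes f: "integrable circle f" and z: "z \<in> unit_disk"
  shows "dz (poisson f) z = deriv (szego f) z" "dzbar (poisson f) z = cnj (deriv (antiszego f) z)"
proof -
  have "\<forall>z\<in>unit_disk. poisson f z = szego f z + cnj (antiszego f z)"
    using poisson_eq_szego[OF f] by blast
  from wirtinger_holomorphic_plus_cnj[OF szego_holomorphic[OF f] antiszego_holomorphic[OF f] this z]
  show "dz (poisson f) z = deriv (szego f) z" "dzbar (poisson f) z = cnj (deriv (antiszego f) z)" .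
qed

lemma deriv_lincomb:
  assumes f: "f holomorphic_on unit_disk" and g: "g holomorphic_on unit_disk" and z: "z \<in> unit_disk"
  shows "deriv (\<lambda>z. a * f z + b * g z) z = a * deriv f z + b * deriv g z"
  by (rule DERIV_imp_deriv) (intro DERIV_add DERIV_cmult holomorphic_derivI[OF f open_ball z] holomorphic_derivI[OF g open_ball z])

lemma holomorphic_lincomb:
  assumes f: "f holomorphic_on unit_disk" and g: "g holomorphic_on unit_disk"
  shows "(\<lambda>z. a * f z + b * g z) holomorphic_on unit_disk"
  by (intro holomorphic_on_add holomorphic_on_mult holomorphic_on_const f g)

lemma poisson_lincomb:
  assumes f: "integrable circle f" and g: "integrable circle g"
  shows "poisson (\<lambda>\<zeta>. a * f \<zeta> + b * g \<zeta>) = (\<lambda>z. a * poisson f z + b * poisson g z)"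
  using poisson_add[of "\<lambda>\<zeta>. a * f \<zeta>" "\<lambda>\<zeta>. b * g \<zeta>"] f g by (simp add: poisson_cmult)

lemma wirtinger_poisson_lincomb:
  assumes f: "integrable circle f" and g: "integrable circle g" and z: "z \<in> unit_disk"
  shows "dz (poisson (\<lambda>\<zeta>. a * f \<zeta> + b * g \<zeta>)) z = a * dz (poisson f) z + b * dz (poisson g) z"
    and "dzbar (poisson (\<lambda>\<zeta>. a * f \<zeta> + b * g \<zeta>)) z = a * dzbar (poisson f) z + b * dzbar (poisson g) z"
proof -
  note hol = szego_holomorphic[OF f] szego_holomorphic[OF g] antiszego_holomorphic[OF f] antiszego_holomorphic[OF g]
  have "\<forall>z\<in>unit_disk. poisson (\<lambda>\<zeta>. a * f \<zeta> + b * g \<zeta>) z =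
     (a * szego f z + b * szego g z) + cnj (cnj a * antiszego f z + cnj b * antiszego g z)"
    unfolding poisson_lincomb[OF f g] using poisson_eq_szego[OF f] poisson_eq_szego[OF g]
    by (simp add: algebra_simps)
  note W = wirtinger_holomorphic_plus_cnj[OF holomorphic_lincomb[OF hol(1,2)] holomorphic_lincomb[OF hol(3,4)] this z]
  show "dz (poisson (\<lambda>\<zeta>. a * f \<zeta> + b * g \<zeta>)) z = a * dz (poisson f) z + b * dz (poisson g) z"
    unfolding W(1) deriv_lincomb[OF hol(1,2) z] wirtinger_poisson[OF f z] wirtinger_poisson[OF g z] ..
  show "dzbar (poisson (\<lambda>\<zeta>. a * f \<zeta> + b * g \<zeta>)) z = a * dzbar (poisson f) z + b * dzbar (poisson g) z"
    unfolding W(2) deriv_lincomb[OF hol(3,4) z] wirtinger_poisson[OF f z] wirtinger_poisson[OF g z] by simp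
qed

lemma wirtinger_poisson_bound:
  assumes f: "f \<in> L2 circle" and z: "z \<in> unit_disk"
  shows "cmod (dz (poisson f) z) \<le> l2norm circle f / ((1 - cmod z) / 2)\<^sup>2"
    "cmod (dzbar (poisson f) z) \<le> l2norm circle f / ((1 - cmod z) / 2)\<^sup>2"
proof -
  have fi: "integrable circle f" by (rule circle.L2_imp_integrable[OF f])
  show "cmod (dz (poisson f) z) \<le> l2norm circle f / ((1 - cmod z) / 2)\<^sup>2"
    unfolding wirtinger_poisson[OF fi z] by (rule deriv_szego_bound[OF f z])
  have cfi: "integrable circle (\<lambda>\<zeta>. cnj (f \<zeta>))" using fi by simp
  have "deriv (antiszego f) z = deriv (szego (\<lambda>\<zeta>. cnj (f \<zeta>))) z"
  proof (rule DERIV_imp_deriv)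
    have "((\<lambda>z. szego (\<lambda>\<zeta>. cnj (f \<zeta>)) z - szego (\<lambda>\<zeta>. cnj (f \<zeta>)) 0) has_field_derivative
      deriv (szego (\<lambda>\<zeta>. cnj (f \<zeta>))) z - 0) (at z)"
      by (intro DERIV_diff DERIV_const holomorphic_derivI[OF szego_holomorphic[OF cfi] open_ball z])
    then show "(antiszego f has_field_derivative deriv (szego (\<lambda>\<zeta>. cnj (f \<zeta>))) z) (at z)"
      unfolding antiszego_def[abs_def] by simp
  qed
  then show "cmod (dzbar (poisson f) z) \<le> l2norm circle f / ((1 - cmod z) / 2)\<^sup>2"
    unfolding wirtinger_poisson[OF fi z] using deriv_szego_bound[OF L2_cnj[OF f] z] by simp
qed

lemma wirtinger_poisson_continuous:
  assumes f: "integrable circle f"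
  shows "continuous_on unit_disk (dz (poisson f))" "continuous_on unit_disk (dzbar (poisson f))"
proof -
  have c: "continuous_on unit_disk (deriv h)" if "h holomorphic_on unit_disk" for h
    by (rule holomorphic_on_imp_continuous_on[OF holomorphic_deriv[OF that open_ball]])
  show "continuous_on unit_disk (dz (poisson f))"
    by (subst continuous_on_cong[OF refl wirtinger_poisson(1)[OF f]]) (auto intro: c szego_holomorphic f)
  have "continuous_on unit_disk (\<lambda>z. cnj (deriv (antiszego f) z))"
    by (intro continuous_on_cnj c antiszego_holomorphic f)
  then show "continuous_on unit_disk (dzbar (poisson f))"
    by (subst continuous_on_cong[OF refl wirtinger_poisson(2)[OF f]])
qed

definition wdz :: "(complex \<Rightarrow> real) \<Rightarrow> (complex \<Rightarrow> complex) \<Rightarrow> complex \<Rightarrow> complex" where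
  "wdz \<omega> f = weighted \<omega> (dz (poisson f))"

definition wdzbar :: "(complex \<Rightarrow> real) \<Rightarrow> (complex \<Rightarrow> complex) \<Rightarrow> complex \<Rightarrow> complex" where
  "wdzbar \<omega> f = weighted \<omega> (dzbar (poisson f))"

lemma wdz_measurable:
  assumes "weight \<omega>" "integrable circle f"
  shows "wdz \<omega> f \<in> borel_measurable area" "wdzbar \<omega> f \<in> borel_measurable area"
  unfolding wdz_def wdzbar_def by (intro weighted_measurable wirtinger_poisson_continuous assms)+

lemma Dh_iff:
  assumes w: "weight \<omega>"
  shows "f \<in> Dh \<omega> \<longleftrightarrow> f \<in> L2 circle \<and> wdz \<omega> f \<in> L2 area \<and> wdzbar \<omega> f \<in> L2 area"
proof (cases "f \<in> L2 circle")
  case True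
  then have fi: "integrable circle f" by (rule circle.L2_imp_integrable)
  note c = wirtinger_poisson_continuous[OF fi]
  have [measurable]: "dz (poisson f) \<in> borel_measurable area" "dzbar (poisson f) \<in> borel_measurable area"
    "\<omega> \<in> borel_measurable area"
    by (rule borel_measurable_area[OF c(1)], rule borel_measurable_area[OF c(2)], rule weight_measurable[OF w])
  have "(\<integral>\<^sup>+ z. ennreal (((cmod (dz (poisson f) z))\<^sup>2 + (cmod (dzbar (poisson f) z))\<^sup>2) * \<omega> z) \<partial>area) =
     (\<integral>\<^sup>+ z. ennreal ((cmod (dz (poisson f) z))\<^sup>2 * \<omega> z) + ennreal ((cmod (dzbar (poisson f) z))\<^sup>2 * \<omega> z) \<partial>area)"
  proof (rule nn_integral_cong)
    fix z assume "z \<in> space area"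
    then have "0 \<le> \<omega> z" using weight_nonneg[OF w] by simp
    then show "ennreal (((cmod (dz (poisson f) z))\<^sup>2 + (cmod (dzbar (poisson f) z))\<^sup>2) * \<omega> z) =
      ennreal ((cmod (dz (poisson f) z))\<^sup>2 * \<omega> z) + ennreal ((cmod (dzbar (poisson f) z))\<^sup>2 * \<omega> z)"
      by (simp add: distrib_right ennreal_plus)
  qed
  also have "\<dots> = (\<integral>\<^sup>+ z. ennreal ((cmod (dz (poisson f) z))\<^sup>2 * \<omega> z) \<partial>area) + (\<integral>\<^sup>+ z. ennreal ((cmod (dzbar (poisson f) z))\<^sup>2 * \<omega> z) \<partial>area)"
    by (intro nn_integral_add) measurable
  finally show ?thesis
    using True by (simp add: Dh_def L2_circle_eq wdz_def wdzbar_def weighted_L2_iff[OF w c(1)] weighted_L2_iff[OF w c(2)] ennreal_add_eq_top less_top)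
qed (simp add: Dh_def L2_circle_eq)

lemma Dh_ip_eq:
  assumes w: "weight \<omega>" and f: "f \<in> Dh \<omega>" and g: "g \<in> Dh \<omega>"
  shows "Dh_ip \<omega> f g = (\<integral>\<zeta>. f \<zeta> * cnj (g \<zeta>) \<partial>circle) + (\<integral>z. wdz \<omega> f z * cnj (wdz \<omega> g z) \<partial>area)
     + (\<integral>z. wdzbar \<omega> f z * cnj (wdzbar \<omega> g z) \<partial>area)"
proof -
  have "energy \<omega> f g = (\<integral>z. wdz \<omega> f z * cnj (wdz \<omega> g z) + wdzbar \<omega> f z * cnj (wdzbar \<omega> g z) \<partial>area)"
    unfolding energy_def wdz_def wdzbar_def
    by (intro Bochner_Integration.integral_cong refl) (simp only: space_area weighted_mult[OF w] distrib_right)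
  also have "\<dots> = (\<integral>z. wdz \<omega> f z * cnj (wdz \<omega> g z) \<partial>area) + (\<integral>z. wdzbar \<omega> f z * cnj (wdzbar \<omega> g z) \<partial>area)"
    using f g by (intro Bochner_Integration.integral_add integrable_ip) (simp_all add: Dh_iff[OF w])
  finally show ?thesis by (simp add: Dh_ip_def L2_ip_def)
qed

lemma wdz_lincomb:
  assumes "integrable circle f" "integrable circle g" "z \<in> space area"
  shows "wdz \<omega> (\<lambda>\<zeta>. a * f \<zeta> + b * g \<zeta>) z = a * wdz \<omega> f z + b * wdz \<omega> g z"
    and "wdzbar \<omega> (\<lambda>\<zeta>. a * f \<zeta> + b * g \<zeta>) z = a * wdzbar \<omega> f z + b * wdzbar \<omega> g z"
proof -
  have z: "z \<in> unit_disk" using assms(3) by simp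
  show "wdz \<omega> (\<lambda>\<zeta>. a * f \<zeta> + b * g \<zeta>) z = a * wdz \<omega> f z + b * wdz \<omega> g z"
    unfolding wdz_def weighted_def wirtinger_poisson_lincomb(1)[OF assms(1,2) z]
    by (simp only: distrib_left mult.left_commute)
  show "wdzbar \<omega> (\<lambda>\<zeta>. a * f \<zeta> + b * g \<zeta>) z = a * wdzbar \<omega> f z + b * wdzbar \<omega> g z"
    unfolding wdzbar_def weighted_def wirtinger_poisson_lincomb(2)[OF assms(1,2) z]
    by (simp only: distrib_left mult.left_commute)
qed

lemma L2_lincomb:
  assumes "f \<in> L2 M" "g \<in> L2 M"
  shows "(\<lambda>x. a * f x + b * g x) \<in> L2 M"
  by (intro L2_add L2_cmult assms)

lemma Dh_integrable:
  assumes "f \<in> Dh \<omega>" shows "integrable circle f"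
  by (rule circle.L2_imp_integrable) (use assms in \<open>simp add: Dh_def L2_circle_eq\<close>)

lemma Dh_lincomb:
  assumes w: "weight \<omega>" and f: "f \<in> Dh \<omega>" and g: "g \<in> Dh \<omega>"
  shows "(\<lambda>\<zeta>. a * f \<zeta> + b * g \<zeta>) \<in> Dh \<omega>"
proof -
  note D = Dh_iff[OF w, THEN iffD1]
  note i = Dh_integrable[OF f] Dh_integrable[OF g]
  have F: "f \<in> L2 circle" "wdz \<omega> f \<in> L2 area" "wdzbar \<omega> f \<in> L2 area"
    and G: "g \<in> L2 circle" "wdz \<omega> g \<in> L2 area" "wdzbar \<omega> g \<in> L2 area"
    using D[OF f] D[OF g] by blast+
  have "wdz \<omega> (\<lambda>\<zeta>. a * f \<zeta> + b * g \<zeta>) \<in> L2 area"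
    using L2_lincomb[OF F(2) G(2), of a b] by (simp only: L2_cong[OF wdz_lincomb(1)[OF i]])
  moreover have "wdzbar \<omega> (\<lambda>\<zeta>. a * f \<zeta> + b * g \<zeta>) \<in> L2 area"
    using L2_lincomb[OF F(3) G(3), of a b] by (simp only: L2_cong[OF wdz_lincomb(2)[OF i]])
  ultimately show ?thesis using L2_lincomb[OF F(1) G(1)] unfolding Dh_iff[OF w] by blast
qed

lemma ip_integral_lincomb:
  assumes "f \<in> L2 M" "g \<in> L2 M" "h \<in> L2 M"
    and "\<And>x. x \<in> space M \<Longrightarrow> u x = a * f x + b * g x"
  shows "(\<integral>x. u x * cnj (h x) \<partial>M) = a * (\<integral>x. f x * cnj (h x) \<partial>M) + b * (\<integral>x. g x * cnj (h x) \<partial>M)"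
proof -
  have "(\<integral>x. u x * cnj (h x) \<partial>M) = (\<integral>x. a * (f x * cnj (h x)) + b * (g x * cnj (h x)) \<partial>M)"
    by (intro Bochner_Integration.integral_cong refl) (simp add: assms(4) algebra_simps)
  also have "\<dots> = a * (\<integral>x. f x * cnj (h x) \<partial>M) + b * (\<integral>x. g x * cnj (h x) \<partial>M)"
    using integrable_ip[OF assms(1,3)] integrable_ip[OF assms(2,3)] by simp
  finally show ?thesis .
qed

lemma Dh_ip_lincomb:
  assumes w: "weight \<omega>" and f: "f \<in> Dh \<omega>" and g: "g \<in> Dh \<omega>" and h: "h \<in> Dh \<omega>"
  shows "Dh_ip \<omega> (\<lambda>\<zeta>. a * f \<zeta> + b * g \<zeta>) h = a * Dh_ip \<omega> f h + b * Dh_ip \<omega> g h"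
proof -
  note D = Dh_iff[OF w, THEN iffD1]
  note i = Dh_integrable[OF f] Dh_integrable[OF g]
  have 1: "(\<integral>\<zeta>. (a * f \<zeta> + b * g \<zeta>) * cnj (h \<zeta>) \<partial>circle) = a * (\<integral>\<zeta>. f \<zeta> * cnj (h \<zeta>) \<partial>circle) + b * (\<integral>\<zeta>. g \<zeta> * cnj (h \<zeta>) \<partial>circle)"
    by (rule ip_integral_lincomb) (use D[OF f] D[OF g] D[OF h] in auto)
  have 2: "(\<integral>z. wdz \<omega> (\<lambda>\<zeta>. a * f \<zeta> + b * g \<zeta>) z * cnj (wdz \<omega> h z) \<partial>area) =
     a * (\<integral>z. wdz \<omega> f z * cnj (wdz \<omega> h z) \<partial>area) + b * (\<integral>z. wdz \<omega> g z * cnj (wdz \<omega> h z) \<partial>area)"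
    by (rule ip_integral_lincomb[OF _ _ _ wdz_lincomb(1)[OF i]]) (use D[OF f] D[OF g] D[OF h] in auto)
  have 3: "(\<integral>z. wdzbar \<omega> (\<lambda>\<zeta>. a * f \<zeta> + b * g \<zeta>) z * cnj (wdzbar \<omega> h z) \<partial>area) =
     a * (\<integral>z. wdzbar \<omega> f z * cnj (wdzbar \<omega> h z) \<partial>area) + b * (\<integral>z. wdzbar \<omega> g z * cnj (wdzbar \<omega> h z) \<partial>area)"
    by (rule ip_integral_lincomb[OF _ _ _ wdz_lincomb(2)[OF i]]) (use D[OF f] D[OF g] D[OF h] in auto)
  show ?thesis
    unfolding Dh_ip_eq[OF w Dh_lincomb[OF w f g] h] Dh_ip_eq[OF w f h] Dh_ip_eq[OF w g h] 1 2 3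
    by (simp add: algebra_simps)
qed

lemma integral_ip_cnj: "(\<integral>x. g x * cnj (f x) \<partial>M) = cnj (\<integral>x. f x * cnj (g x) \<partial>M)"
proof -
  have "(\<integral>x. g x * cnj (f x) \<partial>M) = (\<integral>x. cnj (f x * cnj (g x)) \<partial>M)" by (simp add: mult.commute)
  then show ?thesis by (simp only: Bochner_Integration.integral_cnj)
qed

lemma Dh_ip_cnj:
  assumes w: "weight \<omega>" and f: "f \<in> Dh \<omega>" and g: "g \<in> Dh \<omega>"
  shows "Dh_ip \<omega> g f = cnj (Dh_ip \<omega> f g)"
  unfolding Dh_ip_eq[OF w f g] Dh_ip_eq[OF w g f]
  by (simp only: complex_cnj_add integral_ip_cnj[of _ g f] integral_ip_cnj[of _ "wdz \<omega> g" "wdz \<omega> f"] integral_ip_cnj[of _ "wdzbar \<omega> g" "wdzbar \<omega> f"])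

lemma integral_ip_self:
  "(\<integral>x. f x * cnj (f x) \<partial>M) = complex_of_real ((l2norm M f)\<^sup>2)"
  unfolding l2norm_power2 by (simp only: complex_norm_square[symmetric] integral_complex_of_real)

lemma Dh_ip_self:
  assumes w: "weight \<omega>" and f: "f \<in> Dh \<omega>"
  shows "Dh_ip \<omega> f f = complex_of_real ((l2norm circle f)\<^sup>2 + (l2norm area (wdz \<omega> f))\<^sup>2 + (l2norm area (wdzbar \<omega> f))\<^sup>2)"
  unfolding Dh_ip_eq[OF w f f] using f by (simp add: integral_ip_self Dh_iff[OF w])

lemma Dh_ip_cong_poisson:
  assumes w: "weight \<omega>" and f: "f \<in> Dh \<omega>" "f' \<in> Dh \<omega>" "poisson f = poisson f'"
    and g: "g \<in> Dh \<omega>" "g' \<in> Dh \<omega>" "poisson g = poisson g'"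
  shows "Dh_ip \<omega> f g = Dh_ip \<omega> f' g'"
proof -
  have ae: "AE \<zeta> in circle. f \<zeta> = f' \<zeta>" "AE \<zeta> in circle. g \<zeta> = g' \<zeta>"
    using f g poisson_eq_iff Dh_integrable by blast+
  have m: "f \<in> borel_measurable circle" "f' \<in> borel_measurable circle" "g \<in> borel_measurable circle" "g' \<in> borel_measurable circle"
    using f g Dh_integrable by auto
  have "L2_ip f g = L2_ip f' g'"
    unfolding L2_ip_def
    by (rule integral_cong_AE)
       (intro borel_measurable_times borel_measurable_cnj m, intro borel_measurable_times borel_measurable_cnj m,
        use ae in \<open>eventually_elim, simp\<close>)
  then show ?thesis using f(3) g(3) by (simp add: Dh_ip_def energy_def)
qed

lemma Dh_disk_ip_poisson:
  assumes w: "weight \<omega>" and f: "f \<in> Dh \<omega>" and g: "g \<in> Dh \<omega>"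
  shows "Dh_disk_ip \<omega> (poisson f) (poisson g) = Dh_ip \<omega> f g"
  unfolding Dh_disk_ip_def
proof -
  have inv: "inv_into (Dh \<omega>) poisson (poisson h) \<in> Dh \<omega>" "poisson (inv_into (Dh \<omega>) poisson (poisson h)) = poisson h"
    if "h \<in> Dh \<omega>" for h
    using inv_into_into[OF imageI[OF that]] f_inv_into_f[OF imageI[OF that]] by blast+
  show "Dh_ip \<omega> (inv_into (Dh \<omega>) poisson (poisson f)) (inv_into (Dh \<omega>) poisson (poisson g)) = Dh_ip \<omega> f g"
    by (rule Dh_ip_cong_poisson[OF w inv(1)[OF f] f inv(2)[OF f] inv(1)[OF g] g inv(2)[OF g]])
qed

lemma Dh_L2:
  assumes "f \<in> Dh \<omega>" shows "f \<in> L2 circle"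
  using assms by (simp add: Dh_def L2_circle_eq)

lemma Dh_add: "weight \<omega> \<Longrightarrow> f \<in> Dh \<omega> \<Longrightarrow> g \<in> Dh \<omega> \<Longrightarrow> (\<lambda>\<zeta>. f \<zeta> + g \<zeta>) \<in> Dh \<omega>"
  and Dh_diff: "weight \<omega> \<Longrightarrow> f \<in> Dh \<omega> \<Longrightarrow> g \<in> Dh \<omega> \<Longrightarrow> (\<lambda>\<zeta>. f \<zeta> - g \<zeta>) \<in> Dh \<omega>"
  and Dh_scale: "weight \<omega> \<Longrightarrow> f \<in> Dh \<omega> \<Longrightarrow> (\<lambda>\<zeta>. c * f \<zeta>) \<in> Dh \<omega>"
  using Dh_lincomb[of \<omega> f g 1 1] Dh_lincomb[of \<omega> f g 1 "-1"] Dh_lincomb[of \<omega> f f c 0] by simp_all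

lemma zero_in_Dh:
  assumes w: "weight \<omega>" shows "(\<lambda>\<zeta>. 0) \<in> Dh \<omega>"
proof -
  have p: "poisson (\<lambda>\<zeta>. 0) = (\<lambda>z. 0)" using poisson_cmult[of 0 "\<lambda>\<zeta>. 0"] by simp
  have "dz (\<lambda>z. 0) z = 0" "dzbar (\<lambda>z. 0) z = 0" for z
    by (simp_all add: dz_def dzbar_def partial_x_def partial_y_def)
  then have "wdz \<omega> (\<lambda>\<zeta>. 0) = (\<lambda>z. 0)" "wdzbar \<omega> (\<lambda>\<zeta>. 0) = (\<lambda>z. 0)"
    by (simp_all add: wdz_def wdzbar_def weighted_def p fun_eq_iff)
  then show ?thesis unfolding Dh_iff[OF w] by (simp add: L2_def)
qed

lemma Dh_ip_self_Re:
  assumes "weight \<omega>" "f \<in> Dh \<omega>"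
  shows "Re (Dh_ip \<omega> f f) = (l2norm circle f)\<^sup>2 + (l2norm area (wdz \<omega> f))\<^sup>2 + (l2norm area (wdzbar \<omega> f))\<^sup>2"
  unfolding Dh_ip_self[OF assms] by (simp only: Re_complex_of_real)

lemma ip_norm_Dh_disk:
  assumes w: "weight \<omega>" and f: "f \<in> Dh \<omega>"
  shows "ip_norm (Dh_disk_ip \<omega>) (poisson f) =
    sqrt ((l2norm circle f)\<^sup>2 + (l2norm area (wdz \<omega> f))\<^sup>2 + (l2norm area (wdzbar \<omega> f))\<^sup>2)"
  unfolding ip_norm_def Dh_disk_ip_poisson[OF w f f] Dh_ip_self_Re[OF w f] ..

lemma component_le_ip_norm:
  assumes w: "weight \<omega>" and f: "f \<in> Dh \<omega>"
  shows "l2norm circle f \<le> ip_norm (Dh_disk_ip \<omega>) (poisson f)"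
    "l2norm area (wdz \<omega> f) \<le> ip_norm (Dh_disk_ip \<omega>) (poisson f)"
    "l2norm area (wdzbar \<omega> f) \<le> ip_norm (Dh_disk_ip \<omega>) (poisson f)"
  unfolding ip_norm_Dh_disk[OF w f] by (rule real_le_rsqrt; simp)+

lemma Dh_disk_function_space:
  assumes w: "weight \<omega>" shows "function_space_on unit_disk (Dh_disk \<omega>)"
  unfolding function_space_on_def
proof (intro conjI ballI allI impI)
  fix u x assume "u \<in> Dh_disk \<omega>" "x \<notin> unit_disk"
  then show "u x = 0" by (auto simp: Dh_disk_def poisson_def)
next
  have "poisson (\<lambda>\<zeta>. 0) = (\<lambda>z. 0)" using poisson_cmult[of 0 "\<lambda>\<zeta>. 0"] by simp
  then show "(\<lambda>x. 0) \<in> Dh_disk \<omega>" using zero_in_Dh[OF w] unfolding Dh_disk_def by force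
next
  fix u v assume "u \<in> Dh_disk \<omega>" "v \<in> Dh_disk \<omega>"
  then obtain f g where f: "f \<in> Dh \<omega>" "u = poisson f" and g: "g \<in> Dh \<omega>" "v = poisson g"
    unfolding Dh_disk_def by blast
  have "(\<lambda>x. u x + v x) = poisson (\<lambda>\<zeta>. f \<zeta> + g \<zeta>)"
    unfolding f(2) g(2) by (rule poisson_add[OF Dh_integrable[OF f(1)] Dh_integrable[OF g(1)], symmetric])
  then show "(\<lambda>x. u x + v x) \<in> Dh_disk \<omega>"
    unfolding Dh_disk_def using Dh_add[OF w f(1) g(1)] by blast
next
  fix c u assume "u \<in> Dh_disk \<omega>"
  then obtain f where f: "f \<in> Dh \<omega>" "u = poisson f" unfolding Dh_disk_def by blast
  have "(\<lambda>x. c * u x) = poisson (\<lambda>\<zeta>. c * f \<zeta>)" unfolding f(2) by (rule poisson_cmult[symmetric])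
  then show "(\<lambda>x. c * u x) \<in> Dh_disk \<omega>"
    unfolding Dh_disk_def using Dh_scale[OF w f(1)] by blast
qed

lemma Dh_disk_inner_product:
  assumes w: "weight \<omega>" shows "inner_product_on (Dh_disk \<omega>) (Dh_disk_ip \<omega>)"
  unfolding inner_product_on_def Dh_disk_def
proof (intro conjI ballI allI impI; (elim imageE)?)
  fix u v x f g h assume u: "u = poisson f" "f \<in> Dh \<omega>" and v: "v = poisson g" "g \<in> Dh \<omega>" and x: "x = poisson h" "h \<in> Dh \<omega>"
  have "(\<lambda>z. u z + v z) = poisson (\<lambda>\<zeta>. f \<zeta> + g \<zeta>)"
    unfolding u(1) v(1) by (rule poisson_add[OF Dh_integrable[OF u(2)] Dh_integrable[OF v(2)], symmetric])
  then show "Dh_disk_ip \<omega> (\<lambda>z. u z + v z) x = Dh_disk_ip \<omega> u x + Dh_disk_ip \<omega> v x"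
    using Dh_ip_lincomb[OF w u(2) v(2) x(2), of 1 1]
    by (simp add: u(1) v(1) x(1) Dh_disk_ip_poisson[OF w] u(2) v(2) x(2) Dh_add[OF w])
next
  fix c u x f h assume u: "u = poisson f" "f \<in> Dh \<omega>" and x: "x = poisson h" "h \<in> Dh \<omega>"
  have "(\<lambda>z. c * u z) = poisson (\<lambda>\<zeta>. c * f \<zeta>)" unfolding u(1) by (rule poisson_cmult[symmetric])
  then show "Dh_disk_ip \<omega> (\<lambda>z. c * u z) x = c * Dh_disk_ip \<omega> u x"
    using Dh_ip_lincomb[OF w u(2) u(2) x(2), of c 0]
    by (simp add: u(1) x(1) Dh_disk_ip_poisson[OF w] u(2) x(2) Dh_scale[OF w])
next
  fix u v f g assume u: "u = poisson f" "f \<in> Dh \<omega>" and v: "v = poisson g" "g \<in> Dh \<omega>"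
  show "Dh_disk_ip \<omega> v u = cnj (Dh_disk_ip \<omega> u v)"
    unfolding u(1) v(1) Dh_disk_ip_poisson[OF w u(2) v(2)] Dh_disk_ip_poisson[OF w v(2) u(2)]
    by (rule Dh_ip_cnj[OF w u(2) v(2)])
next
  fix u f assume u: "u = poisson f" "f \<in> Dh \<omega>"
  show "0 \<le> Re (Dh_disk_ip \<omega> u u)"
    unfolding u(1) Dh_disk_ip_poisson[OF w u(2) u(2)] Dh_ip_self_Re[OF w u(2)] by simp
next
  fix u f assume u: "u = poisson f" "f \<in> Dh \<omega>" and z: "Dh_disk_ip \<omega> u u = 0"
  have "ip_norm (Dh_disk_ip \<omega>) (poisson f) = 0" using z by (simp add: ip_norm_def u(1))
  then have "l2norm circle f = 0"
    using component_le_ip_norm(1)[OF w u(2)] l2norm_nonneg[of circle f] by linarith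
  then have "poisson f x = 0" for x
    using poisson_bound[OF Dh_L2[OF u(2)], of x] poisson_outside[of x f] by (cases "x \<in> unit_disk") auto
  then show "u = (\<lambda>x. 0)" unfolding u(1) by blast
qed

lemma wirtinger_weighted_limit:
  assumes f: "\<And>n. f n \<in> L2 circle" and \<phi>: "\<phi> \<in> L2 circle"
    and lim: "(\<lambda>n. l2norm circle (\<lambda>\<zeta>. f n \<zeta> - \<phi> \<zeta>)) \<longlonglongrightarrow> 0" and z: "z \<in> unit_disk"
  shows "(\<lambda>n. wdz \<omega> (f n) z) \<longlonglongrightarrow> wdz \<omega> \<phi> z" "(\<lambda>n. wdzbar \<omega> (f n) z) \<longlonglongrightarrow> wdzbar \<omega> \<phi> z"
proof -
  let ?C = "((1 - cmod z) / 2)\<^sup>2"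
  have fi: "integrable circle (f n)" for n by (rule circle.L2_imp_integrable[OF f])
  have \<phi>i: "integrable circle \<phi>" by (rule circle.L2_imp_integrable[OF \<phi>])
  note d = L2_diff[OF f \<phi>]
  have l: "(\<lambda>n. l2norm circle (\<lambda>\<zeta>. f n \<zeta> - \<phi> \<zeta>) / ?C) \<longlonglongrightarrow> 0"
    using tendsto_divide_zero[OF lim] .
  have "(\<lambda>n. dz (poisson (f n)) z) \<longlonglongrightarrow> dz (poisson \<phi>) z"
  proof (rule LIM_zero_cancel, rule Lim_null_comparison[OF _ l], rule always_eventually, rule allI)
    fix n
    have "dz (poisson (\<lambda>\<zeta>. f n \<zeta> - \<phi> \<zeta>)) z = dz (poisson (f n)) z - dz (poisson \<phi>) z"
      using wirtinger_poisson_lincomb(1)[OF fi[of n] \<phi>i z, of 1 "-1"] by simp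
    then show "norm (dz (poisson (f n)) z - dz (poisson \<phi>) z) \<le> l2norm circle (\<lambda>\<zeta>. f n \<zeta> - \<phi> \<zeta>) / ?C"
      using wirtinger_poisson_bound(1)[OF d z, of n] by simp
  qed
  then show "(\<lambda>n. wdz \<omega> (f n) z) \<longlonglongrightarrow> wdz \<omega> \<phi> z"
    unfolding wdz_def weighted_def by (intro tendsto_mult tendsto_const)
  have "(\<lambda>n. dzbar (poisson (f n)) z) \<longlonglongrightarrow> dzbar (poisson \<phi>) z"
  proof (rule LIM_zero_cancel, rule Lim_null_comparison[OF _ l], rule always_eventually, rule allI)
    fix n
    have "dzbar (poisson (\<lambda>\<zeta>. f n \<zeta> - \<phi> \<zeta>)) z = dzbar (poisson (f n)) z - dzbar (poisson \<phi>) z"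
      using wirtinger_poisson_lincomb(2)[OF fi[of n] \<phi>i z, of 1 "-1"] by simp
    then show "norm (dzbar (poisson (f n)) z - dzbar (poisson \<phi>) z) \<le> l2norm circle (\<lambda>\<zeta>. f n \<zeta> - \<phi> \<zeta>) / ?C"
      using wirtinger_poisson_bound(2)[OF d z, of n] by simp
  qed
  then show "(\<lambda>n. wdzbar \<omega> (f n) z) \<longlonglongrightarrow> wdzbar \<omega> \<phi> z"
    unfolding wdzbar_def weighted_def by (intro tendsto_mult tendsto_const)
qed

lemma wdz_diff:
  assumes "integrable circle f" "integrable circle g" "z \<in> space area"
  shows "wdz \<omega> (\<lambda>\<zeta>. f \<zeta> - g \<zeta>) z = wdz \<omega> f z - wdz \<omega> g z"
    and "wdzbar \<omega> (\<lambda>\<zeta>. f \<zeta> - g \<zeta>) z = wdzbar \<omega> f z - wdzbar \<omega> g z"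
  using wdz_lincomb[OF assms, of \<omega> 1 "-1"] by simp_all

text \<open>The norm dominates the $L^2$ norm on the circle and those of the weighted Wirtinger derivatives on the disk. The
  limit \<open>\<phi>\<close> is found on the circle; there the convergence forces the derivatives of the Poisson
  integrals to converge pointwise to those of \<open>\<phi>\<close>, and Fatou's lemma turns this into convergence in
  the weighted norm.\<close>

lemma Dh_disk_complete:
  assumes w: "weight \<omega>" shows "complete_on (Dh_disk \<omega>) (Dh_disk_ip \<omega>)"
  unfolding complete_on_def
proof (intro allI impI, elim conjE)
  fix s :: "nat \<Rightarrow> complex \<Rightarrow> complex"
  let ?N = "ip_norm (Dh_disk_ip \<omega>)"
  assume "\<forall>n. s n \<in> Dh_disk \<omega>"
    and C: "\<forall>e>0. \<exists>N. \<forall>m\<ge>N. \<forall>n\<ge>N. ?N (\<lambda>x. s m x - s n x) < e"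
  then have "\<forall>n. \<exists>f. f \<in> Dh \<omega> \<and> s n = poisson f" unfolding Dh_disk_def by blast
  then obtain f where f: "\<And>n. f n \<in> Dh \<omega>" "\<And>n. s n = poisson (f n)" by metis
  note fi = Dh_integrable[OF f(1)] and fsq = Dh_L2[OF f(1)]
  have f1: "wdz \<omega> (f n) \<in> L2 area" "wdzbar \<omega> (f n) \<in> L2 area" for n
    using f(1)[of n] unfolding Dh_iff[OF w] by blast+
  have diff: "(\<lambda>x. s m x - poisson g x) = poisson (\<lambda>\<zeta>. f m \<zeta> - g \<zeta>)" if "g \<in> Dh \<omega>" for m g
    unfolding f(2) by (rule poisson_diff[OF fi Dh_integrable[OF that], symmetric])
  have Cauchy: "l2_Cauchy M u"
    if "\<And>m n. l2norm M (\<lambda>x. u m x - u n x) \<le> ?N (\<lambda>x. s m x - s n x)"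
    for M :: "complex measure" and u :: "nat \<Rightarrow> complex \<Rightarrow> complex"
    unfolding l2_Cauchy_def
  proof (intro allI impI)
    fix e :: real assume "e > 0"
    then obtain N where N: "\<forall>m\<ge>N. \<forall>n\<ge>N. ?N (\<lambda>x. s m x - s n x) < e" using C by blast
    then show "\<exists>N. \<forall>m\<ge>N. \<forall>n\<ge>N. l2norm M (\<lambda>x. u m x - u n x) < e"
      using that le_less_trans by blast
  qed
  have C0: "l2_Cauchy circle f"
  proof (rule Cauchy)
    show "l2norm circle (\<lambda>x. f m x - f n x) \<le> ?N (\<lambda>x. s m x - s n x)" for m n
      unfolding f(2)[of n] diff[OF f(1)] by (rule component_le_ip_norm(1)[OF w Dh_diff[OF w f(1) f(1)]])
  qed
  have C1: "l2_Cauchy area (\<lambda>n. wdz \<omega> (f n))"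
  proof (rule Cauchy)
    fix m n
    have "l2norm area (\<lambda>x. wdz \<omega> (f m) x - wdz \<omega> (f n) x) = l2norm area (wdz \<omega> (\<lambda>\<zeta>. f m \<zeta> - f n \<zeta>))"
      by (rule l2norm_cong) (rule wdz_diff(1)[OF fi fi, symmetric])
    then show "l2norm area (\<lambda>x. wdz \<omega> (f m) x - wdz \<omega> (f n) x) \<le> ?N (\<lambda>x. s m x - s n x)"
      unfolding f(2)[of n] diff[OF f(1)] using component_le_ip_norm(2)[OF w Dh_diff[OF w f(1) f(1)]] by simp
  qed
  have C2: "l2_Cauchy area (\<lambda>n. wdzbar \<omega> (f n))"
  proof (rule Cauchy)
    fix m n
    have "l2norm area (\<lambda>x. wdzbar \<omega> (f m) x - wdzbar \<omega> (f n) x) = l2norm area (wdzbar \<omega> (\<lambda>\<zeta>. f m \<zeta> - f n \<zeta>))"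
      by (rule l2norm_cong) (rule wdz_diff(2)[OF fi fi, symmetric])
    then show "l2norm area (\<lambda>x. wdzbar \<omega> (f m) x - wdzbar \<omega> (f n) x) \<le> ?N (\<lambda>x. s m x - s n x)"
      unfolding f(2)[of n] diff[OF f(1)] using component_le_ip_norm(3)[OF w Dh_diff[OF w f(1) f(1)]] by simp
  qed
  obtain \<phi> where \<phi>: "\<phi> \<in> L2 circle" "(\<lambda>n. l2norm circle (\<lambda>\<zeta>. f n \<zeta> - \<phi> \<zeta>)) \<longlonglongrightarrow> 0"
    using circle.l2_Cauchy_convergent[OF fsq C0] by blast
  have \<phi>i: "integrable circle \<phi>" by (rule circle.L2_imp_integrable[OF \<phi>(1)])
  have ae: "AE z in area. (\<lambda>n. wdz \<omega> (f n) z) \<longlonglongrightarrow> wdz \<omega> \<phi> z" "AE z in area. (\<lambda>n. wdzbar \<omega> (f n) z) \<longlonglongrightarrow> wdzbar \<omega> \<phi> z"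
    by (rule AE_I2, simp only: space_area, rule wirtinger_weighted_limit[OF fsq \<phi>], assumption)+
  note lim1 = l2_Cauchy_pointwise_limit[OF f1(1) wdz_measurable(1)[OF w \<phi>i] ae(1) C1]
  note lim2 = l2_Cauchy_pointwise_limit[OF f1(2) wdz_measurable(2)[OF w \<phi>i] ae(2) C2]
  have \<phi>D: "\<phi> \<in> Dh \<omega>" unfolding Dh_iff[OF w] using \<phi>(1) lim1(1) lim2(1) by blast
  have "?N (\<lambda>x. s n x - poisson \<phi> x) = sqrt ((l2norm circle (\<lambda>\<zeta>. f n \<zeta> - \<phi> \<zeta>))\<^sup>2
     + (l2norm area (\<lambda>z. wdz \<omega> (f n) z - wdz \<omega> \<phi> z))\<^sup>2 + (l2norm area (\<lambda>z. wdzbar \<omega> (f n) z - wdzbar \<omega> \<phi> z))\<^sup>2)" for n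
    unfolding diff[OF \<phi>D] ip_norm_Dh_disk[OF w Dh_diff[OF w f(1) \<phi>D]]
    by (simp only: l2norm_cong[OF wdz_diff(1)[OF fi \<phi>i]] l2norm_cong[OF wdz_diff(2)[OF fi \<phi>i]])
  moreover have "(\<lambda>n. sqrt ((l2norm circle (\<lambda>\<zeta>. f n \<zeta> - \<phi> \<zeta>))\<^sup>2
     + (l2norm area (\<lambda>z. wdz \<omega> (f n) z - wdz \<omega> \<phi> z))\<^sup>2 + (l2norm area (\<lambda>z. wdzbar \<omega> (f n) z - wdzbar \<omega> \<phi> z))\<^sup>2))
     \<longlonglongrightarrow> sqrt (0\<^sup>2 + 0\<^sup>2 + 0\<^sup>2)"
    by (intro tendsto_real_sqrt tendsto_add tendsto_power \<phi>(2) lim1(2) lim2(2))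
  ultimately have "(\<lambda>n. ?N (\<lambda>x. s n x - poisson \<phi> x)) \<longlonglongrightarrow> 0" by simp
  then show "\<exists>u\<in>Dh_disk \<omega>. (\<lambda>n. ?N (\<lambda>x. s n x - u x)) \<longlonglongrightarrow> 0"
    using \<phi>D unfolding Dh_disk_def by blast
qed

lemma Dh_disk_evaluation_bound:
  assumes w: "weight \<omega>" and z: "z \<in> unit_disk" and u: "u \<in> Dh_disk \<omega>"
  shows "cmod (u z) \<le> 3 / (1 - cmod z) * ip_norm (Dh_disk_ip \<omega>) u"
proof -
  obtain f where f: "f \<in> Dh \<omega>" "u = poisson f" using u unfolding Dh_disk_def by blast
  have "cmod (u z) \<le> 3 / (1 - cmod z) * l2norm circle f"
    unfolding f(2) by (rule poisson_bound[OF Dh_L2[OF f(1)] z])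
  also have "\<dots> \<le> 3 / (1 - cmod z) * ip_norm (Dh_disk_ip \<omega>) u"
    unfolding f(2) using z by (intro mult_left_mono component_le_ip_norm(1)[OF w f(1)]) auto
  finally show ?thesis .
qed

lemma Dh_disk_rkhs:
  assumes w: "weight \<omega>" shows "rkhs_on unit_disk (Dh_disk \<omega>) (Dh_disk_ip \<omega>)"
  unfolding rkhs_on_def
  using Dh_disk_function_space[OF w] Dh_disk_inner_product[OF w] Dh_disk_complete[OF w] Dh_disk_evaluation_bound[OF w]
  by blast

lemma Dh_evaluation_representer:
  assumes w: "weight \<omega>" and z: "z \<in> unit_disk"
  obtains K where "K \<in> Dh \<omega>" "\<And>f. f \<in> Dh \<omega> \<Longrightarrow> poisson f z = Dh_ip \<omega> f K"
proof -
  interpret inner_product_function_space unit_disk "Dh_disk \<omega>" "Dh_disk_ip \<omega>"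
    by unfold_locales (rule Dh_disk_function_space[OF w] Dh_disk_inner_product[OF w])+
  have "\<exists>v\<in>Dh_disk \<omega>. \<forall>u\<in>Dh_disk \<omega>. u z = Dh_disk_ip \<omega> u v"
    by (rule riesz_representation[OF Dh_disk_complete[OF w], where L = "\<lambda>u. u z" and C = "3 / (1 - cmod z)"],
        simp, simp, rule Dh_disk_evaluation_bound[OF w z], assumption)
  then obtain K where K: "K \<in> Dh \<omega>" "\<forall>u\<in>Dh_disk \<omega>. u z = Dh_disk_ip \<omega> u (poisson K)"
    unfolding Dh_disk_def by blast
  show ?thesis
  proof (rule that[OF K(1)])
    fix f assume f: "f \<in> Dh \<omega>"
    then have "poisson f \<in> Dh_disk \<omega>" unfolding Dh_disk_def by blast
    then show "poisson f z = Dh_ip \<omega> f K" using K(2) Dh_disk_ip_poisson[OF w f K(1)] by simp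
  qed
qed

section \<open>The holomorphic space and its kernel\<close>

lemma deriv_continuous:
  assumes "h holomorphic_on unit_disk" shows "continuous_on unit_disk (deriv h)"
  by (rule holomorphic_on_imp_continuous_on[OF holomorphic_deriv[OF assms open_ball]])

lemma Dhol_iff:
  assumes w: "weight \<omega>"
  shows "h \<in> Dhol \<omega> \<longleftrightarrow> h holomorphic_on unit_disk \<and> weighted \<omega> (deriv h) \<in> L2 area"
  unfolding Dhol_def using weighted_L2_iff[OF w deriv_continuous] by blast

lemma Dhol_holomorphic: "h \<in> Dhol \<omega> \<Longrightarrow> h holomorphic_on unit_disk"
  by (simp add: Dhol_def)

lemma wdz_holomorphic_plus_cnj:
  assumes h: "h holomorphic_on unit_disk" and g: "g holomorphic_on unit_disk"
    and F: "\<forall>z\<in>unit_disk. poisson F z = h z + cnj (g z)" and z: "z \<in> space area"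
  shows "wdz \<omega> F z = weighted \<omega> (deriv h) z" "wdzbar \<omega> F z = cnj (weighted \<omega> (deriv g) z)"
  using wirtinger_holomorphic_plus_cnj[OF h g F] z by (simp_all add: wdz_def wdzbar_def weighted_def)

lemma L2_cnj_iff: "(\<lambda>x. cnj (f x)) \<in> L2 M \<longleftrightarrow> f \<in> L2 M"
  using L2_cnj[of f M] L2_cnj[of "\<lambda>x. cnj (f x)" M] by auto

text \<open>The energy of \<open>F\<close> is the sum of the Dirichlet integrals of \<open>h\<close> and \<open>g\<close>.\<close>

lemma Dh_iff_Dhol:
  assumes w: "weight \<omega>" and h: "h holomorphic_on unit_disk" and g: "g holomorphic_on unit_disk"
    and F: "F \<in> L2 circle" "\<forall>z\<in>unit_disk. poisson F z = h z + cnj (g z)"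
  shows "F \<in> Dh \<omega> \<longleftrightarrow> h \<in> Dhol \<omega> \<and> g \<in> Dhol \<omega>"
proof -
  have "wdz \<omega> F \<in> L2 area \<longleftrightarrow> weighted \<omega> (deriv h) \<in> L2 area"
    by (rule L2_cong[OF wdz_holomorphic_plus_cnj(1)[OF h g F(2)]])
  moreover have "wdzbar \<omega> F \<in> L2 area \<longleftrightarrow> (\<lambda>z. cnj (weighted \<omega> (deriv g) z)) \<in> L2 area"
    by (rule L2_cong[OF wdz_holomorphic_plus_cnj(2)[OF h g F(2)]])
  ultimately show ?thesis using h g F(1) unfolding Dh_iff[OF w] Dhol_iff[OF w] L2_cnj_iff by blast
qed

lemma Dhol_ip_eq:
  assumes w: "weight \<omega>"
  shows "Dhol_ip \<omega> f g = (\<integral>\<zeta>. boundary f \<zeta> * cnj (boundary g \<zeta>) \<partial>circle)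
    + (\<integral>z. weighted \<omega> (deriv f) z * cnj (weighted \<omega> (deriv g) z) \<partial>area)"
proof -
  have "(\<integral>z. weighted \<omega> (deriv f) z * cnj (weighted \<omega> (deriv g) z) \<partial>area) =
    (\<integral>z. deriv f z * cnj (deriv g z) * complex_of_real (\<omega> z) \<partial>area)"
    by (rule Bochner_Integration.integral_cong[OF refl]) (simp only: space_area weighted_mult[OF w])
  then show ?thesis by (simp add: Dhol_ip_def L2_ip_def)
qed

lemma Dhol_ip_cnj: "weight \<omega> \<Longrightarrow> Dhol_ip \<omega> g f = cnj (Dhol_ip \<omega> f g)"
  by (simp only: Dhol_ip_eq complex_cnj_add integral_ip_cnj[of _ "boundary g" "boundary f"]
      integral_ip_cnj[of _ "weighted \<omega> (deriv g)" "weighted \<omega> (deriv f)"])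

lemma boundary_unique:
  assumes f: "f \<in> Hardy2" and \<phi>: "integrable circle \<phi>" and eq: "\<And>z. z \<in> unit_disk \<Longrightarrow> poisson \<phi> z = f z"
  shows "AE \<zeta> in circle. boundary f \<zeta> = \<phi> \<zeta>"
proof -
  have "poisson (boundary f) z = poisson \<phi> z" for z
    using poisson_boundary[OF f, of z] eq[of z] by (cases "z \<in> unit_disk") (simp_all add: poisson_outside)
  then have "poisson (boundary f) = poisson \<phi>" by (rule ext)
  then show ?thesis
    using poisson_eq_iff[OF circle.L2_imp_integrable[OF boundary_Hardy2(1)[OF f]] \<phi>] by blast
qed

lemma poisson_boundary_pair:
  assumes h: "h \<in> Hardy2" and g: "g \<in> Hardy2" and z: "z \<in> unit_disk"
  shows "poisson (\<lambda>\<zeta>. boundary h \<zeta> + cnj (boundary g \<zeta>)) z = h z + cnj (g z)"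
proof -
  have i: "integrable circle (boundary h)" "integrable circle (\<lambda>\<zeta>. cnj (boundary g \<zeta>))"
    using circle.L2_imp_integrable[OF boundary_Hardy2(1)[OF h]]
      circle.L2_imp_integrable[OF boundary_Hardy2(1)[OF g]] by simp_all
  show ?thesis
    unfolding poisson_add[OF i] poisson_cnj poisson_boundary[OF h z] poisson_boundary[OF g z] ..
qed

lemma boundary_pair_unique:
  assumes h: "h \<in> Hardy2" and g: "g \<in> Hardy2" and F: "integrable circle F"
    and eq: "\<forall>z\<in>unit_disk. poisson F z = h z + cnj (g z)"
  shows "AE \<zeta> in circle. F \<zeta> = boundary h \<zeta> + cnj (boundary g \<zeta>)"
proof -
  have "poisson F z = poisson (\<lambda>\<zeta>. boundary h \<zeta> + cnj (boundary g \<zeta>)) z" for z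
    using poisson_boundary_pair[OF h g, of z] eq by (cases "z \<in> unit_disk") (simp_all add: poisson_outside)
  then have "poisson F = poisson (\<lambda>\<zeta>. boundary h \<zeta> + cnj (boundary g \<zeta>))" by (rule ext)
  moreover have "integrable circle (\<lambda>\<zeta>. boundary h \<zeta> + cnj (boundary g \<zeta>))"
    by (intro circle.L2_imp_integrable L2_add L2_cnj boundary_Hardy2(1) h g)
  ultimately show ?thesis using poisson_eq_iff[OF F] by blast
qed

text \<open>Multiply out \<open>(h + cnj g) * cnj (k + cnj l)\<close> on the circle. The mixed terms are products of two
  boundary functions or of two conjugates and integrate to products of values at \<open>0\<close>; in the
  energy the mixed terms vanish identically.\<close>

lemma Dh_ip_decomposition:
  assumes w: "weight \<omega>" and sub: "Dhol \<omega> \<subseteq> Hardy2"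
    and D: "h \<in> Dhol \<omega>" "g \<in> Dhol \<omega>" "k \<in> Dhol \<omega>" "l \<in> Dhol \<omega>"
    and F: "F \<in> Dh \<omega>" "\<forall>z\<in>unit_disk. poisson F z = h z + cnj (g z)"
    and K: "K \<in> Dh \<omega>" "\<forall>z\<in>unit_disk. poisson K z = k z + cnj (l z)"
  shows "Dh_ip \<omega> F K = Dhol_ip \<omega> h k + cnj (Dhol_ip \<omega> g l) + h 0 * l 0 + cnj (g 0 * k 0)"
proof -
  have H: "h \<in> Hardy2" "g \<in> Hardy2" "k \<in> Hardy2" "l \<in> Hardy2" using D sub by blast+
  note sq = boundary_Hardy2(1)[OF H(1)] boundary_Hardy2(1)[OF H(2)] boundary_Hardy2(1)[OF H(3)] boundary_Hardy2(1)[OF H(4)]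
  note hol = Dhol_holomorphic[OF D(1)] Dhol_holomorphic[OF D(2)] Dhol_holomorphic[OF D(3)] Dhol_holomorphic[OF D(4)]
  let ?h = "boundary h" and ?g = "boundary g" and ?k = "boundary k" and ?l = "boundary l"
  have aeF: "AE \<zeta> in circle. F \<zeta> = ?h \<zeta> + cnj (?g \<zeta>)"
    by (rule boundary_pair_unique[OF H(1,2) Dh_integrable[OF F(1)] F(2)])
  have aeK: "AE \<zeta> in circle. K \<zeta> = ?k \<zeta> + cnj (?l \<zeta>)"
    by (rule boundary_pair_unique[OF H(3,4) Dh_integrable[OF K(1)] K(2)])
  have m: "(\<lambda>\<zeta>. F \<zeta> * cnj (K \<zeta>)) \<in> borel_measurable circle"
    by (rule borel_measurable_integrable[OF integrable_ip[OF Dh_L2[OF F(1)] Dh_L2[OF K(1)]]])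
  note i = integrable_ip[OF sq(1,3)] L2_mult[OF sq(1,4)]
    integrable_cnj_iff[THEN iffD2, OF L2_mult[OF sq(2,3)]] integrable_cnj_iff[THEN iffD2, OF integrable_ip[OF sq(2,4)]]
  have "(\<integral>\<zeta>. F \<zeta> * cnj (K \<zeta>) \<partial>circle) =
     (\<integral>\<zeta>. ?h \<zeta> * cnj (?k \<zeta>) + ?h \<zeta> * ?l \<zeta> + cnj (?g \<zeta> * ?k \<zeta>) + cnj (?g \<zeta> * cnj (?l \<zeta>)) \<partial>circle)"
  proof (rule integral_cong_AE[OF m])
    show "(\<lambda>\<zeta>. ?h \<zeta> * cnj (?k \<zeta>) + ?h \<zeta> * ?l \<zeta> + cnj (?g \<zeta> * ?k \<zeta>) + cnj (?g \<zeta> * cnj (?l \<zeta>))) \<in> borel_measurable circle"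
      by (intro borel_measurable_integrable Bochner_Integration.integrable_add i)
    show "AE \<zeta> in circle. F \<zeta> * cnj (K \<zeta>) = ?h \<zeta> * cnj (?k \<zeta>) + ?h \<zeta> * ?l \<zeta> + cnj (?g \<zeta> * ?k \<zeta>) + cnj (?g \<zeta> * cnj (?l \<zeta>))"
      using aeF aeK by eventually_elim (simp add: algebra_simps)
  qed
  also have "\<dots> = (\<integral>\<zeta>. ?h \<zeta> * cnj (?k \<zeta>) \<partial>circle) + (\<integral>\<zeta>. ?h \<zeta> * ?l \<zeta> \<partial>circle)
     + (\<integral>\<zeta>. cnj (?g \<zeta> * ?k \<zeta>) \<partial>circle) + (\<integral>\<zeta>. cnj (?g \<zeta> * cnj (?l \<zeta>)) \<partial>circle)"
    by (simp only: Bochner_Integration.integral_add Bochner_Integration.integrable_add i)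
  also have "\<dots> = (\<integral>\<zeta>. ?h \<zeta> * cnj (?k \<zeta>) \<partial>circle) + h 0 * l 0 + cnj (g 0 * k 0) + cnj (\<integral>\<zeta>. ?g \<zeta> * cnj (?l \<zeta>) \<partial>circle)"
    by (simp only: Bochner_Integration.integral_cnj boundary_mult_integral[OF H(1,4)] boundary_mult_integral[OF H(2,3)])
  finally have 1: "(\<integral>\<zeta>. F \<zeta> * cnj (K \<zeta>) \<partial>circle) =
     (\<integral>\<zeta>. ?h \<zeta> * cnj (?k \<zeta>) \<partial>circle) + h 0 * l 0 + cnj (g 0 * k 0) + cnj (\<integral>\<zeta>. ?g \<zeta> * cnj (?l \<zeta>) \<partial>circle)" .
  have 2: "(\<integral>z. wdz \<omega> F z * cnj (wdz \<omega> K z) \<partial>area) =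
     (\<integral>z. weighted \<omega> (deriv h) z * cnj (weighted \<omega> (deriv k) z) \<partial>area)"
    by (rule Bochner_Integration.integral_cong[OF refl])
       (simp only: wdz_holomorphic_plus_cnj(1)[OF hol(1,2) F(2)] wdz_holomorphic_plus_cnj(1)[OF hol(3,4) K(2)])
  have "(\<integral>z. wdzbar \<omega> F z * cnj (wdzbar \<omega> K z) \<partial>area) =
     (\<integral>z. cnj (weighted \<omega> (deriv g) z * cnj (weighted \<omega> (deriv l) z)) \<partial>area)"
    by (rule Bochner_Integration.integral_cong[OF refl])
       (simp only: wdz_holomorphic_plus_cnj(2)[OF hol(1,2) F(2)] wdz_holomorphic_plus_cnj(2)[OF hol(3,4) K(2)] complex_cnj_mult)
  then have 3: "(\<integral>z. wdzbar \<omega> F z * cnj (wdzbar \<omega> K z) \<partial>area) =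
     cnj (\<integral>z. weighted \<omega> (deriv g) z * cnj (weighted \<omega> (deriv l) z) \<partial>area)"
    by (simp only: Bochner_Integration.integral_cnj)
  show ?thesis
    unfolding Dh_ip_eq[OF w F(1) K(1)] 1 2 3 Dhol_ip_eq[OF w] by (simp add: algebra_simps)
qed

lemma Dhol_const: "(\<lambda>z. c) \<in> Dhol \<omega>"
  unfolding Dhol_def by simp

lemma Dhol_diff_const:
  assumes w: "weight \<omega>" and h: "h \<in> Dhol \<omega>"
  shows "(\<lambda>z. h z - c) \<in> Dhol \<omega>" "z \<in> unit_disk \<Longrightarrow> deriv (\<lambda>z. h z - c) z = deriv h z"
proof -
  note hol = Dhol_holomorphic[OF h]
  have d: "deriv (\<lambda>z. h z - c) z = deriv h z" if z: "z \<in> unit_disk" for z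
  proof (rule DERIV_imp_deriv)
    have "((\<lambda>z. h z - c) has_field_derivative deriv h z - 0) (at z)"
      by (intro DERIV_diff DERIV_const holomorphic_derivI[OF hol open_ball z])
    then show "((\<lambda>z. h z - c) has_field_derivative deriv h z) (at z)" by simp
  qed
  then show "z \<in> unit_disk \<Longrightarrow> deriv (\<lambda>z. h z - c) z = deriv h z" .
  have "weighted \<omega> (deriv (\<lambda>z. h z - c)) \<in> L2 area \<longleftrightarrow> weighted \<omega> (deriv h) \<in> L2 area"
    by (rule L2_cong) (simp add: weighted_def d)
  then show "(\<lambda>z. h z - c) \<in> Dhol \<omega>"
    using h unfolding Dhol_iff[OF w] by (auto intro: holomorphic_on_diff)
qed

lemma poisson_const: "z \<in> unit_disk \<Longrightarrow> poisson (\<lambda>\<zeta>. c) z = c"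
  using poisson_dilate[of "\<lambda>z. c" 0 z] by (simp add: dilate_def[abs_def])

lemma boundary_integral:
  assumes f: "f \<in> Hardy2" shows "(\<integral>\<zeta>. boundary f \<zeta> \<partial>circle) = f 0"
proof -
  have "(\<integral>\<zeta>. boundary f \<zeta> \<partial>circle) = (\<integral>\<zeta>. poisson_kernel 0 \<zeta> * boundary f \<zeta> \<partial>circle)"
    by (rule Bochner_Integration.integral_cong[OF refl]) simp
  also have "\<dots> = poisson (boundary f) 0" by (simp add: poisson_def)
  finally show ?thesis using poisson_boundary[OF f, of 0] by simp
qed

text \<open>Subtracting a constant leaves the energy unchanged, and the mean of a boundary function is the value
  at \<open>0\<close>.\<close>

lemma Dhol_ip_diff_const:
  assumes w: "weight \<omega>" and sub: "Dhol \<omega> \<subseteq> Hardy2" and g: "g \<in> Dhol \<omega>" and k: "k \<in> Dhol \<omega>"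
  shows "Dhol_ip \<omega> g (\<lambda>z. k z - c) = Dhol_ip \<omega> g k - cnj c * g 0"
proof -
  have H: "g \<in> Hardy2" "k \<in> Hardy2" "(\<lambda>z. k z - c) \<in> Hardy2" using sub g k Dhol_diff_const(1)[OF w k] by blast+
  have i: "integrable circle (boundary k)" by (rule circle.L2_imp_integrable[OF boundary_Hardy2(1)[OF H(2)]])
  have ci: "integrable circle (\<lambda>\<zeta>. c)" by (rule circle.L2_imp_integrable[OF circle.L2_const])
  have ae: "AE \<zeta> in circle. boundary (\<lambda>z. k z - c) \<zeta> = boundary k \<zeta> - c"
  proof (rule boundary_unique[OF H(3)])
    show "integrable circle (\<lambda>\<zeta>. boundary k \<zeta> - c)" by (rule Bochner_Integration.integrable_diff[OF i ci])
    show "poisson (\<lambda>\<zeta>. boundary k \<zeta> - c) z = k z - c" if "z \<in> unit_disk" for z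
      unfolding poisson_diff[OF i ci] poisson_boundary[OF H(2) that] poisson_const[OF that] ..
  qed
  note bsq = boundary_Hardy2(1)[OF H(1)]
  note bi = integrable_ip[OF bsq boundary_Hardy2(1)[OF H(2)]] circle.L2_imp_integrable[OF bsq]
  have "(\<integral>\<zeta>. boundary g \<zeta> * cnj (boundary (\<lambda>z. k z - c) \<zeta>) \<partial>circle) =
     (\<integral>\<zeta>. boundary g \<zeta> * cnj (boundary k \<zeta>) - cnj c * boundary g \<zeta> \<partial>circle)"
  proof (rule integral_cong_AE)
    show "(\<lambda>\<zeta>. boundary g \<zeta> * cnj (boundary (\<lambda>z. k z - c) \<zeta>)) \<in> borel_measurable circle"
      by (rule borel_measurable_integrable[OF integrable_ip[OF bsq boundary_Hardy2(1)[OF H(3)]]])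
    show "(\<lambda>\<zeta>. boundary g \<zeta> * cnj (boundary k \<zeta>) - cnj c * boundary g \<zeta>) \<in> borel_measurable circle"
      using bi by (intro borel_measurable_integrable Bochner_Integration.integrable_diff integrable_mult_right)
    show "AE \<zeta> in circle. boundary g \<zeta> * cnj (boundary (\<lambda>z. k z - c) \<zeta>) = boundary g \<zeta> * cnj (boundary k \<zeta>) - cnj c * boundary g \<zeta>"
      using ae by eventually_elim (simp add: right_diff_distrib mult.commute)
  qed
  also have "\<dots> = (\<integral>\<zeta>. boundary g \<zeta> * cnj (boundary k \<zeta>) \<partial>circle) - cnj c * g 0"
    using bi by (simp add: boundary_integral[OF H(1)])
  finally have 1: "(\<integral>\<zeta>. boundary g \<zeta> * cnj (boundary (\<lambda>z. k z - c) \<zeta>) \<partial>circle) =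
     (\<integral>\<zeta>. boundary g \<zeta> * cnj (boundary k \<zeta>) \<partial>circle) - cnj c * g 0" .
  have 2: "(\<integral>z. weighted \<omega> (deriv g) z * cnj (weighted \<omega> (deriv (\<lambda>z. k z - c)) z) \<partial>area) =
     (\<integral>z. weighted \<omega> (deriv g) z * cnj (weighted \<omega> (deriv k) z) \<partial>area)"
    by (rule Bochner_Integration.integral_cong[OF refl]) (simp add: weighted_def Dhol_diff_const(2)[OF w k])
  show ?thesis unfolding Dhol_ip_eq[OF w] 1 2 by simp
qed

lemma Dhol_ip_const:
  assumes w: "weight \<omega>" and sub: "Dhol \<omega> \<subseteq> Hardy2" and g: "g \<in> Dhol \<omega>"
  shows "Dhol_ip \<omega> g (\<lambda>z. c) = cnj c * g 0"
proof -
  have "Dhol_ip \<omega> g (\<lambda>z. c) = Dhol_ip \<omega> g (\<lambda>z. 0) + cnj c * g 0"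
    using Dhol_ip_diff_const[OF w sub g Dhol_const[of 0], of "- c"] by simp
  moreover have "Dhol_ip \<omega> g (\<lambda>z. 0) = 0"
  proof -
    have H: "(\<lambda>z. 0) \<in> Hardy2" using sub Dhol_const by blast
    have ae: "AE \<zeta> in circle. boundary (\<lambda>z. 0) \<zeta> = 0"
      by (rule boundary_unique[OF H]) (simp_all add: poisson_const)
    have "(\<integral>\<zeta>. boundary g \<zeta> * cnj (boundary (\<lambda>z. 0) \<zeta>) \<partial>circle) = 0"
      by (rule integral_eq_zero_AE) (use ae in \<open>eventually_elim, simp\<close>)
    then show ?thesis unfolding Dhol_ip_eq[OF w] by (simp add: weighted_def)
  qed
  ultimately show ?thesis by simp
qed

lemma Dh_szego_parts:
  assumes w: "weight \<omega>" and f: "f \<in> Dh \<omega>"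
  shows "szego f \<in> Dhol \<omega>" "antiszego f \<in> Dhol \<omega>" "\<forall>z\<in>unit_disk. poisson f z = szego f z + cnj (antiszego f z)"
proof -
  note fi = Dh_integrable[OF f]
  show eq: "\<forall>z\<in>unit_disk. poisson f z = szego f z + cnj (antiszego f z)"
    using poisson_eq_szego[OF fi] by blast
  show "szego f \<in> Dhol \<omega>" "antiszego f \<in> Dhol \<omega>"
    using Dh_iff_Dhol[OF w szego_holomorphic[OF fi] antiszego_holomorphic[OF fi] Dh_L2[OF f] eq] f by blast+
qed

text \<open>The boundary map embeds \<open>Dhol \<omega>\<close> in \<open>Dh \<omega>\<close> as the functions with vanishing antiholomorphic part.\<close>

lemma boundary_in_Dh:
  assumes w: "weight \<omega>" and sub: "Dhol \<omega> \<subseteq> Hardy2" and f: "f \<in> Dhol \<omega>"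
  shows "boundary f \<in> Dh \<omega>" "\<forall>z\<in>unit_disk. poisson (boundary f) z = f z + cnj 0"
proof -
  have H: "f \<in> Hardy2" using sub f by blast
  show eq: "\<forall>z\<in>unit_disk. poisson (boundary f) z = f z + cnj 0" using poisson_boundary[OF H] by simp
  show "boundary f \<in> Dh \<omega>"
    using Dh_iff_Dhol[OF w Dhol_holomorphic[OF f] _ boundary_Hardy2(1)[OF H], of "\<lambda>z. 0"] eq f Dhol_const[of 0]
    by simp
qed

text \<open>Evaluation at \<open>z\<close> is represented on \<open>Dh \<omega>\<close> by some \<open>K\<close>. For boundary functions of elements of
  \<open>Dhol \<omega>\<close> the antiholomorphic part of \<open>K\<close>, which vanishes at \<open>0\<close>, does not contribute to the inner product, so
  the holomorphic part of \<open>K\<close> is the kernel.\<close>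

lemma Dhol_kernel_exists:
  assumes w: "weight \<omega>" and sub: "Dhol \<omega> \<subseteq> Hardy2"
  shows "\<exists>k. reproducing_kernel unit_disk (Dhol \<omega>) (Dhol_ip \<omega>) k"
proof -
  have "\<exists>k\<in>Dhol \<omega>. \<forall>f\<in>Dhol \<omega>. f z = Dhol_ip \<omega> f k" if z: "z \<in> unit_disk" for z
  proof -
    obtain K where K: "K \<in> Dh \<omega>" "\<And>f. f \<in> Dh \<omega> \<Longrightarrow> poisson f z = Dh_ip \<omega> f K"
      using Dh_evaluation_representer[OF w z] by blast
    note P = Dh_szego_parts[OF w K(1)]
    have "f z = Dhol_ip \<omega> f (szego K)" if f: "f \<in> Dhol \<omega>" for f
    proof -
      note B = boundary_in_Dh[OF w sub f]
      have "f z = poisson (boundary f) z" using B(2) z by simp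
      also have "\<dots> = Dh_ip \<omega> (boundary f) K" by (rule K(2)[OF B(1)])
      also have "\<dots> = Dhol_ip \<omega> f (szego K) + cnj (Dhol_ip \<omega> (\<lambda>z. 0) (antiszego K)) + f 0 * antiszego K 0 + cnj (0 * szego K 0)"
        by (rule Dh_ip_decomposition[OF w sub f Dhol_const P(1,2) B K(1) P(3)])
      also have "\<dots> = Dhol_ip \<omega> f (szego K)"
        using Dhol_ip_const[OF w sub P(2), of 0] Dhol_ip_cnj[OF w, of "\<lambda>z. 0" "antiszego K"] by simp
      finally show ?thesis .
    qed
    with P(1) show ?thesis by blast
  qed
  then have "\<forall>z. \<exists>k. z \<in> unit_disk \<longrightarrow> k \<in> Dhol \<omega> \<and> (\<forall>f\<in>Dhol \<omega>. f z = Dhol_ip \<omega> f k)" by blast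
  then obtain \<kappa> where \<kappa>: "\<And>z. z \<in> unit_disk \<Longrightarrow> \<kappa> z \<in> Dhol \<omega> \<and> (\<forall>f\<in>Dhol \<omega>. f z = Dhol_ip \<omega> f (\<kappa> z))" by metis
  have "reproducing_kernel unit_disk (Dhol \<omega>) (Dhol_ip \<omega>) (\<lambda>w z. \<kappa> z w)"
    unfolding reproducing_kernel_def using \<kappa> by blast
  then show ?thesis by blast
qed

lemma Dhol_kernel_reproducing:
  assumes w: "weight \<omega>" and sub: "Dhol \<omega> \<subseteq> Hardy2"
  shows "reproducing_kernel unit_disk (Dhol \<omega>) (Dhol_ip \<omega>) (Dhol_kernel \<omega>)"
  unfolding Dhol_kernel_def by (rule someI_ex[OF Dhol_kernel_exists[OF assms]])

text \<open>Since \<open>2 * Re k - 1 = k + cnj (k - 1)\<close>, the inner product with \<open>f\<close> splits into the reproducing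
  formulas for the two holomorphic parts of \<open>f\<close>. The values at \<open>0\<close> enter through \<open>k 0 = 1\<close>, which is the
  reproducing formula applied to the constant function \<open>1\<close>, and through the normalization of \<open>antiszego f\<close>.\<close>

lemma Dh_representation:
  assumes w: "weight \<omega>" and sub: "Dhol \<omega> \<subseteq> Hardy2" and k: "k \<in> Dhol \<omega>"
    and repr: "\<And>f. f \<in> Dhol \<omega> \<Longrightarrow> f z = Dhol_ip \<omega> f k" and z: "z \<in> unit_disk"
  defines "K \<equiv> \<lambda>\<zeta>. complex_of_real (2 * Re (boundary k \<zeta>) - 1)"
  shows "K \<in> Dh \<omega>" "f \<in> Dh \<omega> \<Longrightarrow> poisson f z = Dh_ip \<omega> f K"
proof -
  have H: "k \<in> Hardy2" using sub k by blast
  note ksq = boundary_Hardy2(1)[OF H]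
  have K_eq: "K = (\<lambda>\<zeta>. (boundary k \<zeta> + cnj (boundary k \<zeta>)) - 1)"
    by (simp add: K_def fun_eq_iff complex_eq_iff)
  have Ksq: "K \<in> L2 circle"
    unfolding K_eq by (intro L2_diff L2_add L2_cnj ksq circle.L2_const)
  have i: "integrable circle (\<lambda>\<zeta>. boundary k \<zeta> + cnj (boundary k \<zeta>))" "integrable circle (\<lambda>\<zeta>. 1 :: complex)"
    by (intro circle.L2_imp_integrable L2_add L2_cnj ksq circle.L2_const)+
  note k1 = Dhol_diff_const(1)[OF w k, of 1]
  have PK: "\<forall>z\<in>unit_disk. poisson K z = k z + cnj (k z - 1)"
    unfolding K_eq poisson_diff[OF i] using poisson_boundary_pair[OF H H] poisson_const[of _ 1] by simp
  show KD: "K \<in> Dh \<omega>"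
    using Dh_iff_Dhol[OF w Dhol_holomorphic[OF k] Dhol_holomorphic[OF k1] Ksq PK] k k1 by blast
  have k0: "k 0 = 1"
  proof -
    have "1 = Dhol_ip \<omega> (\<lambda>z. 1) k" using repr[OF Dhol_const[of 1]] .
    also have "\<dots> = cnj (k 0)" using Dhol_ip_cnj[OF w, of "\<lambda>z. 1" k] Dhol_ip_const[OF w sub k, of 1] by simp
    finally have "cnj (k 0) = 1" by simp
    then show ?thesis by (metis complex_cnj_cnj complex_cnj_one)
  qed
  show "poisson f z = Dh_ip \<omega> f K" if f: "f \<in> Dh \<omega>"
  proof -
    note P = Dh_szego_parts[OF w f]
    have "Dh_ip \<omega> f K = Dhol_ip \<omega> (szego f) k + cnj (Dhol_ip \<omega> (antiszego f) (\<lambda>z. k z - 1))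
       + szego f 0 * (k 0 - 1) + cnj (antiszego f 0 * k 0)"
      by (rule Dh_ip_decomposition[OF w sub P(1,2) k k1 f P(3) KD PK])
    also have "\<dots> = szego f z + cnj (antiszego f z)"
      by (simp add: Dhol_ip_diff_const[OF w sub P(2) k] k0 repr[OF P(1)] repr[OF P(2)])
    also have "\<dots> = poisson f z" using P(3) z by simp
    finally show ?thesis by simp
  qed
qed

theorem proposition3p1:
  fixes \<omega> :: "complex \<Rightarrow> real"
  assumes "weight \<omega>"
    and "Dhol \<omega> \<subseteq> Hardy2"
  shows "(\<forall>f\<in>Dh \<omega>. harmonic_on (poisson f) unit_disk) \<and>
    (\<forall>f\<in>Dh \<omega>. \<forall>g\<in>Dh \<omega>. poisson f = poisson g \<longleftrightarrow> (AE \<zeta> in circle. f \<zeta> = g \<zeta>)) \<and>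
    (\<forall>f\<in>Dh \<omega>. \<forall>g\<in>Dh \<omega>. Dh_disk_ip \<omega> (poisson f) (poisson g) = Dh_ip \<omega> f g) \<and>
    rkhs_on unit_disk (Dh_disk \<omega>) (Dh_disk_ip \<omega>) \<and>
    (\<forall>z\<in>unit_disk.
       (\<lambda>\<zeta>. complex_of_real (2 * Re (boundary (\<lambda>w. Dhol_kernel \<omega> w z) \<zeta>) - 1)) \<in> Dh \<omega> \<and>
       (\<forall>f\<in>Dh \<omega>. poisson f z =
          Dh_ip \<omega> f (\<lambda>\<zeta>. complex_of_real (2 * Re (boundary (\<lambda>w. Dhol_kernel \<omega> w z) \<zeta>) - 1))))"
proof (intro conjI ballI)
  note w = assms(1) and sub = assms(2)
  show "harmonic_on (poisson f) unit_disk" if "f \<in> Dh \<omega>" for f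
    using Dh_szego_parts[OF w that]
    by (intro harmonic_holomorphic_plus_cnj[of "szego f" "antiszego f"] Dhol_holomorphic)
  show "poisson f = poisson g \<longleftrightarrow> (AE \<zeta> in circle. f \<zeta> = g \<zeta>)" if "f \<in> Dh \<omega>" "g \<in> Dh \<omega>" for f g
    by (rule poisson_eq_iff[OF Dh_integrable[OF that(1)] Dh_integrable[OF that(2)]])
  show "Dh_disk_ip \<omega> (poisson f) (poisson g) = Dh_ip \<omega> f g" if "f \<in> Dh \<omega>" "g \<in> Dh \<omega>" for f g
    by (rule Dh_disk_ip_poisson[OF w that])
  show "rkhs_on unit_disk (Dh_disk \<omega>) (Dh_disk_ip \<omega>)" by (rule Dh_disk_rkhs[OF w])
  fix z assume z: "z \<in> unit_disk"
  have k: "(\<lambda>w. Dhol_kernel \<omega> w z) \<in> Dhol \<omega>"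
    and repr: "\<And>f. f \<in> Dhol \<omega> \<Longrightarrow> f z = Dhol_ip \<omega> f (\<lambda>w. Dhol_kernel \<omega> w z)"
    using Dhol_kernel_reproducing[OF w sub] z unfolding reproducing_kernel_def by blast+
  note R = Dh_representation[OF w sub k repr z]
  show "(\<lambda>\<zeta>. complex_of_real (2 * Re (boundary (\<lambda>w. Dhol_kernel \<omega> w z) \<zeta>) - 1)) \<in> Dh \<omega>"
    by (rule R(1))
  show "poisson f z = Dh_ip \<omega> f (\<lambda>\<zeta>. complex_of_real (2 * Re (boundary (\<lambda>w. Dhol_kernel \<omega> w z) \<zeta>) - 1))"
    if "f \<in> Dh \<omega>" for f
    by (rule R(2)[OF _ that])
qed

end
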